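(* Let $y_{\rm qc}\in\mathcal{Y}^h$ (with $y_{\rm qc}'>0$) be a local minimizer of $E_{\rm qc}$ over $\mathcal{Y}^h$ such that $\min_\ell(y_{\rm qc})'_\ell\ge r_*/2$ and $A_*(y_{\rm qc})>0$. Then there exists $\tau_0>0$, not depending on $y_{\rm a}$, such that the following holds for every $\tau\in(0,\tau_0]$: if $y_{\rm a}\in\mathcal{Y}^\varepsilon$ (with $y_{\rm a}'>0$) is a local minimizer of $E_{\rm a}$ over $\mathcal{Y}^\varepsilon$ satisfying $\|y_{\rm a}'-y_{\rm qc}'\|_{L^\infty(\Omega)}\le\tau$, then $$\|y_{\rm a}'-(I_\varepsilon y_{\rm qc})'\|_{L^2(\Omega)}\le\frac{2}{A_*(y_{\rm qc})}\big(\eta(y_{\rm qc})+\eta^f+\eta^q\big).$$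
   Context: Atomistic model. Fix $N\in\mathbb{N}$, $F>0$, $\varepsilon=1/(2N)$. $\phi\in C^3(0,\infty)$ is a potential for which there is $r_*>0$ such that $\phi$ is convex on $(0,r_* )$ and concave on $(r_*,\infty)$. A lattice function $v\in\mathbb{R}^{\mathbb{Z}}$ is identified with its continuous piecewise affine interpolant with $v(\varepsilon\ell)=v_\ell$; conversely a continuous $g$ is identified with its nodal values $g_\ell=g(\varepsilon\ell)$ where a lattice function is needed, and $I_\varepsilon g$ denotes the piecewise affine interpolant of $(g(\varepsilon\ell))_\ell$. $v'_\ell:=(v_\ell-v_{\ell-1})/\varepsilon$. $\mathcal{U}^\varepsilon:=\{u\in\mathbb{R}^{\mathbb{Z}}:u_{\ell+2N}=u_\ell,\ u_0=0\}$, $\mathcal{Y}^\varepsilon:=\{y\in\mathbb{R}^{\mathbb{Z}}:y_{\ell+2N}=F+y_\ell,\ y_0=0\}$. $f\in C^0(\mathbb{R})$ is 1-periodic. $E_{\rm a}(y)=\mathcal{E}_{\rm a}(y)-\langle f,y-Fx\rangle_\varepsilon$, where $\mathcal{E}_{\rm a}(y)=\varepsilon\sum_{\ell=-N+1}^N[\phi(y_\ell')+\phi(y_{\ell-1}'+y_\ell')]=\varepsilon\sum_{b\in\mathcal{B}}\phi(r_bD_by)$ and $\langle f,u\rangle_\varepsilon=\varepsilon\sum_{\ell=-N+1}^Nf_\ell u_\ell$. Energies are considered on deformations with positive gradient. $A_*(y):=\min_{\ell=-N+1,\dots,N}A_\ell(y)$ with $A_\ell(y):=\phi''(y_\ell')+2\phi''(y_{\ell-1}'+y_\ell')+2\phi''(y_\ell'+y_{\ell+1}')$.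 Bonds. $\mathcal{B}:=\{(\ell\varepsilon,(\ell+j)\varepsilon):j=1,2;\ \ell=-N+1,\dots,N\}$ (open intervals); $r_b:=j$. For an open interval $\omega=(L,R)$ with $|\omega|=R-L>0$, $D_\omega v:=(v(R)-v(L))/|\omega|$. Mesh. $\Omega=[-1/2,1/2]$; $\Omega_{\rm a}=(L_{\rm a},R_{\rm a})$ with $-1/2<L_{\rm a}<R_{\rm a}<1/2$; $\Omega_{\rm c}=\Omega\setminus\Omega_{\rm a}$; $\Omega_{\rm a}^\#=\Omega_{\rm a}+\mathbb{Z}$, $\Omega_{\rm c}^\#=\Omega_{\rm c}+\mathbb{Z}$. $\mathcal{T}^h$ is a partition of $\mathbb{R}$ into closed intervals $T_k^h=[x_{k-1}^h,x_k^h]$ ($k\in\mathbb{Z}$, $x^h_{k-1}<x^h_k$), of length $h_k$, such that: (T1) for some $K\in\mathbb{N}$, $x^h_{k+K}=x_k^h+1$ for all $k$; (T2) $\Omega_{\rm a}\cap\varepsilon\mathbb{Z}=\Omega_{\rm a}\cap\{x_k^h\}_{k\in\mathbb{Z}}$; (T3) $L_{\rm a},R_{\rm a}\in\{x_k^h\}$; (T4) $h_k\ge2\varepsilon$ whenever $T_k^h\subset\Omega_{\rm c}^\#$. Moreover $0$ is a mesh node. Nodes are numbered so that $x_1^h,\dots,x_K^h$ are exactly the nodes in $(-1/2,1/2]$. $\mathcal{P}_1(\mathcal{T}^h)$ is the space of continuous functions affine on each $T_k^h$; $\mathcal{U}^h:=\{u\in\mathcal{P}_1(\mathcal{T}^h):u\text{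 1-periodic},\ u(0)=0\}$, $\mathcal{Y}^h:=\{y\in\mathcal{P}_1(\mathcal{T}^h):y-Fx\in\mathcal{U}^h\}$. $I_h:C^0(\mathbb{R})\to\mathcal{P}_1(\mathcal{T}^h)$ is nodal interpolation. $\mathcal{K}_{\rm c}:=\{k\in\{1,\dots,K\}:x_k^h\in\Omega_{\rm c}\}$. "$x_k^h\in b$ (mod 1)" means $x_k^h+m\in b$ for some $m\in\mathbb{Z}$. QC model. $E_{\rm qc}(y)=\mathcal{E}_{\rm qc}(y)-\langle f,y-Fx\rangle_h$, $\langle f,u\rangle_h=\int_\Omega I_h(fu)\,dx$, $\mathcal{E}_{\rm qc}(y)=\varepsilon\sum_{b\in\mathcal{B}}[a_b(y)+c_b(y)]$, $a_b(y)=\frac{|b\cap\Omega_{\rm a}^\#|}{|b|}\phi(r_bD_{b\cap\Omega_{\rm a}^\#}y)$ (with $a_b\equiv0$ if $|b\cap\Omega_{\rm a}^\#|=0$; $b\cap\Omega_{\rm a}^\#$ is empty or an open interval), $c_b(y)=\frac1{|b|}\int_{b\cap\Omega_{\rm c}^\#}\phi(r_by'(x))\,dx$. Estimators. $\eta(y_h):=(3\sum_{k\in\mathcal{K}_{\rm c}}\eta_k^2)^{1/2}$ with $\eta_k^2:=\sum_{b\in\mathcal{B},\,x_k^h\in b\,(\mathrm{mod}\,1)}\big(\|\phi'(r_bD_by_h)-\phi'(r_bD_{b\cap\Omega_{\rm a}^\#}y_h)\|_{L^2(b\cap\Omega_{\rm a}^\#)}^2+\|\phi'(r_bD_by_h)-\phi'(r_by_h')\|_{L^2(b\cap\Omega_{\rm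 c}^\#)}^2\big)$. Let $T_\ell^\varepsilon=((\ell-1)\varepsilon,\ell\varepsilon)$ and let $\tilde\Omega_{\rm c}$ be the union of the closures of all $T_\ell^\varepsilon$, $\ell\in\mathbb{Z}$, with $|T_\ell^\varepsilon\cap\Omega_{\rm c}^\#|>0$. It is assumed that $f\in C^2(\tilde\Omega_{\rm c})$, meaning: $f$ is $C^2$ on $\tilde\Omega_{\rm c}\cap[-1/2,1/2]$ (one-sided at boundary points) and, in case $1/2$ is not a mesh node, also $C^2$ near $1/2$. For $*\in\{f,q\}$, $(\eta^* )^2:=\sum_{k\in\{1,\dots,K\},\,T_k^h\subset\tilde\Omega_{\rm c}}(\eta^*_k)^2$, $(\eta_k^f)^2:=\frac{h_k^2}{\pi^2}\|f\|_{L^2(T_k^h)}^2$, $(\eta_k^q)^2:=(\varepsilon^4+h_k^4)\|f'\|^2_{L^2(T_k^h)}+\frac{\varepsilon^4+h_k^4}{4\pi^2}\|f''\|_{L^2(T_k^h)}^2$. *)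

theory Defs
  imports "HOL-Analysis.Analysis" "HOL-Probability.Essential_Supremum"
begin

text \<open>Derivatives are taken within \<open>S\<close>: on an open set this is the usual \<open>C\<^sup>n\<close>, on a
  closed interval the derivatives at the end points are one-sided.\<close>

definition Ck_on :: "nat \<Rightarrow> (real \<Rightarrow> real) \<Rightarrow> real set \<Rightarrow> bool" where
  "Ck_on n g S \<longleftrightarrow> (\<exists>D :: nat \<Rightarrow> real \<Rightarrow> real. D 0 = g \<and>
     (\<forall>j<n. \<forall>x\<in>S. (D j has_real_derivative D (Suc j) x) (at x within S)) \<and>
     continuous_on S (D n))"

definition L2_norm :: "real set \<Rightarrow> (real \<Rightarrow> real) \<Rightarrow> real" where
  "L2_norm S g = sqrt (LINT x:S|lborel. (g x)\<^sup>2)"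

definition Linf_norm :: "real set \<Rightarrow> (real \<Rightarrow> real) \<Rightarrow> ereal" where
  "Linf_norm S g = esssup (restrict_space lborel S) (\<lambda>x. ereal \<bar>g x\<bar>)"

text \<open>Local minimality is measured in the sup norm. In the applications below, differences of
  elements of \<open>Y\<close> lie in a finite-dimensional space of periodic functions, so that every other
  norm on that space gives the same notion.\<close>

definition local_minimizer :: "(('a \<Rightarrow> real) \<Rightarrow> real) \<Rightarrow> ('a \<Rightarrow> real) set \<Rightarrow> ('a \<Rightarrow> real) \<Rightarrow> bool" where
  "local_minimizer E Y y \<longleftrightarrow>
     y \<in> Y \<and> (\<exists>\<delta>>0. \<forall>z\<in>Y. (\<forall>x. \<bar>z x - y x\<bar> < \<delta>) \<longrightarrow> E y \<le> E z)"

text \<open>The piecewise affine function with value \<open>v k\<close> at the node \<open>X k\<close>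
  (\<open>X\<close> strictly increasing and unbounded in both directions).\<close>

definition pw_affine :: "(int \<Rightarrow> real) \<Rightarrow> (int \<Rightarrow> real) \<Rightarrow> real \<Rightarrow> real" where
  "pw_affine X v x = (let k = (THE k. X (k - 1) \<le> x \<and> x < X k) in
     v (k - 1) + (v k - v (k - 1)) / (X k - X (k - 1)) * (x - X (k - 1)))"

definition periodic_ext :: "real set \<Rightarrow> real set" where
  "periodic_ext S = {x + of_int m | x (m :: int). x \<in> S}"

text \<open>Meaningful only if \<open>\<omega>\<close> is a nonempty bounded open interval; \<open>Sup\<close> and \<open>Inf\<close> then recover
  its end points.\<close>

definition diff_quot :: "real set \<Rightarrow> (real \<Rightarrow> real) \<Rightarrow> real" where
  "diff_quot \<omega> v = (v (Sup \<omega>) - v (Inf \<omega>)) / (Sup \<omega> - Inf \<omega>)"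

definition eps :: "nat \<Rightarrow> real" where
  "eps N = 1 / (2 * real N)"

definition period_cells :: "nat \<Rightarrow> int set" where
  "period_cells N = {- int N + 1..int N}"

definition nodal :: "nat \<Rightarrow> (real \<Rightarrow> real) \<Rightarrow> int \<Rightarrow> real" where
  "nodal N g l = g (eps N * of_int l)"

definition lattice_interp :: "nat \<Rightarrow> (int \<Rightarrow> real) \<Rightarrow> real \<Rightarrow> real" where
  "lattice_interp N v = pw_affine (\<lambda>l. eps N * of_int l) v"

definition I_eps :: "nat \<Rightarrow> (real \<Rightarrow> real) \<Rightarrow> real \<Rightarrow> real" where
  "I_eps N g = lattice_interp N (nodal N g)"

definition bdiff :: "nat \<Rightarrow> (int \<Rightarrow> real) \<Rightarrow> int \<Rightarrow> real" where
  "bdiff N v l = (v l - v (l - 1)) / eps N"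

definition Y_eps :: "nat \<Rightarrow> real \<Rightarrow> (int \<Rightarrow> real) set" where
  "Y_eps N F = {y. (\<forall>l. y (l + 2 * int N) = F + y l) \<and> y 0 = 0}"

definition Y_eps_pos :: "nat \<Rightarrow> real \<Rightarrow> (int \<Rightarrow> real) set" where
  "Y_eps_pos N F = {y \<in> Y_eps N F. \<forall>l. 0 < bdiff N y l}"

definition inner_eps :: "nat \<Rightarrow> (int \<Rightarrow> real) \<Rightarrow> (int \<Rightarrow> real) \<Rightarrow> real" where
  "inner_eps N g u = eps N * (\<Sum>l\<in>period_cells N. g l * u l)"

definition stored_a :: "nat \<Rightarrow> (real \<Rightarrow> real) \<Rightarrow> (int \<Rightarrow> real) \<Rightarrow> real" where
  "stored_a N \<phi> y = eps N * (\<Sum>l\<in>period_cells N.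
     \<phi> (bdiff N y l) + \<phi> (bdiff N y (l - 1) + bdiff N y l))"

definition E_a :: "nat \<Rightarrow> real \<Rightarrow> (real \<Rightarrow> real) \<Rightarrow> (real \<Rightarrow> real) \<Rightarrow> (int \<Rightarrow> real) \<Rightarrow> real" where
  "E_a N F \<phi> f y = stored_a N \<phi> y
     - inner_eps N (nodal N f) (\<lambda>l. y l - nodal N (\<lambda>x. F * x) l)"

definition A_coeff :: "nat \<Rightarrow> (real \<Rightarrow> real) \<Rightarrow> (int \<Rightarrow> real) \<Rightarrow> int \<Rightarrow> real" where
  "A_coeff N \<phi> y l = deriv (deriv \<phi>) (bdiff N y l)
     + 2 * deriv (deriv \<phi>) (bdiff N y (l - 1) + bdiff N y l)
     + 2 * deriv (deriv \<phi>) (bdiff N y l + bdiff N y (l + 1))"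

definition A_star :: "nat \<Rightarrow> (real \<Rightarrow> real) \<Rightarrow> (int \<Rightarrow> real) \<Rightarrow> real" where
  "A_star N \<phi> y = Min (A_coeff N \<phi> y ` period_cells N)"

text \<open>The pair \<open>(l, j)\<close> stands for the bond \<open>(l \<epsilon>, (l + j) \<epsilon>)\<close>, whose range \<open>r\<^sub>b\<close> is \<open>j\<close>;
  distinct pairs give distinct intervals.\<close>

definition bonds :: "nat \<Rightarrow> (int \<times> nat) set" where
  "bonds N = period_cells N \<times> {1, 2}"

definition bond_ivl :: "nat \<Rightarrow> int \<times> nat \<Rightarrow> real set" where
  "bond_ivl N b = {eps N * of_int (fst b) <..< eps N * (of_int (fst b) + real (snd b))}"

definition bond_range :: "int \<times> nat \<Rightarrow> real" where
  "bond_range b = real (snd b)"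

definition Omega :: "real set" where
  "Omega = {- 1 / 2..1 / 2}"

definition Omega_a :: "real \<Rightarrow> real \<Rightarrow> real set" where
  "Omega_a La Ra = {La<..<Ra}"

definition Omega_c :: "real \<Rightarrow> real \<Rightarrow> real set" where
  "Omega_c La Ra = Omega - Omega_a La Ra"

definition Omega_a_per :: "real \<Rightarrow> real \<Rightarrow> real set" where
  "Omega_a_per La Ra = periodic_ext (Omega_a La Ra)"

definition Omega_c_per :: "real \<Rightarrow> real \<Rightarrow> real set" where
  "Omega_c_per La Ra = periodic_ext (Omega_c La Ra)"

definition element :: "(int \<Rightarrow> real) \<Rightarrow> int \<Rightarrow> real set" where
  "element X k = {X (k - 1)..X k}"

definition elem_len :: "(int \<Rightarrow> real) \<Rightarrow> int \<Rightarrow> real" where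
  "elem_len X k = X k - X (k - 1)"

locale qc_mesh =
  fixes N :: nat and La Ra :: real and K :: nat and X :: "int \<Rightarrow> real"
  assumes atomistic_region: "- 1 / 2 < La" "La < Ra" "Ra < 1 / 2"
    and increasing: "\<And>k. X (k - 1) < X k"
    and covering: "(\<Union>k. element X k) = UNIV"
    and T1: "0 < K" "\<And>k. X (k + int K) = X k + 1"
    and T2: "Omega_a La Ra \<inter> {eps N * of_int l | l :: int. True} = Omega_a La Ra \<inter> range X"
    and T3: "La \<in> range X" "Ra \<in> range X"
    and T4: "\<And>k. element X k \<subseteq> Omega_c_per La Ra \<Longrightarrow> 2 * eps N \<le> elem_len X k"
    and zero_node: "0 \<in> range X"
    and numbering: "X ` {1..int K} = range X \<inter> {- 1 / 2 <.. 1 / 2}"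

definition P1 :: "(int \<Rightarrow> real) \<Rightarrow> (real \<Rightarrow> real) set" where
  "P1 X = {v. continuous_on UNIV v \<and> (\<forall>k. \<exists>a b. \<forall>x\<in>element X k. v x = a * x + b)}"

definition U_h :: "(int \<Rightarrow> real) \<Rightarrow> (real \<Rightarrow> real) set" where
  "U_h X = {u \<in> P1 X. (\<forall>x. u (x + 1) = u x) \<and> u 0 = 0}"

definition Y_h :: "real \<Rightarrow> (int \<Rightarrow> real) \<Rightarrow> (real \<Rightarrow> real) set" where
  "Y_h F X = {y \<in> P1 X. (\<lambda>x. y x - F * x) \<in> U_h X}"

definition Y_h_pos :: "real \<Rightarrow> (int \<Rightarrow> real) \<Rightarrow> (real \<Rightarrow> real) set" where
  "Y_h_pos F X = {y \<in> Y_h F X. \<forall>k. \<forall>x\<in>interior (element X k). 0 < deriv y x}"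

definition I_h :: "(int \<Rightarrow> real) \<Rightarrow> (real \<Rightarrow> real) \<Rightarrow> real \<Rightarrow> real" where
  "I_h X g = pw_affine X (\<lambda>k. g (X k))"

definition inner_h :: "(int \<Rightarrow> real) \<Rightarrow> (real \<Rightarrow> real) \<Rightarrow> (real \<Rightarrow> real) \<Rightarrow> real" where
  "inner_h X g u = (LINT x:Omega|lborel. I_h X (\<lambda>x. g x * u x) x)"

definition a_bond :: "nat \<Rightarrow> (real \<Rightarrow> real) \<Rightarrow> real \<Rightarrow> real \<Rightarrow> int \<times> nat \<Rightarrow> (real \<Rightarrow> real) \<Rightarrow> real" where
  "a_bond N \<phi> La Ra b y =
     (let \<omega> = bond_ivl N b \<inter> Omega_a_per La Ra in
      if measure lborel \<omega> = 0 then 0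
      else measure lborel \<omega> / measure lborel (bond_ivl N b) * \<phi> (bond_range b * diff_quot \<omega> y))"

text \<open>Here and in the estimators, \<open>deriv\<close> is applied to piecewise smooth functions and is
  unspecified at finitely many points of the domain of integration.\<close>

definition c_bond :: "nat \<Rightarrow> (real \<Rightarrow> real) \<Rightarrow> real \<Rightarrow> real \<Rightarrow> int \<times> nat \<Rightarrow> (real \<Rightarrow> real) \<Rightarrow> real" where
  "c_bond N \<phi> La Ra b y = 1 / measure lborel (bond_ivl N b) *
     (LINT x:bond_ivl N b \<inter> Omega_c_per La Ra|lborel. \<phi> (bond_range b * deriv y x))"

definition stored_qc :: "nat \<Rightarrow> (real \<Rightarrow> real) \<Rightarrow> real \<Rightarrow> real \<Rightarrow> (real \<Rightarrow> real) \<Rightarrow> real" where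
  "stored_qc N \<phi> La Ra y = eps N * (\<Sum>b\<in>bonds N. a_bond N \<phi> La Ra b y + c_bond N \<phi> La Ra b y)"

definition E_qc :: "nat \<Rightarrow> real \<Rightarrow> (real \<Rightarrow> real) \<Rightarrow> (real \<Rightarrow> real) \<Rightarrow> real \<Rightarrow> real \<Rightarrow> (int \<Rightarrow> real) \<Rightarrow>
    (real \<Rightarrow> real) \<Rightarrow> real" where
  "E_qc N F \<phi> f La Ra X y = stored_qc N \<phi> La Ra y - inner_h X f (\<lambda>x. y x - F * x)"

definition eta_elem_sq :: "nat \<Rightarrow> (real \<Rightarrow> real) \<Rightarrow> real \<Rightarrow> real \<Rightarrow> (int \<Rightarrow> real) \<Rightarrow> (real \<Rightarrow> real) \<Rightarrow>
    int \<Rightarrow> real" where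
  "eta_elem_sq N \<phi> La Ra X y k =
     (\<Sum>b\<in>{b \<in> bonds N. \<exists>m :: int. X k + of_int m \<in> bond_ivl N b}.
        (L2_norm (bond_ivl N b \<inter> Omega_a_per La Ra)
          (\<lambda>x. deriv \<phi> (bond_range b * diff_quot (bond_ivl N b) y)
             - deriv \<phi> (bond_range b * diff_quot (bond_ivl N b \<inter> Omega_a_per La Ra) y)))\<^sup>2
      + (L2_norm (bond_ivl N b \<inter> Omega_c_per La Ra)
          (\<lambda>x. deriv \<phi> (bond_range b * diff_quot (bond_ivl N b) y)
             - deriv \<phi> (bond_range b * deriv y x)))\<^sup>2)"

definition eta :: "nat \<Rightarrow> (real \<Rightarrow> real) \<Rightarrow> real \<Rightarrow> real \<Rightarrow> nat \<Rightarrow> (int \<Rightarrow> real) \<Rightarrow> (real \<Rightarrow> real) \<Rightarrow>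
    real" where
  "eta N \<phi> La Ra K X y =
     sqrt (3 * (\<Sum>k\<in>{k \<in> {1..int K}. X k \<in> Omega_c La Ra}. eta_elem_sq N \<phi> La Ra X y k))"

definition lattice_cell :: "nat \<Rightarrow> int \<Rightarrow> real set" where
  "lattice_cell N l = {eps N * of_int (l - 1) <..< eps N * of_int l}"

definition Omega_c_tilde :: "nat \<Rightarrow> real \<Rightarrow> real \<Rightarrow> real set" where
  "Omega_c_tilde N La Ra = (\<Union>l\<in>{l. 0 < measure lborel (lattice_cell N l \<inter> Omega_c_per La Ra)}.
     closure (lattice_cell N l))"

definition elements_c_tilde :: "nat \<Rightarrow> real \<Rightarrow> real \<Rightarrow> nat \<Rightarrow> (int \<Rightarrow> real) \<Rightarrow> int set" where
  "elements_c_tilde N La Ra K X = {k \<in> {1..int K}. element X k \<subseteq> Omega_c_tilde N La Ra}"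

definition eta_f :: "nat \<Rightarrow> (real \<Rightarrow> real) \<Rightarrow> real \<Rightarrow> real \<Rightarrow> nat \<Rightarrow> (int \<Rightarrow> real) \<Rightarrow> real" where
  "eta_f N f La Ra K X = sqrt (\<Sum>k\<in>elements_c_tilde N La Ra K X.
     (elem_len X k)\<^sup>2 / pi\<^sup>2 * (L2_norm (element X k) f)\<^sup>2)"

definition eta_q :: "nat \<Rightarrow> (real \<Rightarrow> real) \<Rightarrow> real \<Rightarrow> real \<Rightarrow> nat \<Rightarrow> (int \<Rightarrow> real) \<Rightarrow> real" where
  "eta_q N f La Ra K X = sqrt (\<Sum>k\<in>elements_c_tilde N La Ra K X.
     (eps N ^ 4 + elem_len X k ^ 4) * (L2_norm (element X k) (deriv f))\<^sup>2
     + (eps N ^ 4 + elem_len X k ^ 4) / (4 * pi\<^sup>2) * (L2_norm (element X k) (deriv (deriv f)))\<^sup>2)"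

end

theory Submission
  imports Defs
begin

text \<open>Let \<open>e\<close> be the difference of the atomistic solution and the lattice values of the
  quasicontinuum solution. Both first variations vanish when tested with \<open>e\<close>, respectively with
  its mesh interpolant. Since \<open>\<phi>\<close> is concave beyond \<open>r\<^sub>*\<close>, the second-neighbour terms of the
  Hessian are bounded below by nearest-neighbour ones, so the Hessian at the quasicontinuum solution is
  bounded below by \<open>A\<^sub>*\<close>; close enough to it half of this survives, and the claim follows
  from bounds on the residual. In the stored energies the interpolant may be exchanged
  for \<open>e\<close>, and only the bonds containing a node of the continuum region contribute, each point
  lying in at most three bonds of a period. For the forces one compares two trapezoidal sums over a period
  that begins at the common node \<open>0\<close>, through the integral of \<open>f e\<close>: second order quadrature errors on
  lattice cells and on elements, and the Wirtinger inequality for \<open>e\<close> minus its interpolant on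
  each element.\<close>

section \<open>Integral inequalities on an interval\<close>

text \<open>The obstacle is that lattice and mesh do not fit together: in the continuum region
  elements cut cells and bonds anywhere, and the interfaces \<open>La\<close>, \<open>Ra\<close> are
  nodes but need not be lattice points. Both first variations are therefore written as integrals
  over bonds of a stress times the piecewise constant slope of one and the same test function. The
  minimal element length 2 eps in the continuum region keeps neighbouring copies of the atomistic
  interval 2 eps apart, so a bond meets at most one of them and its atomistic part is a single
  interval ending at mesh nodes. The factor 2 of the estimate is the half of \<open>A_star\<close>
  given away to linearization. By periodicity only finitely many gradients of the quasicontinuum
  solution occur, and differentiability of the first derivative of \<phi> at these suffices; hence
  the admissible distance does not depend on the atomistic solution. In the force estimate four
  quadrature errors (lattice or mesh, first or second derivative of f) carry a factor 1/4 each and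
  are bounded by \<open>eta_q\<close> each; \<open>eta_f\<close> is the price of replacing the test
  function by its mesh interpolant.\<close>

lemma integral_Cauchy_Schwarz:
  fixes g h :: "real \<Rightarrow> real"
  assumes g: "(\<lambda>x. (g x)\<^sup>2) integrable_on S" and h: "(\<lambda>x. (h x)\<^sup>2) integrable_on S"
    and gh: "(\<lambda>x. g x * h x) integrable_on S"
  shows "\<bar>integral S (\<lambda>x. g x * h x)\<bar>
    \<le> sqrt (integral S (\<lambda>x. (g x)\<^sup>2)) * sqrt (integral S (\<lambda>x. (h x)\<^sup>2))"
proof -
  define A B C where "A = integral S (\<lambda>x. (g x)\<^sup>2)" and "B = integral S (\<lambda>x. (h x)\<^sup>2)"
    and "C = integral S (\<lambda>x. g x * h x)"
  have q: "0 \<le> A - 2 * t * C + t\<^sup>2 * B" for t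
  proof -
    have "((\<lambda>x. (g x)\<^sup>2 - (2 * t) * (g x * h x) + t\<^sup>2 * (h x)\<^sup>2) has_integral
        (A - 2 * t * C + t\<^sup>2 * B)) S"
      unfolding A_def B_def C_def using g h gh
      by (intro has_integral_add has_integral_diff has_integral_mult_right integrable_integral)
    moreover have "0 \<le> (g x)\<^sup>2 - (2 * t) * (g x * h x) + t\<^sup>2 * (h x)\<^sup>2" for x
    proof -
      have "(g x)\<^sup>2 - (2 * t) * (g x * h x) + t\<^sup>2 * (h x)\<^sup>2 = (g x - t * h x)\<^sup>2"
        by (simp add: power2_eq_square algebra_simps)
      then show ?thesis by simp
    qed
    ultimately show ?thesis by (rule has_integral_nonneg)
  qed
  have A0: "0 \<le> A" and B0: "0 \<le> B"
    unfolding A_def B_def by (auto intro!: integral_nonneg g h)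
  have "C\<^sup>2 \<le> A * B"
  proof (cases "B = 0")
    case True
    have "C = 0"
    proof (rule ccontr)
      assume "C \<noteq> 0"
      \<comment> \<open>With B = 0 the quadratic is affine in t, and at this t it equals -1.\<close>
      with q[of "(A + 1) / (2 * C)"] True show False by (simp add: field_simps)
    qed
    then show ?thesis using True by simp
  next
    case False
    with B0 have "0 < B" by simp
    with q[of "C / B"] show ?thesis by (simp add: field_simps power2_eq_square)
  qed
  then have "\<bar>C\<bar> \<le> sqrt (A * B)" by (simp add: real_le_rsqrt)
  then show ?thesis unfolding A_def B_def C_def by (simp add: real_sqrt_mult)
qed

text \<open>The finite exceptional set S admits the kinks of piecewise affine functions, to which
  the inequality is applied on single elements and on the whole period.\<close>

lemma Wirtinger_Dirichlet:
  fixes g g' :: "real \<Rightarrow> real"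
  assumes ab: "a < b" and fin: "finite S" and cont: "continuous_on {a..b} g"
    and der: "\<And>x. x \<in> {a<..<b} - S \<Longrightarrow> (g has_real_derivative g' x) (at x)"
    and zero: "g a = 0" "g b = 0"
    and int: "(\<lambda>x. (g' x)\<^sup>2) integrable_on {a..b}"
  shows "integral {a..b} (\<lambda>x. (g x)\<^sup>2) \<le> ((b - a) / pi)\<^sup>2 * integral {a..b} (\<lambda>x. (g' x)\<^sup>2)"
proof -
  define c m where "c = pi / (b - a)" and "m = (a + b) / 2"
  define A B where "A = integral {a..b} (\<lambda>x. (g x)\<^sup>2)" and "B = integral {a..b} (\<lambda>x. (g' x)\<^sup>2)"
  have c: "0 < c" using ab by (simp add: c_def)
  have intg: "(\<lambda>x. (g x)\<^sup>2) integrable_on {a..b}"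
    by (intro integrable_continuous_real continuous_intros cont)
  have main: "\<mu>\<^sup>2 * A \<le> B" if mu: "0 < \<mu>" "\<mu> < c" for \<mu>
  proof -
    \<comment> \<open>With weight \<open>w x = cos (\<mu> (x - m))\<close>, positive on the closed interval because \<open>\<mu> < c\<close>,
      \<open>g'\<^sup>2 - \<mu>\<^sup>2 g\<^sup>2 + (\<mu> tan (\<mu> (x - m)) g\<^sup>2)'\<close> is a perfect square.\<close>
    define t where "t x = tan (\<mu> * (x - m))" for x
    have cos: "cos (\<mu> * (x - m)) \<noteq> 0" if "x \<in> {a..b}" for x
    proof -
      have "\<bar>x - m\<bar> \<le> (b - a) / 2" using that by (auto simp: m_def abs_le_iff field_simps)
      then have "\<mu> * \<bar>x - m\<bar> \<le> \<mu> * ((b - a) / 2)" using mu by (intro mult_left_mono) auto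
      also have "\<dots> < c * ((b - a) / 2)" using mu ab by (intro mult_strict_right_mono) auto
      also have "\<dots> = pi / 2" using ab by (simp add: c_def)
      finally have "\<bar>\<mu> * (x - m)\<bar> < pi / 2" using mu by (simp add: abs_mult)
      then have "0 < cos (\<mu> * (x - m))" by (intro cos_gt_zero_pi) (auto simp: abs_less_iff)
      then show ?thesis by simp
    qed
    define G' where "G' x = \<mu> * (\<mu> * (1 + (t x)\<^sup>2) * (g x)\<^sup>2 + t x * (2 * g x * g' x))" for x
    have "(G' has_integral (\<mu> * (t b * (g b)\<^sup>2) - \<mu> * (t a * (g a)\<^sup>2))) {a..b}"
    proof (rule fundamental_theorem_of_calculus_interior_strong[OF fin])
      show "a \<le> b" using ab by simp
      fix x assume x: "x \<in> {a<..<b} - S"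
      have tx: "(t has_real_derivative \<mu> * (1 + (t x)\<^sup>2)) (at x)"
        unfolding t_def using cos[of x] x
        by (auto intro!: derivative_eq_intros simp: tan_sec power_inverse)
      have "((\<lambda>x. \<mu> * (t x * (g x)\<^sup>2)) has_real_derivative G' x) (at x)"
        unfolding G'_def
        by (auto intro!: derivative_eq_intros tx der[OF x] simp: algebra_simps power2_eq_square)
      then show "((\<lambda>x. \<mu> * (t x * (g x)\<^sup>2)) has_vector_derivative G' x) (at x)"
        by (simp add: has_real_derivative_iff_has_vector_derivative)
    next
      have "continuous_on {a..b} t"
        unfolding t_def using cos by (intro continuous_intros) auto
      then show "continuous_on {a..b} (\<lambda>x. \<mu> * (t x * (g x)\<^sup>2))"
        by (intro continuous_intros cont)
    qed
    then have "(G' has_integral 0) {a..b}" by (simp add: zero)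
    then have "((\<lambda>x. (g' x)\<^sup>2 - \<mu>\<^sup>2 * (g x)\<^sup>2 + G' x) has_integral (B - \<mu>\<^sup>2 * A + 0)) {a..b}"
      unfolding A_def B_def using int intg
      by (intro has_integral_add has_integral_diff has_integral_mult_right integrable_integral)
    moreover have "0 \<le> (g' x)\<^sup>2 - \<mu>\<^sup>2 * (g x)\<^sup>2 + G' x" for x
    proof -
      have "(g' x)\<^sup>2 - \<mu>\<^sup>2 * (g x)\<^sup>2 + G' x = (g' x + \<mu> * t x * g x)\<^sup>2"
        unfolding G'_def by (simp add: power2_eq_square algebra_simps)
      then show ?thesis by simp
    qed
    ultimately have "0 \<le> B - \<mu>\<^sup>2 * A + 0" by (rule has_integral_nonneg)
    then show ?thesis by simp
  qed
  \<comment> \<open>For \<mu> = c the tangent would blow up at both end points, so the sharp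
    constant is reached only as a limit.\<close>
  have "c\<^sup>2 * A \<le> B"
  proof (rule tendsto_upperbound)
    show "((\<lambda>\<mu>. \<mu>\<^sup>2 * A) \<longlongrightarrow> c\<^sup>2 * A) (at_left c)" by (intro tendsto_intros)
    show "\<forall>\<^sub>F \<mu> in at_left c. \<mu>\<^sup>2 * A \<le> B"
      unfolding eventually_at_left_field using c main by (intro exI[of _ 0]) auto
  qed simp
  then show ?thesis
    unfolding A_def[symmetric] B_def[symmetric] c_def using ab
    by (simp add: field_simps)
qed

text \<open>With the Peano kernel \<open>w\<close> of the trapezoidal rule the error is half the
  integral of w (f p)'', and (f p)'' = f'' p + 2 s f' because p is affine. Since w is at most (b -
  a)^2 / 4, Cauchy-Schwarz gives the two products; \<open>sqrt ((b - a) * s\<^sup>2)\<close> is the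
  L2 norm of the slope of p.\<close>

lemma trapezoid_error:
  fixes f f1 f2 :: "real \<Rightarrow> real"
  assumes ab: "a < b" and cont: "continuous_on {a..b} f" "continuous_on {a..b} f1" "continuous_on {a..b} f2"
    and der: "\<And>x. x \<in> {a<..<b} \<Longrightarrow> (f has_real_derivative f1 x) (at x)"
      "\<And>x. x \<in> {a<..<b} \<Longrightarrow> (f1 has_real_derivative f2 x) (at x)"
    and p: "\<And>x. x \<in> {a..b} \<Longrightarrow> p x = q + s * x"
  shows "\<bar>(b - a) * (f a * p a + f b * p b) / 2 - integral {a..b} (\<lambda>x. f x * p x)\<bar>
    \<le> (b - a)\<^sup>2 / 8 *
      (2 * (sqrt (integral {a..b} (\<lambda>x. (f1 x)\<^sup>2)) * sqrt ((b - a) * s\<^sup>2))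
       + sqrt (integral {a..b} (\<lambda>x. (f2 x)\<^sup>2)) * sqrt (integral {a..b} (\<lambda>x. (p x)\<^sup>2)))"
proof -
  define P where "P x = q + s * x" for x
  define w where "w x = (x - a) * (b - x)" for x
  \<comment> \<open>H = w (f P)' - w' f P. As w'' = -2, its derivative is w (f P)'' + 2 f P, and as
    w vanishes at both ends, its boundary values are those of the trapezoidal rule.\<close>
  define H where "H x = w x * (f1 x * P x + f x * s) - (a + b - 2 * x) * (f x * P x)" for x
  have eqP: "integral {a..b} (\<lambda>x. f x * p x) = integral {a..b} (\<lambda>x. f x * P x)"
    "integral {a..b} (\<lambda>x. (p x)\<^sup>2) = integral {a..b} (\<lambda>x. (P x)\<^sup>2)" "p a = P a" "p b = P b"
    using p ab by (auto simp: P_def intro!: integral_cong)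
  note ci = continuous_intros cont
  have cP: "continuous_on {a..b} P" "continuous_on {a..b} w"
    unfolding P_def w_def by (intro continuous_intros)+
  have "((\<lambda>x. w x * (f2 x * P x + 2 * f1 x * s) + 2 * (f x * P x)) has_integral (H b - H a)) {a..b}"
  proof (rule fundamental_theorem_of_calculus_interior)
    show "a \<le> b" using ab by simp
    show "continuous_on {a..b} H" unfolding H_def by (intro ci cP)
    fix x assume x: "x \<in> {a<..<b}"
    have dP: "(P has_real_derivative s) (at x)" and dw: "(w has_real_derivative (a + b - 2 * x)) (at x)"
      unfolding P_def w_def by (auto intro!: derivative_eq_intros)
    have "(H has_real_derivative w x * (f2 x * P x + 2 * f1 x * s) + 2 * (f x * P x)) (at x)"
      unfolding H_def
      by (auto intro!: derivative_eq_intros dP dw der[OF x] simp: algebra_simps)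
    then show "(H has_vector_derivative w x * (f2 x * P x + 2 * f1 x * s) + 2 * (f x * P x)) (at x)"
      by (simp add: has_real_derivative_iff_has_vector_derivative)
  qed
  then have i1: "((\<lambda>x. w x * f2 x * P x + 2 * (w x * f1 x * s) + 2 * (f x * P x)) has_integral (H b - H a)) {a..b}"
    by (rule has_integral_eq[rotated]) (simp add: algebra_simps)
  have i2: "((\<lambda>x. w x * f2 x * P x + 2 * (w x * f1 x * s) + 2 * (f x * P x)) has_integral
     (integral {a..b} (\<lambda>x. w x * f2 x * P x) + 2 * integral {a..b} (\<lambda>x. w x * f1 x * s)
       + 2 * integral {a..b} (\<lambda>x. f x * P x))) {a..b}"
    by (intro has_integral_add has_integral_mult_right integrable_integral integrable_continuous_real ci cP)
  have id: "H b - H a = integral {a..b} (\<lambda>x. w x * f2 x * P x)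
      + 2 * integral {a..b} (\<lambda>x. w x * f1 x * s) + 2 * integral {a..b} (\<lambda>x. f x * P x)"
    using has_integral_unique[OF i1 i2] .
  have "H b - H a = (b - a) * (f a * P a + f b * P b)"
    unfolding H_def w_def by (simp add: algebra_simps)
  with id have err: "(b - a) * (f a * P a + f b * P b) / 2 - integral {a..b} (\<lambda>x. f x * P x)
     = integral {a..b} (\<lambda>x. w x * f2 x * P x) / 2 + integral {a..b} (\<lambda>x. w x * f1 x * s)"
    by linarith
  have w: "0 \<le> w x" "w x \<le> (b - a)\<^sup>2 / 4" if "x \<in> {a..b}" for x
  proof -
    show "0 \<le> w x" using that by (simp add: w_def)
    have "(b - a)\<^sup>2 / 4 - w x = (x - (a + b) / 2)\<^sup>2"
      unfolding w_def by (simp add: power2_eq_square field_simps)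
    then show "w x \<le> (b - a)\<^sup>2 / 4" by (metis diff_ge_0_iff_ge zero_le_power2)
  qed
  have wb: "sqrt (integral {a..b} (\<lambda>x. (w x * u x)\<^sup>2)) \<le> (b - a)\<^sup>2 / 4 * sqrt (integral {a..b} (\<lambda>x. (u x)\<^sup>2))"
    if u: "continuous_on {a..b} u" for u
  proof -
    have "integral {a..b} (\<lambda>x. (w x * u x)\<^sup>2) \<le> integral {a..b} (\<lambda>x. ((b - a)\<^sup>2 / 4)\<^sup>2 * (u x)\<^sup>2)"
    proof (rule integral_le)
      fix x assume "x \<in> {a..b}"
      then have "(w x)\<^sup>2 \<le> ((b - a)\<^sup>2 / 4)\<^sup>2" using w by (intro power_mono) auto
      then show "(w x * u x)\<^sup>2 \<le> ((b - a)\<^sup>2 / 4)\<^sup>2 * (u x)\<^sup>2"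
        by (simp only: power_mult_distrib) (intro mult_right_mono, auto)
    qed (intro integrable_continuous_real ci cP u)+
    then have "sqrt (integral {a..b} (\<lambda>x. (w x * u x)\<^sup>2)) \<le> sqrt (((b - a)\<^sup>2 / 4)\<^sup>2 * integral {a..b} (\<lambda>x. (u x)\<^sup>2))"
      by simp
    then show ?thesis by (simp add: real_sqrt_mult)
  qed
  have "\<bar>integral {a..b} (\<lambda>x. w x * f2 x * P x)\<bar>
     \<le> sqrt (integral {a..b} (\<lambda>x. (w x * f2 x)\<^sup>2)) * sqrt (integral {a..b} (\<lambda>x. (P x)\<^sup>2))"
    by (intro integral_Cauchy_Schwarz integrable_continuous_real ci cP)
  also have "\<dots> \<le> ((b - a)\<^sup>2 / 4 * sqrt (integral {a..b} (\<lambda>x. (f2 x)\<^sup>2))) * sqrt (integral {a..b} (\<lambda>x. (P x)\<^sup>2))"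
    by (intro mult_right_mono wb cont real_sqrt_ge_zero integral_nonneg integrable_continuous_real ci cP) auto
  finally have e2: "\<bar>integral {a..b} (\<lambda>x. w x * f2 x * P x)\<bar> \<le> \<dots>" .
  have "\<bar>integral {a..b} (\<lambda>x. w x * f1 x * s)\<bar>
     \<le> sqrt (integral {a..b} (\<lambda>x. (w x * f1 x)\<^sup>2)) * sqrt (integral {a..b} (\<lambda>x. s\<^sup>2))"
    by (intro integral_Cauchy_Schwarz integrable_continuous_real ci cP)
  also have "\<dots> \<le> ((b - a)\<^sup>2 / 4 * sqrt (integral {a..b} (\<lambda>x. (f1 x)\<^sup>2))) * sqrt (integral {a..b} (\<lambda>x. s\<^sup>2))"
    using ab by (intro mult_right_mono wb cont real_sqrt_ge_zero) auto
  finally have e1: "\<bar>integral {a..b} (\<lambda>x. w x * f1 x * s)\<bar>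
     \<le> ((b - a)\<^sup>2 / 4 * sqrt (integral {a..b} (\<lambda>x. (f1 x)\<^sup>2))) * sqrt ((b - a) * s\<^sup>2)"
    using ab by simp
  define S1 S2 where "S1 = sqrt (integral {a..b} (\<lambda>x. (f1 x)\<^sup>2)) * sqrt ((b - a) * s\<^sup>2)"
    and "S2 = sqrt (integral {a..b} (\<lambda>x. (f2 x)\<^sup>2)) * sqrt (integral {a..b} (\<lambda>x. (P x)\<^sup>2))"
  have "\<bar>integral {a..b} (\<lambda>x. w x * f2 x * P x)\<bar> \<le> (b - a)\<^sup>2 / 4 * S2"
    "\<bar>integral {a..b} (\<lambda>x. w x * f1 x * s)\<bar> \<le> (b - a)\<^sup>2 / 4 * S1"
    using e1 e2 unfolding S1_def S2_def by (simp_all only: mult.assoc)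
  moreover have "(b - a)\<^sup>2 / 8 * (2 * S1 + S2) = (b - a)\<^sup>2 / 4 * S2 / 2 + (b - a)\<^sup>2 / 4 * S1"
    by (simp add: field_simps)
  ultimately show ?thesis
    unfolding eqP err S1_def[symmetric] S2_def[symmetric] by linarith
qed

section \<open>Periodic grids and piecewise affine functions\<close>

lemma sum_int_period_Suc:
  fixes P :: "int \<Rightarrow> 'a::ab_group_add"
  assumes "\<And>k. P (k + int n) = P k"
  shows "sum P {i + 2..i + 1 + int n} = sum P {i + 1..i + int n}"
proof (cases "n = 0")
  case False
  have "{i + 1..i + 1 + int n} = insert (i + 1) {i + 2..i + 1 + int n}" by auto
  moreover have "{i + 1..i + 1 + int n} = insert (i + 1 + int n) {i + 1..i + int n}"
    using False by auto
  ultimately have "sum P (insert (i + 1) {i + 2..i + 1 + int n})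
    = sum P (insert (i + 1 + int n) {i + 1..i + int n})" by simp
  then have "P (i + 1) + sum P {i + 2..i + 1 + int n} = P (i + 1 + int n) + sum P {i + 1..i + int n}"
    by simp
  then show ?thesis by (simp add: assms)
qed simp

lemma sum_int_period:
  fixes P :: "int \<Rightarrow> 'a::ab_group_add"
  assumes "\<And>k. P (k + int n) = P k"
  shows "sum P {i + 1..i + int n} = sum P {j + 1..j + int n}"
proof -
  have "sum P {j + 1..j + int n} = sum P {0 + 1..0 + int n}" for j
  proof (induction j rule: int_induct[where k = 0])
    case (step1 i)
    then show ?case using sum_int_period_Suc[of P n i, OF assms] by (simp add: algebra_simps)
  next
    case (step2 i)
    then show ?case using sum_int_period_Suc[of P n "i - 1", OF assms] by (simp add: algebra_simps)
  qed simp
  then show ?thesis by metis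
qed

text \<open>A class containing continuous functions, indicators of Borel sets and functions of the
  cell number, and closed under sums and products. On bounded sets its members are Lebesgue
  integrable and the Henstock integral has the same value, so integrability becomes a syntactic
  matter and the Lebesgue integrals of the model can be rewritten as Henstock integrals.\<close>

definition loc_bounded_meas :: "(real \<Rightarrow> real) \<Rightarrow> bool" where
  "loc_bounded_meas g \<longleftrightarrow>
     g \<in> borel_measurable borel \<and> (\<forall>a b. \<exists>B. \<forall>x\<in>{a..b}. \<bar>g x\<bar> \<le> B)"

lemma lbm_continuous: "continuous_on UNIV g \<Longrightarrow> loc_bounded_meas g"
  unfolding loc_bounded_meas_def
proof (intro conjI allI)
  fix a b :: real assume g: "continuous_on UNIV g"
  have "compact (g ` {a..b})"
    by (intro compact_continuous_image continuous_on_subset[OF g]) auto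
  then obtain B where "\<forall>y\<in>g ` {a..b}. norm y \<le> B"
    using compact_imp_bounded bounded_iff by metis
  then show "\<exists>B. \<forall>x\<in>{a..b}. \<bar>g x\<bar> \<le> B" by auto
qed (rule borel_measurable_continuous_onI)

lemma lbm_const: "loc_bounded_meas (\<lambda>x. c)"
  by (rule lbm_continuous) simp

lemma lbm_indicator:
  assumes "A \<in> sets borel" shows "loc_bounded_meas (indicator A)"
  unfolding loc_bounded_meas_def using assms
  by (auto intro!: exI[of _ 1] simp: indicator_def)

lemma lbm_add:
  assumes "loc_bounded_meas g" "loc_bounded_meas h"
  shows "loc_bounded_meas (\<lambda>x. g x + h x)"
  unfolding loc_bounded_meas_def
proof (intro conjI allI)
  fix a b :: real
  obtain B C where "\<forall>x\<in>{a..b}. \<bar>g x\<bar> \<le> B" "\<forall>x\<in>{a..b}. \<bar>h x\<bar> \<le> C"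
    using assms unfolding loc_bounded_meas_def by meson
  then have "\<forall>x\<in>{a..b}. \<bar>g x + h x\<bar> \<le> B + C"
    by (meson abs_triangle_ineq add_mono order_trans)
  then show "\<exists>B. \<forall>x\<in>{a..b}. \<bar>g x + h x\<bar> \<le> B" ..
qed (use assms in \<open>auto simp: loc_bounded_meas_def\<close>)

lemma lbm_mult:
  assumes "loc_bounded_meas g" "loc_bounded_meas h"
  shows "loc_bounded_meas (\<lambda>x. g x * h x)"
  unfolding loc_bounded_meas_def
proof (intro conjI allI)
  fix a b :: real
  obtain B C where BC: "\<forall>x\<in>{a..b}. \<bar>g x\<bar> \<le> B" "\<forall>x\<in>{a..b}. \<bar>h x\<bar> \<le> C"
    using assms unfolding loc_bounded_meas_def by meson
  have "\<forall>x\<in>{a..b}. \<bar>g x * h x\<bar> \<le> B * C"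
  proof
    fix x assume "x \<in> {a..b}"
    then have "\<bar>g x\<bar> \<le> B" "\<bar>h x\<bar> \<le> C" using BC by auto
    then show "\<bar>g x * h x\<bar> \<le> B * C"
      unfolding abs_mult by (intro mult_mono) auto
  qed
  then show "\<exists>B. \<forall>x\<in>{a..b}. \<bar>g x * h x\<bar> \<le> B" ..
qed (use assms in \<open>auto simp: loc_bounded_meas_def\<close>)

lemma lbm_diff:
  assumes "loc_bounded_meas g" "loc_bounded_meas h"
  shows "loc_bounded_meas (\<lambda>x. g x - h x)"
  using lbm_add[OF assms(1) lbm_mult[OF lbm_const[of "-1"] assms(2)]] by simp

lemma lbm_power2: "loc_bounded_meas g \<Longrightarrow> loc_bounded_meas (\<lambda>x. (g x)\<^sup>2)"
  unfolding power2_eq_square by (intro lbm_mult)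

lemmas lbm_intros = lbm_const lbm_indicator lbm_add lbm_diff lbm_mult lbm_power2

lemma lbm_set_integrable:
  assumes g: "loc_bounded_meas g" and S: "S \<in> sets borel" "S \<subseteq> {a..b}"
  shows "set_integrable lborel S g"
proof -
  obtain B where B: "\<forall>x\<in>{a..b}. \<bar>g x\<bar> \<le> B" using g unfolding loc_bounded_meas_def by meson
  have g': "g \<in> borel_measurable borel" using g by (simp add: loc_bounded_meas_def)
  have "set_integrable lborel {a..b} g"
    unfolding set_integrable_def
  proof (rule Bochner_Integration.integrable_bound)
    show "integrable lborel (\<lambda>x. indicator {a..b} x *\<^sub>R \<bar>B\<bar>)"
      by (rule borel_integrable_compact) auto
    show "(\<lambda>x. indicator {a..b} x *\<^sub>R g x) \<in> borel_measurable lborel"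
      using g' by simp
    show "AE x in lborel. norm (indicator {a..b} x *\<^sub>R g x) \<le> norm (indicator {a..b} x *\<^sub>R \<bar>B\<bar>)"
      using B by (intro AE_I2) (auto simp: indicator_def intro: order_trans[OF _ abs_ge_self])
  qed
  then show ?thesis
    by (rule set_integrable_subset) (use S in auto)
qed

lemma lbm_integrable_on: "loc_bounded_meas g \<Longrightarrow> g integrable_on {a..b}"
  by (rule set_borel_integral_eq_integral(1)[OF lbm_set_integrable[of _ _ a b]]) auto

lemma lbm_LINT:
  assumes g: "loc_bounded_meas g" and S: "S \<in> sets borel" "S \<subseteq> {a..b}"
  shows "(LINT x:S|lborel. g x) = integral {a..b} (\<lambda>x. indicator S x * g x)"
proof -
  have "(LINT x:S|lborel. g x) = (LINT x:{a..b}|lborel. indicator S x * g x)"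
    unfolding set_lebesgue_integral_def using S
    by (intro Bochner_Integration.integral_cong) (auto simp: indicator_def)
  also have "\<dots> = integral {a..b} (\<lambda>x. indicator S x * g x)"
    by (intro set_borel_integral_eq_integral lbm_set_integrable[of _ _ a b] lbm_intros g S) auto
  finally show ?thesis .
qed

section \<open>Integrals of 1-periodic functions\<close>

lemma integral_shift_periodic:
  fixes g :: "real \<Rightarrow> real"
  assumes "\<And>x. g (x + c) = g x"
  shows "integral {a + c..b + c} g = integral {a..b} g"
  using integral_shift_Icc_real[of a b g c] assms by (simp add: o_def add.commute)

lemma periodic_of_int:
  fixes g :: "real \<Rightarrow> 'a"
  assumes "\<And>x. g (x + 1) = g x"
  shows "g (x + of_int m) = g x"
proof (induction m rule: int_induct[where k = 0])
  case (step1 i)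
  then show ?case using assms[of "x + of_int i"] by (simp add: algebra_simps)
next
  case (step2 i)
  then show ?case using assms[of "x + of_int (i - 1)"] by (simp add: algebra_simps)
qed simp

lemma integral_unit_periodic:
  assumes g: "loc_bounded_meas g" and per: "\<And>x. g (x + 1) = g x"
  shows "integral {a..a + 1} g = integral {0..1} g"
proof -
  \<comment> \<open>The piece over [a, b] that is lost reappears over [a + 1, b + 1].\<close>
  have step: "integral {a..a + 1} g = integral {b..b + 1} g" if "a \<le> b" "b \<le> a + 1" for a b
    using Henstock_Kurzweil_Integration.integral_combine[of a b "a + 1" g] Henstock_Kurzweil_Integration.integral_combine[of b "a + 1" "b + 1" g] that
      integral_shift_periodic[of g 1 a b, OF per] lbm_integrable_on[OF g] by simp
  have int: "integral {b..b + 1} g = integral {b + of_int m..b + of_int m + 1} g" for b m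
  proof -
    have "g (x + of_int m) = g x" for x by (rule periodic_of_int[of g, OF per])
    from integral_shift_periodic[of g "of_int m" b "b + 1", OF this] show ?thesis
      by (simp add: algebra_simps)
  qed
  have "integral {a..a + 1} g = integral {of_int \<lfloor>a\<rfloor>..of_int \<lfloor>a\<rfloor> + 1} g"
    by (rule step[symmetric]) linarith+
  also have "\<dots> = integral {0..1} g"
    using int[of 0 "\<lfloor>a\<rfloor>"] by simp
  finally show ?thesis .
qed

text \<open>Interpreted twice, for the mesh nodes with K cells per period and for the lattice points
  with 2N, so that interpolants on both grids share one theory.\<close>

locale periodic_grid =
  fixes X :: "int \<Rightarrow> real" and K :: nat
  assumes grid_less: "\<And>k. X (k - 1) < X k" and K_pos: "0 < K"
    and grid_period: "\<And>k. X (k + int K) = X k + 1"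
begin

lemma grid_less_Suc: "X k < X (k + 1)"
  using grid_less[of "k + 1"] by simp

lemma strict_mono_grid: "strict_mono X"
proof (rule strict_monoI)
  fix i j :: int assume "i < j"
  then show "X i < X j"
    by (induction rule: int_gr_induct) (auto intro: grid_less_Suc less_trans)
qed

lemma grid_less_iff [simp]: "X i < X j \<longleftrightarrow> i < j"
  by (rule strict_mono_less[OF strict_mono_grid])

lemma grid_le_iff [simp]: "X i \<le> X j \<longleftrightarrow> i \<le> j"
  by (rule strict_mono_less_eq[OF strict_mono_grid])

lemma grid_eq_iff [simp]: "X i = X j \<longleftrightarrow> i = j"
  by (rule strict_mono_eq[OF strict_mono_grid])

lemma grid_shift: "X (k + m * int K) = X k + of_int m"
proof (induction m rule: int_induct[where k = 0])
  case (step1 i)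
  then show ?case using grid_period[of "k + i * int K"] by (simp add: algebra_simps)
next
  case (step2 i)
  then show ?case using grid_period[of "k + (i - 1) * int K"] by (simp add: algebra_simps)
qed simp

lemma ex_grid_gt: "\<exists>k. x < X k"
  using grid_shift[of 0 "\<lfloor>x - X 0\<rfloor> + 1"] by (intro exI[of _ "(\<lfloor>x - X 0\<rfloor> + 1) * int K"]) (simp, linarith)

lemma ex_grid_le: "\<exists>k. X k \<le> x"
  using grid_shift[of 0 "\<lfloor>x - X 0\<rfloor>"] by (intro exI[of _ "\<lfloor>x - X 0\<rfloor> * int K"]) (simp, linarith)

text \<open>The same choice of a cell as inside \<open>pw_affine\<close>. Half-open cells make it
  unique; a node belongs to the cell on its right.\<close>

definition idx :: "real \<Rightarrow> int" where
  "idx x = (THE k. X (k - 1) \<le> x \<and> x < X k)"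

lemma idx_eqI: "X (k - 1) \<le> x \<Longrightarrow> x < X k \<Longrightarrow> idx x = k"
  unfolding idx_def
proof (rule the_equality)
  fix j assume "X (k - 1) \<le> x" "x < X k" "X (j - 1) \<le> x \<and> x < X j"
  then have "X (k - 1) < X j" "X (j - 1) < X k" by linarith+
  then show "j = k" by simp
qed simp

lemma ex_cell: "\<exists>k. X (k - 1) \<le> x \<and> x < X k"
proof -
  obtain i where i: "X i \<le> x" using ex_grid_le by blast
  obtain j where j: "x < X j" using ex_grid_gt by blast
  have "\<exists>k. i \<le> k \<and> X k \<le> x \<and> x < X (k + 1)"
  proof (rule ccontr)
    assume no: "\<not> ?thesis"
    have "X k \<le> x" if "i \<le> k" for k
      using that
    proof (induction k rule: int_ge_induct)
      case (step k)
      then show ?case using no by (meson not_le)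
    qed (rule i)
    moreover have "X i < X j" using i j by linarith
    ultimately have "X j \<le> x" by simp
    with j show False by simp
  qed
  then obtain k where "X k \<le> x" "x < X (k + 1)" by blast
  then show ?thesis by (intro exI[of _ "k + 1"]) simp
qed

lemma idx_bounds: "X (idx x - 1) \<le> x" "x < X (idx x)"
  using ex_cell[of x] idx_eqI by metis+

lemma idx_iff: "idx x = k \<longleftrightarrow> X (k - 1) \<le> x \<and> x < X k"
  using idx_bounds idx_eqI by blast

lemma idx_shift: "idx (x + of_int m) = idx x + m * int K"
  using idx_bounds[of x] grid_shift[of "idx x" m] grid_shift[of "idx x - 1" m]
  by (intro idx_eqI) (simp_all add: algebra_simps)

lemma node_outside_cell: "z \<in> range X \<Longrightarrow> z \<le> X (k - 1) \<or> X k \<le> z"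
  by (auto simp: linorder_not_le[symmetric])

lemma node_shift: "z + of_int m \<in> range X \<longleftrightarrow> z \<in> range X"
proof -
  have *: "z + of_int m \<in> range X" if "z \<in> range X" for z m
    using that grid_shift[of _ m] by (metis rangeE rangeI)
  from *[of z m] *[of "z + of_int m" "- m"] show ?thesis by auto
qed

lemma finite_grid: "finite {k. a \<le> X k \<and> X k \<le> b}"
proof (rule finite_subset)
  show "{k. a \<le> X k \<and> X k \<le> b} \<subseteq> {idx a - 1..idx b}"
  proof (auto)
    fix k assume "a \<le> X k" "X k \<le> b"
    then have "X (idx a - 1) \<le> X k" "X k < X (idx b)"
      using idx_bounds[of a] idx_bounds[of b] by linarith+
    then show "idx a - 1 \<le> k" "k \<le> idx b" by simp_all
  qed
qed simp

lemma finite_nodes: "finite (range X \<inter> {a..b})"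
proof -
  have "range X \<inter> {a..b} = X ` {k. a \<le> X k \<and> X k \<le> b}" by auto
  then show ?thesis using finite_grid by simp
qed

lemma idx_measurable: "idx \<in> measurable borel (count_space UNIV)"
proof -
  have "idx -` {k} = {X (k - 1)..<X k}" for k
    by (auto simp: vimage_def idx_iff)
  then show ?thesis
    by (subst measurable_count_space_eq_countable) auto
qed

lemma lbm_idx: "loc_bounded_meas (\<lambda>x. G (idx x))"
  unfolding loc_bounded_meas_def
proof (intro conjI allI)
  show "(\<lambda>x. G (idx x)) \<in> borel_measurable borel"
    by (rule measurable_compose[OF idx_measurable]) simp
  fix a b :: real
  have "\<forall>x\<in>{a..b}. \<bar>G (idx x)\<bar> \<le> (\<Sum>k\<in>{idx a..idx b}. \<bar>G k\<bar>)"
  proof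
    fix x assume x: "x \<in> {a..b}"
    then have "X (idx a - 1) < X (idx x)" "X (idx x - 1) < X (idx b)"
      using idx_bounds[of a] idx_bounds[of b] idx_bounds[of x]
      unfolding atLeastAtMost_iff by linarith+
    then have "idx x \<in> {idx a..idx b}" by simp
    then show "\<bar>G (idx x)\<bar> \<le> (\<Sum>k\<in>{idx a..idx b}. \<bar>G k\<bar>)"
      by (rule member_le_sum) auto
  qed
  then show "\<exists>B. \<forall>x\<in>{a..b}. \<bar>G (idx x)\<bar> \<le> B" ..
qed

lemma has_integral_cells:
  fixes h :: "real \<Rightarrow> real"
  assumes "\<And>k. k \<in> {i + 1..i + int n} \<Longrightarrow> (h has_integral J k) {X (k - 1)..X k}"
  shows "(h has_integral sum J {i + 1..i + int n}) {X i..X (i + int n)}"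
  using assms
proof (induction n)
  case 0
  then show ?case using has_integral_refl(1)[of h "X i"] by simp
next
  case (Suc n)
  have "(h has_integral (sum J {i + 1..i + int n} + J (i + int (Suc n)))) {X i..X (i + int (Suc n))}"
  proof (rule Henstock_Kurzweil_Integration.has_integral_combine)
    show "(h has_integral sum J {i + 1..i + int n}) {X i..X (i + int n)}"
      by (rule Suc.IH) (use Suc.prems in auto)
    show "(h has_integral J (i + int (Suc n))) {X (i + int n)..X (i + int (Suc n))}"
      using Suc.prems[of "i + int (Suc n)"] by (simp add: algebra_simps)
  qed auto
  moreover have "{i + 1..i + int (Suc n)} = insert (i + int (Suc n)) {i + 1..i + int n}" by auto
  ultimately show ?case by (simp add: add.commute)
qed

lemma integral_cells:
  fixes h :: "real \<Rightarrow> real"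
  assumes "\<And>k. k \<in> {i + 1..i + int n} \<Longrightarrow> h integrable_on {X (k - 1)..X k}"
  shows "integral {X i..X (i + int n)} h = (\<Sum>k\<in>{i + 1..i + int n}. integral {X (k - 1)..X k} h)"
  by (intro integral_unique has_integral_cells integrable_integral assms)

lemma integral_idx_cell:
  "integral {X (k - 1)..X k} (\<lambda>x. H (idx x) x) = integral {X (k - 1)..X k} (H k)"
\<comment> \<open>At the right end point the index has already jumped to k + 1.\<close>
proof (rule integral_spike[of "{X k}"])
  show "H k x = H (idx x) x" if "x \<in> {X (k - 1)..X k} - {X k}" for x
    using that idx_eqI[of k x] by auto
qed simp

text \<open>Turns the continuum part of a bond energy into a finite sum over cells, which can then
  be differentiated term by term with respect to the deformation.\<close>

lemma LINT_idx:
  assumes S: "S \<in> sets borel" and J: "finite J" "S \<subseteq> (\<Union>k\<in>J. {X (k - 1)..<X k})"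
  shows "(LINT x:S|lborel. G (idx x)) = (\<Sum>k\<in>J. measure lborel (S \<inter> {X (k - 1)..<X k}) * G k)"
proof -
  have fin: "emeasure lborel (S \<inter> {X (k - 1)..<X k}) < \<infinity>" for k
  proof -
    have "emeasure lborel (S \<inter> {X (k - 1)..<X k}) \<le> emeasure lborel {X (k - 1)..X k}"
      by (rule emeasure_mono) (auto intro: less_imp_le)
    also have "\<dots> < \<infinity>" by simp
    finally show ?thesis .
  qed
  have "(LINT x:S|lborel. G (idx x)) = (LINT x|lborel. (\<Sum>k\<in>J. indicator (S \<inter> {X (k - 1)..<X k}) x * G k))"
    unfolding set_lebesgue_integral_def
  proof (rule Bochner_Integration.integral_cong)
    fix x
    have "(\<Sum>k\<in>J. indicator (S \<inter> {X (k - 1)..<X k}) x * G k)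
      = (\<Sum>k\<in>J. if k = idx x then indicator S x * G k else 0)"
      by (intro sum.cong) (auto simp: indicator_def idx_bounds dest: idx_eqI)
    also have "\<dots> = indicator S x * G (idx x)"
    proof (cases "x \<in> S")
      case True
      then have "idx x \<in> J" using J idx_eqI[of _ x] by force
      then show ?thesis using J by simp
    next
      case False
      then show ?thesis by (simp add: sum.neutral)
    qed
    finally show "indicator S x *\<^sub>R G (idx x) = (\<Sum>k\<in>J. indicator (S \<inter> {X (k - 1)..<X k}) x * G k)"
      by simp
  qed simp
  also have "\<dots> = (\<Sum>k\<in>J. LINT x|lborel. indicator (S \<inter> {X (k - 1)..<X k}) x * G k)"
    using fin S by (intro Bochner_Integration.integral_sum) (auto intro!: integrable_mult_left integrable_real_indicator)
  also have "\<dots> = (\<Sum>k\<in>J. measure lborel (S \<inter> {X (k - 1)..<X k}) * G k)"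
    using S by (intro sum.cong) auto
  finally show ?thesis .
qed

section \<open>Slopes and piecewise affine interpolation on a periodic grid\<close>

definition slope :: "(int \<Rightarrow> real) \<Rightarrow> int \<Rightarrow> real" where
  "slope v k = (v k - v (k - 1)) / (X k - X (k - 1))"

lemma pw_affine_idx: "pw_affine X v x = v (idx x - 1) + slope v (idx x) * (x - X (idx x - 1))"
  by (simp add: pw_affine_def slope_def idx_def Let_def)

lemma pw_affine_cell:
  assumes "X (k - 1) \<le> x" "x \<le> X k"
  shows "pw_affine X v x = v (k - 1) + slope v k * (x - X (k - 1))"
proof (cases "x < X k")
  case True
  then show ?thesis using assms idx_eqI[of k x] by (simp add: pw_affine_idx)
next
  case False
  then have x: "x = X k" using assms by simp
  have "idx x = k + 1" by (rule idx_eqI) (auto simp: x)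
  then show ?thesis using grid_less[of k] by (simp add: pw_affine_idx slope_def x)
qed

lemma pw_affine_node [simp]: "pw_affine X v (X k) = v k"
  using pw_affine_cell[of "k + 1" "X k" v] by simp

lemma slope_linear: "slope (\<lambda>k. a * v k + b * w k) k = a * slope v k + b * slope w k"
proof -
  define h where "h = X k - X (k - 1)"
  have "h \<noteq> 0" by (simp add: h_def)
  then show ?thesis unfolding slope_def h_def[symmetric] by (simp add: field_simps)
qed

lemma pw_affine_linear:
  "pw_affine X (\<lambda>k. a * v k + b * w k) x = a * pw_affine X v x + b * pw_affine X w x"
  unfolding pw_affine_idx slope_linear by (simp add: algebra_simps)

lemma continuous_pw_affine: "continuous_on S (pw_affine X v)"
proof -
  have c: "continuous_on {X (k - 1)..X k} (pw_affine X v)" for k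
    by (rule continuous_on_eq[of _ "\<lambda>x. v (k - 1) + slope v k * (x - X (k - 1))"])
      (auto intro!: continuous_intros simp: pw_affine_cell)
  have "isCont (pw_affine X v) x" for x
  proof -
    define k where "k = idx x"
    \<comment> \<open>x may be the left node of its cell; with the preceding cell added it becomes
      an interior point.\<close>
    have "continuous_on ({X (k - 1 - 1)..X (k - 1)} \<union> {X (k - 1)..X k}) (pw_affine X v)"
      by (intro continuous_on_closed_Un c) auto
    moreover have "{X (k - 1 - 1)..X (k - 1)} \<union> {X (k - 1)..X k} = {X (k - 1 - 1)..X k}"
      by (intro ivl_disj_un_two_touch) auto
    ultimately have "continuous_on {X (k - 1 - 1)..X k} (pw_affine X v)" by simp
    moreover have "x \<in> interior {X (k - 1 - 1)..X k}"
      unfolding interior_atLeastAtMost_real greaterThanLessThan_iff k_def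
      using less_le_trans[OF grid_less idx_bounds(1)] idx_bounds(2) by blast
    ultimately show ?thesis by (rule continuous_on_interior)
  qed
  then show ?thesis by (intro continuous_at_imp_continuous_on) auto
qed

lemma has_derivative_pw_affine:
  assumes "X (k - 1) < x" "x < X k"
  shows "(pw_affine X v has_real_derivative slope v k) (at x)"
proof (rule has_field_derivative_transform_within_open)
  show "((\<lambda>x. v (k - 1) + slope v k * (x - X (k - 1))) has_real_derivative slope v k) (at x)"
    by (auto intro!: derivative_eq_intros)
  show "open {X (k - 1)<..<X k}" "x \<in> {X (k - 1)<..<X k}" using assms by auto
  show "v (k - 1) + slope v k * (y - X (k - 1)) = pw_affine X v y" if "y \<in> {X (k - 1)<..<X k}" for y
    using that pw_affine_cell[of k y v] by simp
qed

lemma idx_strict: "x \<notin> range X \<Longrightarrow> X (idx x - 1) < x"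
  using idx_bounds[of x] by (metis order_le_less rangeI)

lemma deriv_pw_affine: "x \<notin> range X \<Longrightarrow> deriv (pw_affine X v) x = slope v (idx x)"
  by (intro DERIV_imp_deriv has_derivative_pw_affine idx_bounds idx_strict)

lemma has_integral_slope:
  assumes "a \<le> b"
  shows "((\<lambda>x. slope v (idx x)) has_integral (pw_affine X v b - pw_affine X v a)) {a..b}"
proof (rule fundamental_theorem_of_calculus_interior_strong[OF finite_nodes[of a b] assms])
  fix x assume "x \<in> {a<..<b} - range X \<inter> {a..b}"
  then have "x \<notin> range X" by auto
  then show "(pw_affine X v has_vector_derivative slope v (idx x)) (at x)"
    using has_derivative_pw_affine idx_bounds idx_strict
    by (simp add: has_real_derivative_iff_has_vector_derivative[symmetric])
qed (rule continuous_pw_affine)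

text \<open>\<open>deriv\<close> differs from the slope at most at the nodes, which form a countable
  and hence null set.\<close>

lemma LINT_deriv_pw_affine:
  fixes Q :: "real \<Rightarrow> real \<Rightarrow> real"
  shows
  "(LINT x:S|lborel. Q x (deriv (pw_affine X v) x)) = (LINT x:S|lborel. Q x (slope v (idx x)))"
  unfolding set_lebesgue_integral_def
proof (rule integral_discrete_difference[where X = "range X"])
  fix x assume "x \<notin> range X"
  then show "indicator S x *\<^sub>R Q x (deriv (pw_affine X v) x) = indicator S x *\<^sub>R Q x (slope v (idx x))"
    by (simp add: deriv_pw_affine)
qed auto

lemma slope_period:
  assumes "\<And>k. v (k + int K) = v k + c"
  shows "slope v (k + int K) = slope v k"
  using assms[of k] assms[of "k - 1"] grid_period[of k] grid_period[of "k - 1"]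
  by (simp add: slope_def algebra_simps)

lemma pw_affine_period:
  assumes "\<And>k. v (k + int K) = v k + c"
  shows "pw_affine X v (x + 1) = pw_affine X v x + c"
proof -
  have i: "idx (x + 1) = idx x + int K" using idx_shift[of x 1] by simp
  have j: "idx x + int K - 1 = idx x - 1 + int K" by simp
  show ?thesis
    unfolding pw_affine_idx i j assms grid_period slope_period[of v c, OF assms] by simp
qed

lemma integral_pw_affine_cell:
  "integral {X (k - 1)..X k} (pw_affine X v) = (X k - X (k - 1)) * (v (k - 1) + v k) / 2"
proof -
  define G where "G x = v (k - 1) * x + slope v k * (x - X (k - 1))\<^sup>2 / 2" for x
  have "(pw_affine X v has_integral (G (X k) - G (X (k - 1)))) {X (k - 1)..X k}"
  proof (rule fundamental_theorem_of_calculus)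
    fix x assume "x \<in> {X (k - 1)..X k}"
    then have "pw_affine X v x = v (k - 1) + slope v k * (x - X (k - 1))" by (simp add: pw_affine_cell)
    then show "(G has_vector_derivative pw_affine X v x) (at x within {X (k - 1)..X k})"
      unfolding has_real_derivative_iff_has_vector_derivative[symmetric] G_def
      by (auto intro!: derivative_eq_intros)
  qed simp
  moreover have "G (X k) - G (X (k - 1)) = (X k - X (k - 1)) * (v (k - 1) + v k) / 2"
    using grid_less[of k] by (simp add: G_def slope_def power2_eq_square field_simps)
  ultimately show ?thesis by (simp add: integral_unique)
qed

lemma P1_pw_affine:
  assumes "y \<in> P1 X" shows "y = pw_affine X (\<lambda>k. y (X k))"
proof
  fix x
  define k where "k = idx x"
  obtain a b where ab: "\<And>x. x \<in> element X k \<Longrightarrow> y x = a * x + b"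
    using assms unfolding P1_def by blast
  have el: "X k \<in> element X k" "X (k - 1) \<in> element X k" "x \<in> element X k"
    using idx_bounds[of x] grid_less[of k] by (auto simp: element_def k_def)
  have "slope (\<lambda>k. y (X k)) k = a"
    using ab[OF el(1)] ab[OF el(2)] grid_less[of k] by (simp add: slope_def field_simps)
  then show "y x = pw_affine X (\<lambda>k. y (X k)) x"
    unfolding pw_affine_idx k_def[symmetric] using ab[OF el(2)] ab[OF el(3)]
    by (simp add: algebra_simps)
qed

lemma pw_affine_P1: "pw_affine X v \<in> P1 X"
  unfolding P1_def
proof (intro CollectI conjI allI continuous_pw_affine)
  fix k
  have "pw_affine X v x = slope v k * x + (v (k - 1) - slope v k * X (k - 1))" if "x \<in> element X k" for x
    using that pw_affine_cell[of k x v] by (simp add: element_def algebra_simps)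
  then show "\<exists>a b. \<forall>x\<in>element X k. pw_affine X v x = a * x + b" by blast
qed

end

section \<open>Geometry of the mesh\<close>

locale qc_grid = qc_mesh N La Ra K X for N La Ra K X +
  assumes N_pos: "0 < N"
begin

abbreviation L :: "int \<Rightarrow> real" where "L \<equiv> \<lambda>l. eps N * of_int l"

abbreviation Oa :: "real set" where "Oa \<equiv> Omega_a_per La Ra"

abbreviation Oc :: "real set" where "Oc \<equiv> Omega_c_per La Ra"

abbreviation Ot :: "real set" where "Ot \<equiv> Omega_c_tilde N La Ra"

lemma eps_pos: "0 < eps N"
  using N_pos by (simp add: eps_def)

lemma eps_period: "eps N * (2 * real N) = 1"
  using N_pos by (simp add: eps_def)

lemma L_shift: "L (l + 2 * int N * m) = L l + of_int m"
  using N_pos by (simp add: eps_def field_simps)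

sublocale mesh: periodic_grid X K
  by unfold_locales (use increasing T1 in auto)

sublocale lat: periodic_grid L "2 * N"
  by unfold_locales (use N_pos eps_pos L_shift[of _ 1] in auto)

lemma L_diff: "L l - L (l - 1) = eps N"
  by (simp add: algebra_simps)

section \<open>The periodic atomistic and continuum regions\<close>

lemma Oa_iff: "x \<in> Oa \<longleftrightarrow> (\<exists>m::int. La + m < x \<and> x < Ra + m)"
proof
  assume "x \<in> Oa"
  then obtain q :: real and m :: int where "x = q + m" "La < q" "q < Ra"
    by (auto simp: Omega_a_per_def periodic_ext_def Omega_a_def)
  then show "\<exists>m::int. La + m < x \<and> x < Ra + m" by (intro exI[of _ m]) auto
next
  assume "\<exists>m::int. La + m < x \<and> x < Ra + m"
  then obtain m :: int where "La + m < x" "x < Ra + m" by blast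
  then have "x = (x - m) + of_int m" "x - m \<in> Omega_a La Ra" by (auto simp: Omega_a_def)
  then show "x \<in> Oa" unfolding Omega_a_per_def periodic_ext_def by blast
qed

text \<open>The translates of the closed unit interval \<open>Omega\<close> overlap only at
  half-integers, and none of these lies in \<open>Oa\<close> because -1/2 < \<open>La\<close> and
  \<open>Ra\<close> < 1/2. Hence the two periodic regions are complementary.\<close>

lemma Oc_iff: "x \<in> Oc \<longleftrightarrow> x \<notin> Oa"
proof
  assume "x \<in> Oc"
  then obtain q m where q: "x = q + of_int m" "q \<in> Omega_c La Ra"
    by (auto simp: Omega_c_per_def periodic_ext_def)
  show "x \<notin> Oa"
  proof
    assume "x \<in> Oa"
    then obtain m' :: int where m': "La + m' < x" "x < Ra + m'" using Oa_iff by blast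
    have "-1/2 \<le> q" "q \<le> 1/2" using q by (auto simp: Omega_c_def Omega_def)
    then have "of_int (m' - m) < (1::real)" "of_int (m - m') < (1::real)"
      using m' q atomistic_region by auto
    then have "m = m'" by linarith
    then show False using m' q by (auto simp: Omega_c_def Omega_a_def)
  qed
next
  assume x: "x \<notin> Oa"
  define m where "m = \<lfloor>x + 1/2\<rfloor>"
  have "- 1 / 2 \<le> x - m" "x - m \<le> 1 / 2" unfolding m_def by linarith+
  moreover have "\<not> (La < x - m \<and> x - m < Ra)" using x Oa_iff[of x] by (auto simp: algebra_simps)
  ultimately have "x - m \<in> Omega_c La Ra"
    by (simp add: Omega_c_def Omega_def Omega_a_def)
  then show "x \<in> Oc"
    unfolding Omega_c_per_def periodic_ext_def by (intro CollectI exI[of _ "x - m"] exI[of _ m]) auto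
qed

lemma Oa_shift: "x + of_int m \<in> Oa \<longleftrightarrow> x \<in> Oa"
proof -
  have *: "x + of_int m \<in> Oa" if x: "x \<in> Oa" for x m
  proof -
    obtain m' :: int where "La + m' < x" "x < Ra + m'" using x Oa_iff by blast
    then show ?thesis unfolding Oa_iff by (intro exI[of _ "m' + m"]) auto
  qed
  from *[of x m] *[of "x + of_int m" "- m"] show ?thesis by auto
qed

lemma Oa_measurable [measurable]: "Oa \<in> sets borel"
proof -
  have "Oa = (\<Union>m::int. {La + m<..<Ra + m})" using Oa_iff by auto
  then show ?thesis by auto
qed

lemma Oc_measurable [measurable]: "Oc \<in> sets borel"
proof -
  have "Oc = - Oa" using Oc_iff by auto
  then show ?thesis by (simp add: borel_comp)
qed

text \<open>\<open>Omega_c\<close> consists of two pieces, but its periodic extension joins them: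
  the components are the closed gaps between consecutive copies of the atomistic interval.\<close>

lemma Oc_cases: "x \<in> Oc \<longleftrightarrow> (\<exists>m::int. Ra + m \<le> x \<and> x \<le> La + m + 1)"
proof
  assume x: "x \<in> Oc"
  define m where "m = \<lfloor>x - Ra\<rfloor>"
  have m: "Ra + m \<le> x" "x < Ra + m + 1" unfolding m_def by linarith+
  have "x \<le> La + m + 1"
  proof (rule ccontr)
    assume "\<not> ?thesis"
    then have "x \<in> Oa" unfolding Oa_iff using m by (intro exI[of _ "m + 1"]) auto
    with x Oc_iff show False by blast
  qed
  with m show "\<exists>m::int. Ra + m \<le> x \<and> x \<le> La + m + 1" by blast
next
  assume "\<exists>m::int. Ra + m \<le> x \<and> x \<le> La + m + 1"
  then obtain m :: int where m: "Ra + m \<le> x" "x \<le> La + m + 1" by blast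
  have "x \<notin> Oa"
  proof
    assume "x \<in> Oa"
    then obtain m' :: int where "La + m' < x" "x < Ra + m'" using Oa_iff by blast
    then have "real_of_int m < real_of_int m'" "real_of_int m' < real_of_int (m + 1)"
      using m by auto
    then show False by (simp only: of_int_less_iff)
  qed
  then show "x \<in> Oc" using Oc_iff by blast
qed

lemma La_node: "La + of_int m \<in> range X" and Ra_node: "Ra + of_int m \<in> range X"
  using T3 mesh.node_shift by auto

lemma lattice_node: "x \<in> Oa \<Longrightarrow> x \<in> range L \<longleftrightarrow> x \<in> range X"
proof -
  assume "x \<in> Oa"
  then obtain m :: int where m: "La + m < x" "x < Ra + m" using Oa_iff by blast
  then have "x - m \<in> Omega_a La Ra" by (auto simp: Omega_a_def)
  then have "x - m \<in> range L \<longleftrightarrow> x - m \<in> range X"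
    using T2 by (auto simp: set_eq_iff)
  then show ?thesis using mesh.node_shift[of x "- m"] lat.node_shift[of x "- m"] by simp
qed

text \<open>The element that starts at the node \<open>Ra\<close> ends before the next copy of
  \<open>La\<close>, hence lies in the continuum region, where (T4) bounds its length from below.
  Consequently no bond can meet two copies of the atomistic interval.\<close>

lemma gap_ge: "2 * eps N \<le> La + 1 - Ra"
proof -
  obtain k where k: "X k = Ra" using T3 by auto
  have "La + 1 \<in> range X" using La_node[of 1] by simp
  then have "X (k + 1) \<le> La + 1"
    using mesh.node_outside_cell[of "La + 1" "k + 1"] k atomistic_region by auto
  moreover have "element X (k + 1) \<subseteq> Oc"
  proof
    fix x assume "x \<in> element X (k + 1)"
    then have "Ra + of_int 0 \<le> x" "x \<le> La + of_int 0 + 1"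
      using k calculation by (auto simp: element_def)
    then show "x \<in> Oc" unfolding Oc_cases by blast
  qed
  ultimately show ?thesis using T4[of "k + 1"] k by (simp add: elem_len_def)
qed

text \<open>The interfaces are nodes and no node is interior to an element, so the midpoint decides
  on which side the whole element lies.\<close>

lemma element_cases:
  obtains (cont) m :: int where "Ra + m \<le> X (k - 1)" "X k \<le> La + m + 1"
  | (atom) m :: int where "La + m \<le> X (k - 1)" "X k \<le> Ra + m"
proof -
  define z where "z = (X (k - 1) + X k) / 2"
  have z: "X (k - 1) < z" "z < X k" using increasing[of k] by (auto simp: z_def)
  have *: "w \<le> z \<Longrightarrow> w \<le> X (k - 1)" "z \<le> w \<Longrightarrow> X k \<le> w" if "w \<in> range X" for w
    using mesh.node_outside_cell[OF that, of k] z by auto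
  show thesis
  proof (cases "z \<in> Oa")
    case True
    then obtain m :: int where "La + m < z" "z < Ra + m" using Oa_iff by blast
    then show thesis using atom[of m] *[OF La_node[of m]] *[OF Ra_node[of m]] by auto
  next
    case False
    then obtain m :: int where "Ra + m \<le> z" "z \<le> La + m + 1" using Oc_iff Oc_cases by blast
    then show thesis using cont[of m] *[OF Ra_node[of m]] *[OF La_node[of "m + 1"]] by (auto simp: add.assoc)
  qed
qed

section \<open>Lattice cells that meet the continuum region\<close>

lemma lattice_cell_eq: "lattice_cell N l = {L (l - 1)<..<L l}"
  by (simp add: lattice_cell_def)

lemma closure_lattice_cell: "closure (lattice_cell N l) = {L (l - 1)..L l}"
  unfolding lattice_cell_eq by (rule closure_greaterThanLessThan) (rule lat.grid_less)

definition cell_in :: "int \<Rightarrow> bool" where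
  "cell_in l \<longleftrightarrow> 0 < measure lborel (lattice_cell N l \<inter> Oc)"

lemma cell_inI:
  assumes "a < b" "{a<..<b} \<subseteq> lattice_cell N l" "{a<..<b} \<subseteq> Oc"
  shows "cell_in l"
proof -
  have "emeasure lborel (lattice_cell N l \<inter> Oc) \<le> emeasure lborel {L (l - 1)..L l}"
    by (rule emeasure_mono) (auto simp: lattice_cell_def)
  also have "\<dots> < \<infinity>" by (rule emeasure_bounded_finite) simp
  finally have fin: "emeasure lborel (lattice_cell N l \<inter> Oc) < \<infinity>" .
  have "measure lborel {a<..<b} \<le> measure lborel (lattice_cell N l \<inter> Oc)"
    by (rule measure_mono_fmeasurable)
      (use assms fin in \<open>auto simp: fmeasurable_def lattice_cell_def\<close>)
  then show ?thesis using assms(1) by (simp add: cell_in_def)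
qed

lemma Ot_eq: "Ot = (\<Union>l\<in>Collect cell_in. {L (l - 1)..L l})"
  by (simp add: Omega_c_tilde_def cell_in_def[abs_def] closure_lattice_cell)

lemma cell_in_Ot: "cell_in l \<Longrightarrow> {L (l - 1)..L l} \<subseteq> Ot"
  unfolding Ot_eq by blast

lemma cell_out_Ot: "\<not> cell_in l \<Longrightarrow> {L (l - 1)<..<L l} \<inter> Ot = {}"
proof (rule ccontr)
  assume l: "\<not> cell_in l" and "{L (l - 1)<..<L l} \<inter> Ot \<noteq> {}"
  then obtain x j where x: "L (l - 1) < x" "x < L l" "L (j - 1) \<le> x" "x \<le> L j" "cell_in j"
    unfolding Ot_eq by auto
  then have "L (l - 1) < L j" "L (j - 1) < L l" by linarith+
  then have "l - 1 < j" "j - 1 < l" by (simp_all only: lat.grid_less_iff)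
  then have "j = l" by linarith
  with l x show False by simp
qed

text \<open>The definition asks for cells meeting \<open>Oc\<close> in positive measure, and a point
  of \<open>Oc\<close> may be a boundary point. Each component of \<open>Oc\<close> has length at
  least 2 eps, so to the right of the point, or to its left if it is the right end of its component,
  there is an interval of \<open>Oc\<close> within one cell whose closure contains the
  point.\<close>

lemma Oc_subset_Ot: "Oc \<subseteq> Ot"
proof
  fix x assume "x \<in> Oc"
  then obtain m :: int where m: "Ra + m \<le> x" "x \<le> La + m + 1" using Oc_cases by blast
  have sub: "{a<..<b} \<subseteq> Oc" if "Ra + m \<le> a" "b \<le> La + m + 1" for a b
    using that by (auto simp: Oc_cases intro!: exI[of _ m])
  show "x \<in> Ot"
  proof (cases "x < La + m + 1")
    case True
    let ?l = "lat.idx x"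
    have x: "L (?l - 1) \<le> x" "x < L ?l" using lat.idx_bounds by auto
    have "cell_in ?l"
      by (rule cell_inI[of x "min (L ?l) (La + m + 1)"])
        (use x True m in \<open>auto simp: lattice_cell_eq intro!: sub[THEN subsetD]\<close>)
    then show ?thesis using x cell_in_Ot[of ?l] by auto
  next
    case False
    \<comment> \<open>Here \<open>Oc\<close> extends only to the left of x, so a lattice point is
      assigned to the cell on its left, against the convention of \<open>idx\<close>.\<close>
    define l where "l = (if L (lat.idx x - 1) = x then lat.idx x - 1 else lat.idx x)"
    have x: "L (l - 1) < x" "x \<le> L l"
      using lat.idx_bounds[of x] lat.grid_less[of "lat.idx x - 1"] by (auto simp: l_def)
    have "Ra + m < x" using False gap_ge eps_pos by linarith
    then have "cell_in l"
      by (intro cell_inI[of "max (L (l - 1)) (Ra + m)" x])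
        (use x False m in \<open>auto simp: lattice_cell_eq intro!: sub[THEN subsetD]\<close>)
    then show ?thesis using x cell_in_Ot[of l] by auto
  qed
qed

text \<open>Decisive for the forces: where f need not be smooth, the elements are lattice cells and
  both quadrature rules agree exactly. Inside the atomistic region nodes and lattice points
  coincide, so an atomistic element lies in one cell. It can fail to fill this cell only by ending
  at an interface strictly inside it, and then the cell meets the continuum region in positive
  measure.\<close>

lemma element_tilde_cases:
  obtains (sub) "element X k \<subseteq> Ot" 
  | (out) l where "\<not> cell_in l" "X (k - 1) = L (l - 1)" "X k = L l"
proof (cases rule: element_cases[of k])
  case (cont m)
  then have "element X k \<subseteq> Oc" by (auto simp: element_def Oc_cases intro!: exI[of _ m])
  then show ?thesis using Oc_subset_Ot sub by blast
next
  case (atom m)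
  have no: "L l \<le> X (k - 1) \<or> X k \<le> L l" for l
  proof (rule ccontr)
    assume a: "\<not> ?thesis"
    then have "L l \<in> Oa" unfolding Oa_iff using atom by (intro exI[of _ m]) auto
    then have "L l \<in> range X" using lattice_node by blast
    then show False using a mesh.node_outside_cell[of "L l" k] by auto
  qed
  define l where "l = lat.idx (X (k - 1))"
  have l: "L (l - 1) \<le> X (k - 1)" "X (k - 1) < L l" using lat.idx_bounds by (auto simp: l_def)
  then have l': "X k \<le> L l" using no[of l] by auto
  show ?thesis
  proof (cases "cell_in l")
    case True
    have "element X k \<subseteq> {L (l - 1)..L l}"
      unfolding element_def using l l' by (intro atLeastatMost_subset_iff[THEN iffD2]) blast
    then show ?thesis using cell_in_Ot[OF True] sub by blast
  next
    case False
    have X1: "X (k - 1) = L (l - 1)"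
    proof (rule ccontr)
      assume ne: "X (k - 1) \<noteq> L (l - 1)"
      have "X (k - 1) \<notin> Oa"
      proof
        assume "X (k - 1) \<in> Oa"
        then obtain j where j: "X (k - 1) = L j" using lattice_node[of "X (k - 1)"] by auto
        have "L (l - 1) < L j" "L j < L l"
          using order.not_eq_order_implies_strict[OF ne[symmetric] l(1)] l(2) unfolding j .
        then have "l - 1 < j" "j < l" by (simp_all only: lat.grid_less_iff)
        then show False by linarith
      qed
      moreover have "X (k - 1) < Ra + m" using atom increasing[of k] by linarith
      ultimately have "\<not> La + m < X (k - 1)" unfolding Oa_iff by blast
      then have eq: "X (k - 1) = La + m" using atom by linarith
      \<comment> \<open>The left interface lies strictly inside the cell, and the part of the cell
        just to its left belongs to \<open>Oc\<close>; the maximum keeps the witness interval within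
        one gap.\<close>
      have "cell_in l"
        by (rule cell_inI[of "max (L (l - 1)) (Ra + (m - 1))" "La + m"])
          (use ne l eq gap_ge eps_pos in \<open>auto simp: lattice_cell_eq Oc_cases intro!: exI[of _ "m - 1"]\<close>)
      with False show False ..
    qed
    have X2: "X k = L l"
    proof (rule ccontr)
      assume ne: "X k \<noteq> L l"
      have kl: "L (l - 1) < X k" using increasing[of k] X1 by simp
      have "X k \<notin> Oa"
      proof
        assume "X k \<in> Oa"
        then obtain j where j: "X k = L j" using lattice_node[of "X k"] by auto
        have "L (l - 1) < L j" "L j < L l"
          using kl order.not_eq_order_implies_strict[OF ne l'] unfolding j .
        then have "l - 1 < j" "j < l" by (simp_all only: lat.grid_less_iff)
        then show False by linarith
      qed
      moreover have "La + m < X k" using atom increasing[of k] by linarith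
      ultimately have "\<not> X k < Ra + m" unfolding Oa_iff by blast
      then have eq: "X k = Ra + m" using atom by linarith
      have "cell_in l"
        by (rule cell_inI[of "Ra + m" "min (L l) (La + m + 1)"])
          (use ne l' kl eq gap_ge eps_pos in \<open>auto simp: lattice_cell_eq Oc_cases intro!: exI[of _ m]\<close>)
      with False show False ..
    qed
    show ?thesis by (rule out[OF False X1 X2])
  qed
qed

lemma cell_in_shift: "cell_in (l + 2 * int N * m) \<longleftrightarrow> cell_in l"
proof -
  have tr: "(+) c ` S = (\<lambda>x. x - c) -` S" for c :: real and S
  proof (intro set_eqI iffI)
    fix x assume "x \<in> (\<lambda>x. x - c) -` S"
    then show "x \<in> (+) c ` S" by (intro image_eqI[of _ _ "x - c"]) auto
  qed auto
  have eq: "lattice_cell N (l + 2 * int N * m) \<inter> Oc = (+) (real_of_int m) ` (lattice_cell N l \<inter> Oc)"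
  proof -
    have "x \<in> lattice_cell N (l + 2 * int N * m) \<inter> Oc \<longleftrightarrow> x - of_int m \<in> lattice_cell N l \<inter> Oc" for x
    proof -
      have L: "L (l + 2 * int N * m) = L l + m" "L (l + 2 * int N * m - 1) = L (l - 1) + m"
        using L_shift[of l m] L_shift[of "l - 1" m] by (simp_all add: algebra_simps)
      have "x - m \<in> Oa \<longleftrightarrow> x \<in> Oa" using Oa_shift[of x "- m"] by simp
      then show ?thesis
        unfolding lattice_cell_eq Int_iff greaterThanLessThan_iff Oc_iff L by auto
    qed
    then show ?thesis unfolding tr by blast
  qed
  have "measure lborel ((+) (real_of_int m) ` S) = measure lborel S" if "S \<in> sets borel" for S :: "real set"
  proof -
    have "S \<in> sets lebesgue" using that by simp
    have "measure lebesgue ((+) (real_of_int m) ` S) = measure lebesgue S" by (rule measure_translation)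
    moreover have "(+) (real_of_int m) ` S \<in> sets borel"
      unfolding tr using measurable_sets_borel[OF _ that, of "\<lambda>x::real. x - m"] by simp
    ultimately show ?thesis using that by simp
  qed
  then show ?thesis unfolding cell_in_def eq by (simp add: lattice_cell_def)
qed

lemma Ot_shift: "x + of_int m \<in> Ot \<longleftrightarrow> x \<in> Ot"
proof -
  have *: "x + of_int m \<in> Ot" if x: "x \<in> Ot" for x m
  proof -
    obtain l where l: "cell_in l" "L (l - 1) \<le> x" "x \<le> L l" using x unfolding Ot_eq by auto
    have "l + 2 * int N * m - 1 = l - 1 + 2 * int N * m" by simp
    with l have "L (l + 2 * int N * m - 1) \<le> x + of_int m" "x + of_int m \<le> L (l + 2 * int N * m)"
      using L_shift by (metis add_le_cancel_right)+
    then show ?thesis unfolding Ot_eq using l cell_in_shift[of l m] by auto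
  qed
  from *[of x m] *[of "x + of_int m" "- m"] show ?thesis by auto
qed

text \<open>By \<open>gap_ge\<close> an open interval of length at most 2 eps meets only one copy of
  the atomistic interval. Each end of the intersection is either an interface, which is a node, or a
  lattice point within \<open>Oa\<close>, which is a node by (T2).\<close>

lemma lattice_ivl_Oa:
  assumes ab: "a \<in> range L" "b \<in> range L" "b \<le> a + 2 * eps N" and ne: "{a<..<b} \<inter> Oa \<noteq> {}"
  obtains p q m where "{a<..<b} \<inter> Oa = {p<..<q}" "p < q" "p \<in> range X" "q \<in> range X"
    "a \<le> p" "q \<le> b" "p = a \<or> p = La + of_int m" "q = b \<or> q = Ra + of_int m"
proof -
  obtain z where z: "a < z" "z < b" "z \<in> Oa" using ne by auto
  then obtain m :: int where m: "La + m < z" "z < Ra + m" using Oa_iff by blast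
  define p q where "p = max a (La + m)" and "q = min b (Ra + m)"
  have eq: "{a<..<b} \<inter> Oa = {p<..<q}"
  proof (intro equalityI subsetI)
    fix x assume x: "x \<in> {a<..<b} \<inter> Oa"
    then obtain m' :: int where m': "La + m' < x" "x < Ra + m'" using Oa_iff by blast
    have xab: "a < x" "x < b" using x by simp_all
    have "m' = m"
    proof (rule ccontr)
      assume "m' \<noteq> m"
      then consider "m' + 1 \<le> m" | "m + 1 \<le> m'" by linarith
      then show False
      proof cases
        case 1
        then have "real_of_int m' + 1 \<le> m" by linarith
        then show False using m'(2) m(1) xab(1) z(2) gap_ge ab(3) by linarith
      next
        case 2
        then have "real_of_int m + 1 \<le> m'" by linarith
        then show False using m'(1) m(2) xab(2) z(1) gap_ge ab(3) by linarith
      qed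
    qed
    with x m' show "x \<in> {p<..<q}" by (simp add: p_def q_def)
  next
    fix x assume "x \<in> {p<..<q}"
    then have x: "a < x" "x < b" "La + m < x \<and> x < Ra + m" by (simp_all add: p_def q_def)
    then have "x \<in> Oa" unfolding Oa_iff by blast
    with x show "x \<in> {a<..<b} \<inter> Oa" by simp
  qed
  have pq: "p < z" "z < q" using z m by (simp_all add: p_def q_def)
  have pX: "p \<in> range X"
  proof (cases "p = La + m")
    case False
    then have "p = a" "La + m < a" by (auto simp: p_def max_def split: if_splits)
    have "La + m < a \<and> a < Ra + m" using \<open>La + m < a\<close> z m by linarith
    then have "a \<in> Oa" unfolding Oa_iff by blast
    with ab(1) show ?thesis using lattice_node[of a] \<open>p = a\<close> by simp
  qed (simp add: La_node)
  have qX: "q \<in> range X"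
  proof (cases "q = Ra + m")
    case False
    then have "q = b" "b < Ra + m" by (auto simp: q_def min_def split: if_splits)
    have "La + m < b \<and> b < Ra + m" using \<open>b < Ra + m\<close> z m by linarith
    then have "b \<in> Oa" unfolding Oa_iff by blast
    with ab(2) show ?thesis using lattice_node[of b] \<open>q = b\<close> by simp
  qed (simp add: Ra_node)
  have "p < q" using pq by linarith
  moreover have "a \<le> p" "q \<le> b" "p = a \<or> p = La + m" "q = b \<or> q = Ra + m"
    unfolding p_def q_def max_def min_def by simp_all
  ultimately show thesis
    by (rule that[OF eq _ pX qX])
qed

text \<open>Interfaces are nodes that belong to the closed continuum region, so an interval crossing
  one contains a continuum node. Without such a node the interval is purely atomistic, or it avoids
  \<open>Oa\<close> and fits into one element. In both cases atomistic and quasicontinuum stresses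
  will coincide on the bond.\<close>

lemma ivl_without_cont_node:
  assumes ab: "a \<in> range L" "b \<in> range L" "a < b" "b \<le> a + 2 * eps N"
    and no: "\<And>k. X k \<in> Oc \<Longrightarrow> X k \<notin> {a<..<b}"
  obtains (atom) "{a<..<b} \<subseteq> Oa"
  | (cont) k where "{a<..<b} \<inter> Oa = {}" "X (k - 1) \<le> a" "b \<le> X k"
proof (cases "{a<..<b} \<inter> Oa = {}")
  case True
  define k where "k = mesh.idx a"
  have k: "X (k - 1) \<le> a" "a < X k" using mesh.idx_bounds by (auto simp: k_def)
  have "b \<le> X k"
  proof (rule ccontr)
    assume "\<not> ?thesis"
    then have in_ab: "X k \<in> {a<..<b}" using k by auto
    then have "X k \<in> Oc" using True Oc_iff by blast
    with no in_ab show False by blast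
  qed
  then show ?thesis using cont[of k] True k by auto
next
  case False
  obtain p q m where pq: "{a<..<b} \<inter> Oa = {p<..<q}" "p < q" "p \<in> range X" "q \<in> range X"
    "a \<le> p" "q \<le> b" "p = a \<or> p = La + of_int m" "q = b \<or> q = Ra + of_int m"
    by (rule lattice_ivl_Oa[OF ab(1,2,4) False])
  have Oc_end: "La + of_int m \<in> Oc" "Ra + of_int m \<in> Oc"
    unfolding Oc_cases using gap_ge eps_pos
    by (auto intro: exI[of _ "m - 1"] exI[of _ m])
  have "p = a"
  proof (rule ccontr)
    assume "p \<noteq> a"
    then have p: "p = La + of_int m" "p \<in> {a<..<b}" using pq by auto
    obtain i where "p = X i" using pq(3) by blast
    then show False using no[of i] p Oc_end by simp
  qed
  moreover have "q = b"
  proof (rule ccontr)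
    assume "q \<noteq> b"
    then have q: "q = Ra + of_int m" "q \<in> {a<..<b}" using pq by auto
    obtain i where "q = X i" using pq(4) by blast
    then show False using no[of i] q Oc_end by simp
  qed
  ultimately show ?thesis using atom pq by auto
qed

lemma node_representative:
  assumes "X i \<in> Oc"
  obtains k m where "k \<in> {1..int K}" "X k \<in> Omega_c La Ra" "X i = X k + of_int m"
proof -
  \<comment> \<open>The ceiling rather than the floor, since the numbered nodes lie in a window that
    is open at -1/2 and closed at 1/2.\<close>
  define m where "m = - \<lceil>X i - 1 / 2\<rceil>"
  have m: "- 1 / 2 < X i + m" "X i + m \<le> 1 / 2" unfolding m_def by linarith+
  have "X i + m \<in> range X" using mesh.node_shift[of "X i" m] by simp
  then have "X i + m \<in> X ` {1..int K}" unfolding numbering using m by simp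
  then obtain k where k: "X i + m = X k" "k \<in> {1..int K}" by (rule imageE)
  have "X k \<notin> Oa" using assms Oa_shift[of "X i" m] k(1) by (simp add: Oc_iff)
  then have "\<not> (La + of_int 0 < X k \<and> X k < Ra + of_int 0)" using Oa_iff[of "X k"] by blast
  then have "\<not> (La < X k \<and> X k < Ra)" by simp
  then have "X k \<in> Omega_c La Ra" using k(1) m by (simp add: Omega_c_def Omega_def Omega_a_def)
  then show thesis by (rule that[OF k(2), of "- m"]) (use k(1) in simp)
qed

end

section \<open>First variations of the two energies\<close>

lemma int_period_mult:
  fixes P :: "int \<Rightarrow> 'a"
  assumes "\<And>k. P (k + int n) = P k"
  shows "P (k + m * int n) = P k"
proof (induction m rule: int_induct[where k = 0])
  case (step1 i)
  then show ?case using assms[of "k + i * int n"] by (simp add: algebra_simps)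
next
  case (step2 i)
  then show ?case using assms[of "k + (i - 1) * int n"] by (simp add: algebra_simps)
qed simp

lemma int_period_range:
  fixes P :: "int \<Rightarrow> 'a"
  assumes "\<And>k. P (k + int n) = P k" "0 < n"
  shows "P k \<in> P ` {j + 1..j + int n}"
proof -
  define k' where "k' = (k - j - 1) mod int n + j + 1"
  have "k = k' + ((k - j - 1) div int n) * int n"
    unfolding k'_def by (metis (no_types, opaque_lifting) add.assoc add.commute diff_add_cancel diff_diff_eq div_mult_mod_eq)
  then have "P k = P k'" using int_period_mult[of P n k', OF assms(1)] by metis
  moreover have "k' \<in> {j + 1..j + int n}"
    using assms(2) pos_mod_sign[of "int n" "k - j - 1"] pos_mod_bound[of "int n" "k - j - 1"]
    unfolding k'_def atLeastAtMost_iff by linarith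
  ultimately show ?thesis by blast
qed

lemma int_period_bounded:
  fixes P :: "int \<Rightarrow> real"
  assumes "\<And>k. P (k + int n) = P k" "0 < n"
  obtains B where "0 < B" "\<And>k. \<bar>P k\<bar> \<le> B"
proof
  let ?B = "Max ((\<lambda>k. \<bar>P k\<bar>) ` {0 + 1..0 + int n}) + 1"
  have *: "\<bar>P k\<bar> \<le> Max ((\<lambda>k. \<bar>P k\<bar>) ` {0 + 1..0 + int n})" for k
    using int_period_range[of "\<lambda>k. \<bar>P k\<bar>" n k 0] assms by (intro Max_ge) auto
  show "\<bar>P k\<bar> \<le> ?B" for k using *[of k] by linarith
  show "0 < ?B" using *[of 0] by linarith
qed

lemma int_period_pos:
  fixes P :: "int \<Rightarrow> real"
  assumes "\<And>k. P (k + int n) = P k" "0 < n" "\<And>k. 0 < P k"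
  obtains c where "0 < c" "\<And>k. c \<le> P k"
proof
  let ?c = "Min (P ` {0 + 1..0 + int n})"
  show "?c \<le> P k" for k
    using int_period_range[of P n k 0] assms by (intro Min_le) auto
  show "0 < ?c" using assms by (subst Min_gr_iff) auto
qed

text \<open>Makes positivity of all gradients an open condition along a line, so that small
  variations of either sign stay admissible. Periodicity leaves only finitely many gradients to
  control.\<close>

lemma int_period_pos_perturb:
  fixes P Q :: "int \<Rightarrow> real"
  assumes "\<And>k. P (k + int n) = P k" "\<And>k. Q (k + int n) = Q k" "0 < n" "\<And>k. 0 < P k"
  obtains t0 where "0 < t0" "\<And>t k. \<bar>t\<bar> < t0 \<Longrightarrow> 0 < P k + t * Q k"
proof -
  obtain c where c: "0 < c" "\<And>k. c \<le> P k" using int_period_pos[of P n, OF assms(1,3,4)] by blast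
  obtain B where B: "0 < B" "\<And>k. \<bar>Q k\<bar> \<le> B" using int_period_bounded[of Q n, OF assms(2,3)] by blast
  show thesis
  proof
    show "0 < c / B" using c B by simp
    fix t k assume t: "\<bar>t\<bar> < c / B"
    have "\<bar>t * Q k\<bar> \<le> \<bar>t\<bar> * B" unfolding abs_mult by (intro mult_left_mono B) auto
    also have "\<dots> < c" using t B by (simp add: field_simps)
    finally show "0 < P k + t * Q k" using c(2)[of k] by linarith
  qed
qed

text \<open>Because u is bounded, small t keep the perturbed function within the prescribed sup
  distance, and 0 is a local minimum of a function of one variable.\<close>

lemma local_minimizer_stationary:
  assumes min: "local_minimizer E Y y"
    and Y: "0 < t0" "\<And>t. \<bar>t\<bar> < t0 \<Longrightarrow> (\<lambda>x. y x + t * u x) \<in> Y"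
    and u: "0 < B" "\<And>x. \<bar>u x\<bar> \<le> B"
    and der: "((\<lambda>t. E (\<lambda>x. y x + t * u x)) has_real_derivative D) (at 0)"
  shows "D = 0"
proof -
  obtain \<delta> where \<delta>: "0 < \<delta>" "\<And>z. z \<in> Y \<Longrightarrow> (\<And>x. \<bar>z x - y x\<bar> < \<delta>) \<Longrightarrow> E y \<le> E z"
    using min unfolding local_minimizer_def by blast
  define d where "d = min t0 (\<delta> / B)"
  have "E (\<lambda>x. y x + 0 * u x) \<le> E (\<lambda>x. y x + t * u x)" if "\<bar>0 - t\<bar> < d" for t
  proof -
    have t: "\<bar>t\<bar> < t0" "\<bar>t\<bar> * B < \<delta>" using that u by (auto simp: d_def field_simps)
    have "E y \<le> E (\<lambda>x. y x + t * u x)"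
    proof (rule \<delta>(2)[OF Y(2)[OF t(1)]])
      fix x
      have "\<bar>t * u x\<bar> \<le> \<bar>t\<bar> * B" unfolding abs_mult by (intro mult_left_mono u) auto
      then show "\<bar>y x + t * u x - y x\<bar> < \<delta>" using t by simp
    qed
    then show ?thesis by simp
  qed
  moreover have "0 < d" using Y(1) \<delta>(1) u(1) by (simp add: d_def)
  ultimately show ?thesis using DERIV_local_min[OF der, of d] by blast
qed

lemma bdiff_linear: "bdiff N (\<lambda>l. v l + t * u l) l = bdiff N v l + t * bdiff N u l"
  by (simp add: bdiff_def add_divide_distrib diff_divide_distrib algebra_simps)

lemma diff_quot_ivl: "p < q \<Longrightarrow> diff_quot {p<..<q} v = (v q - v p) / (q - p)"
  by (simp add: diff_quot_def)

lemma diff_quot_linear: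
  "diff_quot S (\<lambda>x. v x + t * u x) = diff_quot S v + t * diff_quot S u"
  by (simp add: diff_quot_def add_divide_distrib diff_divide_distrib algebra_simps)

lemma LINT_open_ivl:
  assumes "loc_bounded_meas g" "S \<in> sets borel"
  shows "(LINT x:{a<..<b} \<inter> S|lborel. g x) = integral {a..b} (\<lambda>x. indicator S x * g x)"
proof -
  have "(LINT x:{a<..<b} \<inter> S|lborel. g x) = integral {a..b} (\<lambda>x. indicator ({a<..<b} \<inter> S) x * g x)"
    by (rule lbm_LINT) (use assms in auto)
  also have "\<dots> = integral {a..b} (\<lambda>x. indicator S x * g x)"
    by (rule integral_spike[of "{a, b}"]) (auto simp: indicator_def)
  finally show ?thesis .
qed

lemma L2_norm_square:
  "(L2_norm S g)\<^sup>2 = (LINT x:S|lborel. (g x)\<^sup>2)"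
proof -
  have "0 \<le> (LINT x:S|lborel. (g x)\<^sup>2)"
    unfolding set_lebesgue_integral_def by (intro Bochner_Integration.integral_nonneg) auto
  then show ?thesis by (simp add: L2_norm_def)
qed

context qc_grid
begin

text \<open>For \<psi> the derivative of \<phi> this is the first variation of
  \<open>stored_a\<close> at z in the direction u.\<close>

definition stress_sum :: "(real \<Rightarrow> real) \<Rightarrow> (int \<Rightarrow> real) \<Rightarrow> (int \<Rightarrow> real) \<Rightarrow> real" where
  "stress_sum \<psi> z u = eps N * (\<Sum>l\<in>period_cells N. \<psi> (bdiff N z l) * bdiff N u l
     + \<psi> (bdiff N z (l - 1) + bdiff N z l) * (bdiff N u (l - 1) + bdiff N u l))"

lemma bdiff_period:
  assumes "\<And>l. v (l + 2 * int N) = c + v l"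
  shows "bdiff N v (l + int (2 * N)) = bdiff N v l"
  using assms[of l] assms[of "l - 1"] by (simp add: bdiff_def algebra_simps)

lemma E_a_stationary:
  assumes \<phi>: "\<And>t. 0 < t \<Longrightarrow> (\<phi> has_real_derivative deriv \<phi> t) (at t)"
    and min: "local_minimizer (E_a N F \<phi> f) (Y_eps_pos N F) z"
    and u: "\<And>l. u (l + 2 * int N) = u l" "u 0 = 0"
  shows "stress_sum (deriv \<phi>) z u = inner_eps N (nodal N f) u"
proof -
  have z: "z \<in> Y_eps_pos N F" using min by (simp add: local_minimizer_def)
  then have zp: "\<And>l. z (l + 2 * int N) = F + z l" "z 0 = 0" "\<And>l. 0 < bdiff N z l"
    by (auto simp: Y_eps_pos_def Y_eps_def)
  obtain t0 where t0: "0 < t0" "\<And>t k. \<bar>t\<bar> < t0 \<Longrightarrow> 0 < bdiff N z k + t * bdiff N u k"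
    using int_period_pos_perturb[of "bdiff N z" "2 * N" "bdiff N u"]
      bdiff_period[of z F, OF zp(1)] bdiff_period[of u 0] u(1) zp(3) N_pos by auto
  obtain B where B: "0 < B" "\<And>l. \<bar>u l\<bar> \<le> B"
    using int_period_bounded[of u "2 * N"] u(1) N_pos by auto
  have Y: "(\<lambda>l. z l + t * u l) \<in> Y_eps_pos N F" if "\<bar>t\<bar> < t0" for t
    using t0(2)[OF that] zp u by (simp add: Y_eps_pos_def Y_eps_def bdiff_linear)
  define P where "P t = (\<Sum>l\<in>period_cells N. \<phi> (bdiff N z l + t * bdiff N u l)
      + \<phi> ((bdiff N z (l - 1) + bdiff N z l) + t * (bdiff N u (l - 1) + bdiff N u l)))" for t
  have E: "E_a N F \<phi> f (\<lambda>l. z l + t * u l) = eps N * P t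
      - (inner_eps N (nodal N f) (\<lambda>l. z l - nodal N (\<lambda>x. F * x) l) + t * inner_eps N (nodal N f) u)" for t
  proof -
    have "stored_a N \<phi> (\<lambda>l. z l + t * u l) = eps N * P t"
      by (simp add: stored_a_def P_def bdiff_linear algebra_simps)
    moreover have "inner_eps N (nodal N f) (\<lambda>l. (z l + t * u l) - nodal N (\<lambda>x. F * x) l)
      = inner_eps N (nodal N f) (\<lambda>l. z l - nodal N (\<lambda>x. F * x) l) + t * inner_eps N (nodal N f) u"
      unfolding inner_eps_def
      by (simp add: sum_distrib_left sum.distrib[symmetric] algebra_simps)
    ultimately show ?thesis by (simp add: E_a_def)
  qed
  have chain: "((\<lambda>t. \<phi> (a + t * b)) has_real_derivative deriv \<phi> a * b) (at 0)" if "0 < a" for a b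
    by (rule DERIV_chain2[of \<phi>]) (use \<phi>[OF that] in \<open>auto intro!: derivative_eq_intros\<close>)
  have "(P has_real_derivative (\<Sum>l\<in>period_cells N. deriv \<phi> (bdiff N z l) * bdiff N u l
     + deriv \<phi> (bdiff N z (l - 1) + bdiff N z l) * (bdiff N u (l - 1) + bdiff N u l))) (at 0)"
    unfolding P_def by (intro DERIV_sum DERIV_add chain zp add_pos_pos)
  then have "((\<lambda>t. eps N * P t
      - (inner_eps N (nodal N f) (\<lambda>l. z l - nodal N (\<lambda>x. F * x) l) + t * inner_eps N (nodal N f) u))
     has_real_derivative (stress_sum (deriv \<phi>) z u - inner_eps N (nodal N f) u)) (at 0)"
    unfolding stress_sum_def by (auto intro!: derivative_eq_intros)
  then have "((\<lambda>t. E_a N F \<phi> f (\<lambda>l. z l + t * u l)) has_real_derivative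
      (stress_sum (deriv \<phi>) z u - inner_eps N (nodal N f) u)) (at 0)"
    unfolding E .
  from local_minimizer_stationary[OF min t0(1) Y B this] show ?thesis by simp
qed

section \<open>First variation of the quasicontinuum energy\<close>

lemma bond_ivl_eq: "bond_ivl N (l, j) = {L l<..<L (l + int j)}"
  by (simp add: bond_ivl_def)

lemma bond_width: "L (l + int j) - L l = eps N * real j"
  by (simp add: algebra_simps)

lemma bond_subset_cells:
  "{L l<..<L (l + int j)} \<inter> S \<subseteq> (\<Union>k\<in>{mesh.idx (L l)..mesh.idx (L (l + int j))}. {X (k - 1)..<X k})"
proof
  fix x assume x: "x \<in> {L l<..<L (l + int j)} \<inter> S"
  have "X (mesh.idx (L l) - 1) < X (mesh.idx x)" "X (mesh.idx x - 1) < X (mesh.idx (L (l + int j)))"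
    using x mesh.idx_bounds[of x] mesh.idx_bounds[of "L l"] mesh.idx_bounds[of "L (l + int j)"]
    unfolding Int_iff greaterThanLessThan_iff by linarith+
  then have "mesh.idx x \<in> {mesh.idx (L l)..mesh.idx (L (l + int j))}" by simp
  then show "x \<in> (\<Union>k\<in>{mesh.idx (L l)..mesh.idx (L (l + int j))}. {X (k - 1)..<X k})"
    using mesh.idx_bounds[of x] by (intro UN_I[of "mesh.idx x"]) simp_all
qed

definition bond_atom :: "int \<times> nat \<Rightarrow> real set" where
  "bond_atom b = bond_ivl N b \<inter> Oa"

lemma bond_atom_cases:
  assumes b: "b \<in> bonds N" and ne: "bond_atom b \<noteq> {}"
  obtains p q where "bond_atom b = {p<..<q}" "p < q" "p \<in> range X" "q \<in> range X"
    "L (fst b) \<le> p" "q \<le> L (fst b + int (snd b))"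
proof -
  obtain l j where lj: "b = (l, j)" "j = 1 \<or> j = 2" using b by (auto simp: bonds_def)
  have w: "L (l + int j) \<le> L l + 2 * eps N" using lj eps_pos by (auto simp: algebra_simps)
  have atom: "bond_atom b = {L l<..<L (l + int j)} \<inter> Oa"
    unfolding bond_atom_def lj(1) bond_ivl_eq ..
  obtain p q m where pq:
    "{L l<..<L (l + int j)} \<inter> Oa = {p<..<q}" "p < q" "p \<in> range X" "q \<in> range X"
    "L l \<le> p" "q \<le> L (l + int j)" "p = L l \<or> p = La + of_int m" "q = L (l + int j) \<or> q = Ra + of_int m"
    by (rule lattice_ivl_Oa[OF rangeI rangeI w ne[unfolded atom]])
  show thesis
    by (rule that[of p q]) (use pq atom in \<open>simp_all only: lj(1) fst_conv snd_conv\<close>)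
qed

lemma pw_affine_increase:
  assumes "\<And>k. c \<le> mesh.slope v k" "p \<le> q"
  shows "c * (q - p) \<le> pw_affine X v q - pw_affine X v p"
proof (rule has_integral_le[OF _ mesh.has_integral_slope[OF assms(2)]])
  show "((\<lambda>x. c) has_integral c * (q - p)) {p..q}"
    using has_integral_const_real[of c p q] assms(2) by (simp add: mult.commute)
qed (rule assms)

text \<open>First variation of one summand of the energy; no weights occur because \<open>\<epsilon> r\<^sub>b / |b| = 1\<close>.\<close>

definition bond_var :: "(real \<Rightarrow> real) \<Rightarrow> (int \<Rightarrow> real) \<Rightarrow> (int \<Rightarrow> real) \<Rightarrow> int \<times> nat \<Rightarrow> real" where
  "bond_var \<psi> v w b = (if bond_atom b = {} then 0 else
      \<psi> (bond_range b * diff_quot (bond_atom b) (pw_affine X v))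
        * (pw_affine X w (Sup (bond_atom b)) - pw_affine X w (Inf (bond_atom b))))
    + integral {L (fst b)..L (fst b + int (snd b))} (\<lambda>x. indicator Oc x *
        (\<psi> (bond_range b * mesh.slope v (mesh.idx x)) * mesh.slope w (mesh.idx x)))"

text \<open>The lower bound c on the slopes passes to difference quotients and keeps every argument
  of \<phi> positive. The atomistic part is one smooth function of t, the continuum part a finite
  sum over mesh cells, so no limit has to be exchanged with an integral.\<close>

lemma bond_energy_derivative:
  assumes \<phi>: "\<And>t. 0 < t \<Longrightarrow> (\<phi> has_real_derivative deriv \<phi> t) (at t)"
    and c: "0 < c" "\<And>k. c \<le> mesh.slope v k" and b: "b \<in> bonds N"
  shows "((\<lambda>t. eps N * (a_bond N \<phi> La Ra b (\<lambda>x. pw_affine X v x + t * pw_affine X w x)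
      + c_bond N \<phi> La Ra b (\<lambda>x. pw_affine X v x + t * pw_affine X w x)))
    has_real_derivative bond_var (deriv \<phi>) v w b) (at 0)"
proof -
  let ?u = "\<lambda>t x. pw_affine X v x + t * pw_affine X w x"
  obtain l j where lj: "b = (l, j)" "j = 1 \<or> j = 2" using b by (auto simp: bonds_def)
  define r where "r = bond_range b"
  have r: "0 < r" "r = real j" using lj by (auto simp: r_def bond_range_def)
  have ivl: "bond_ivl N b = {L l<..<L (l + int j)}" using lj bond_ivl_eq by simp
  have len: "measure lborel (bond_ivl N b) = eps N * r"
  proof -
    have "L l \<le> L (l + int j)" using eps_pos by (simp add: algebra_simps)
    then show ?thesis unfolding ivl using bond_width[of l j] r by simp
  qed
  have er: "0 < eps N * r" using eps_pos r by simp
  have chain: "((\<lambda>t. \<phi> (a + t * b)) has_real_derivative deriv \<phi> a * b) (at 0)" if "0 < a" for a b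
    by (rule DERIV_chain2[of \<phi>]) (use \<phi>[OF that] in \<open>auto intro!: derivative_eq_intros\<close>)
  have a: "((\<lambda>t. eps N * a_bond N \<phi> La Ra b (?u t))
    has_real_derivative (if bond_atom b = {} then 0 else
      deriv \<phi> (r * diff_quot (bond_atom b) (pw_affine X v))
        * (pw_affine X w (Sup (bond_atom b)) - pw_affine X w (Inf (bond_atom b))))) (at 0)"
  proof (cases "bond_atom b = {}")
    case True
    then have "bond_ivl N b \<inter> Omega_a_per La Ra = {}" by (simp add: bond_atom_def)
    then show ?thesis using True by (simp add: a_bond_def)
  next
    case False
    obtain p q where pq: "bond_atom b = {p<..<q}" "p < q" by (rule bond_atom_cases[OF b False])
    define Dv Dw where "Dv = diff_quot {p<..<q} (pw_affine X v)" and "Dw = diff_quot {p<..<q} (pw_affine X w)"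
    have "c * (q - p) \<le> pw_affine X v q - pw_affine X v p"
      using pw_affine_increase[OF c(2), of p q] pq by simp
    then have "0 < pw_affine X v q - pw_affine X v p"
      using c(1) pq(2) by (smt (verit) mult_pos_pos)
    then have Dv: "0 < Dv" using pq by (simp add: Dv_def diff_quot_ivl)
    have eq: "eps N * a_bond N \<phi> La Ra b (?u t)
      = (q - p) / r * \<phi> (r * Dv + t * (r * Dw))" for t
    proof -
      have "bond_ivl N b \<inter> Omega_a_per La Ra = {p<..<q}" using pq by (simp add: bond_atom_def)
      then have "a_bond N \<phi> La Ra b (?u t)
        = (q - p) / (eps N * r) * \<phi> (r * diff_quot {p<..<q} (?u t))"
        using pq(2) by (simp add: a_bond_def Let_def len r_def[symmetric])
      also have "r * diff_quot {p<..<q} (?u t) = r * Dv + t * (r * Dw)"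
        unfolding diff_quot_linear Dv_def Dw_def by (simp add: algebra_simps)
      finally show ?thesis using eps_pos r by simp
    qed
    have "((\<lambda>t. (q - p) / r * \<phi> (r * Dv + t * (r * Dw))) has_real_derivative
        (q - p) / r * (deriv \<phi> (r * Dv) * (r * Dw))) (at 0)"
      using chain[of "r * Dv" "r * Dw"] Dv r by (intro DERIV_cmult) auto
    moreover have "(q - p) / r * (deriv \<phi> (r * Dv) * (r * Dw))
      = deriv \<phi> (r * Dv) * (pw_affine X w q - pw_affine X w p)"
      using pq r by (simp add: Dw_def diff_quot_ivl)
    ultimately show ?thesis
      unfolding eq using pq False by (simp add: Dv_def)
  qed
  define J where "J = {mesh.idx (L l)..mesh.idx (L (l + int j))}"
  define S where "S = {L l<..<L (l + int j)} \<inter> Oc"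
  have S: "S \<in> sets borel" "finite J" "S \<subseteq> (\<Union>k\<in>J. {X (k - 1)..<X k})"
    using bond_subset_cells by (auto simp: S_def J_def)
  have c_eq: "eps N * c_bond N \<phi> La Ra b (?u t)
     = (\<Sum>k\<in>J. measure lborel (S \<inter> {X (k - 1)..<X k}) / r *
         \<phi> (r * mesh.slope v k + t * (r * mesh.slope w k)))" for t
  proof -
    have "?u t = pw_affine X (\<lambda>k. 1 * v k + t * w k)"
      unfolding mesh.pw_affine_linear by simp
    then have "c_bond N \<phi> La Ra b (?u t)
      = 1 / (eps N * r) * (LINT x:S|lborel. \<phi> (r * deriv (pw_affine X (\<lambda>k. 1 * v k + t * w k)) x))"
      unfolding c_bond_def len r_def[symmetric] unfolding S_def ivl by simp
    also have "\<dots> = 1 / (eps N * r) * (LINT x:S|lborel. \<phi> (r * mesh.slope (\<lambda>k. 1 * v k + t * w k) (mesh.idx x)))"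
      by (subst mesh.LINT_deriv_pw_affine[of S "\<lambda>x d. \<phi> (r * d)"]) simp
    also have "\<dots> = 1 / (eps N * r) * (\<Sum>k\<in>J. measure lborel (S \<inter> {X (k - 1)..<X k}) *
         \<phi> (r * mesh.slope (\<lambda>k. 1 * v k + t * w k) k))"
      by (subst mesh.LINT_idx[OF S]) simp
    finally show ?thesis
      using eps_pos by (simp add: mesh.slope_linear[of 1 v t w, simplified] sum_distrib_left algebra_simps)
  qed
  have "((\<lambda>t. eps N * c_bond N \<phi> La Ra b (?u t))
    has_real_derivative (\<Sum>k\<in>J. measure lborel (S \<inter> {X (k - 1)..<X k}) / r *
         (deriv \<phi> (r * mesh.slope v k) * (r * mesh.slope w k)))) (at 0)"
    unfolding c_eq
  proof (intro DERIV_sum DERIV_cmult chain)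
    fix k show "0 < r * mesh.slope v k"
      using r c(1) c(2)[of k] by (intro mult_pos_pos) linarith+
  qed
  also have "(\<Sum>k\<in>J. measure lborel (S \<inter> {X (k - 1)..<X k}) / r *
         (deriv \<phi> (r * mesh.slope v k) * (r * mesh.slope w k)))
    = (LINT x:S|lborel. deriv \<phi> (r * mesh.slope v (mesh.idx x)) * mesh.slope w (mesh.idx x))"
    unfolding mesh.LINT_idx[OF S, of "\<lambda>k. deriv \<phi> (r * mesh.slope v k) * mesh.slope w k"]
    using r by (intro sum.cong) auto
  also have "\<dots> = integral {L l..L (l + int j)} (\<lambda>x. indicator Oc x *
      (deriv \<phi> (r * mesh.slope v (mesh.idx x)) * mesh.slope w (mesh.idx x)))"
    unfolding S_def by (intro LINT_open_ivl lbm_intros mesh.lbm_idx Oc_measurable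
        mesh.lbm_idx[of "\<lambda>k. deriv \<phi> (r * mesh.slope v k)"])
  finally have "((\<lambda>t. eps N * c_bond N \<phi> La Ra b (?u t))
    has_real_derivative integral {L l..L (l + int j)} (\<lambda>x. indicator Oc x *
      (deriv \<phi> (r * mesh.slope v (mesh.idx x)) * mesh.slope w (mesh.idx x)))) (at 0)" .
  from DERIV_add[OF a this] show ?thesis
    unfolding bond_var_def r_def[symmetric] distrib_left by (simp only: lj(1) fst_conv snd_conv)
qed

lemma Y_h_pos_nodal:
  assumes "y \<in> Y_h_pos F X"
  shows "y = pw_affine X (\<lambda>k. y (X k))" "\<And>x. y (x + 1) = y x + F" "y 0 = 0"
    "\<And>k. 0 < mesh.slope (\<lambda>k. y (X k)) k"
proof -
  have Y: "y \<in> P1 X" "\<And>x. y (x + 1) - F * (x + 1) = y x - F * x" "y 0 = 0"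
    "\<And>k x. x \<in> interior (element X k) \<Longrightarrow> 0 < deriv y x"
    using assms by (auto simp: Y_h_pos_def Y_h_def U_h_def)
  show eq: "y = pw_affine X (\<lambda>k. y (X k))" by (rule mesh.P1_pw_affine[OF Y(1)])
  show "y (x + 1) = y x + F" for x using Y(2)[of x] by (simp add: algebra_simps)
  show "y 0 = 0" by (rule Y(3))
  show "0 < mesh.slope (\<lambda>k. y (X k)) k" for k
  proof -
    define x where "x = (X (k - 1) + X k) / 2"
    have x: "X (k - 1) < x" "x < X k" using increasing[of k] by (auto simp: x_def)
    then have "(y has_real_derivative mesh.slope (\<lambda>k. y (X k)) k) (at x)"
      by (subst eq) (rule mesh.has_derivative_pw_affine)
    then have "deriv y x = mesh.slope (\<lambda>k. y (X k)) k" by (rule DERIV_imp_deriv)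
    then show ?thesis using Y(4)[of x k] x by (simp add: element_def)
  qed
qed

lemma slope_mesh_period:
  assumes "\<And>x. y (x + 1) = y x + c"
  shows "mesh.slope (\<lambda>k. y (X k)) (k + int K) = mesh.slope (\<lambda>k. y (X k)) k"
  by (rule mesh.slope_period[of _ c]) (simp add: T1 assms)

lemma E_qc_stationary:
  assumes \<phi>: "\<And>t. 0 < t \<Longrightarrow> (\<phi> has_real_derivative deriv \<phi> t) (at t)"
    and min: "local_minimizer (E_qc N F \<phi> f La Ra X) (Y_h_pos F X) y"
    and w: "\<And>k. w (k + int K) = w k" "pw_affine X w 0 = 0"
  shows "(\<Sum>b\<in>bonds N. bond_var (deriv \<phi>) (\<lambda>k. y (X k)) w b) = inner_h X f (pw_affine X w)"
proof -
  have "y \<in> Y_h_pos F X" using min by (simp add: local_minimizer_def)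
  note y = Y_h_pos_nodal[OF this]
  define v where "v k = y (X k)" for k
  have yv: "y = pw_affine X v" unfolding v_def[abs_def] by (rule y)
  have vp: "mesh.slope v (k + int K) = mesh.slope v k" for k
    unfolding v_def[abs_def] by (rule slope_mesh_period[of y F]) (rule y(2))
  have wp: "mesh.slope w (k + int K) = mesh.slope w k" for k
    by (rule mesh.slope_period[of _ 0]) (simp add: w)
  have v0: "0 < mesh.slope v k" for k unfolding v_def[abs_def] by (rule y)
  obtain c where c: "0 < c" "\<And>k. c \<le> mesh.slope v k"
    using int_period_pos[of "mesh.slope v" K, OF vp T1(1) v0] by blast
  obtain t0 where t0: "0 < t0" "\<And>t k. \<bar>t\<bar> < t0 \<Longrightarrow> 0 < mesh.slope v k + t * mesh.slope w k"
    using int_period_pos_perturb[of "mesh.slope v" K "mesh.slope w", OF vp wp T1(1) v0] by blast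
  have lin: "(\<lambda>x. y x + t * pw_affine X w x) = pw_affine X (\<lambda>k. 1 * v k + t * w k)" for t
    unfolding mesh.pw_affine_linear yv by simp
  have wper: "pw_affine X w (x + 1) = pw_affine X w x" for x
    using mesh.pw_affine_period[of w 0 x] w by simp
  have Y: "(\<lambda>x. y x + t * pw_affine X w x) \<in> Y_h_pos F X" if t: "\<bar>t\<bar> < t0" for t
  proof -
    have P: "(\<lambda>x. y x + t * pw_affine X w x) \<in> P1 X" unfolding lin by (rule mesh.pw_affine_P1)
    have "(\<lambda>x. y x + t * pw_affine X w x - F * x) \<in> P1 X"
    proof -
      have "continuous_on UNIV (\<lambda>x. y x + t * pw_affine X w x - F * x)"
        by (intro continuous_intros mesh.continuous_pw_affine, subst yv) (rule mesh.continuous_pw_affine)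
      moreover have "\<exists>a b. \<forall>x\<in>element X k. y x + t * pw_affine X w x - F * x = a * x + b" for k
      proof -
        obtain a b where "\<forall>x\<in>element X k. y x + t * pw_affine X w x = a * x + b"
          using P unfolding P1_def by blast
        then have "\<forall>x\<in>element X k. y x + t * pw_affine X w x - F * x = (a - F) * x + b"
          by (simp add: left_diff_distrib)
        then show ?thesis by (intro exI)
      qed
      ultimately show ?thesis unfolding P1_def by blast
    qed
    then have "(\<lambda>x. y x + t * pw_affine X w x) \<in> Y_h F X"
      using P y(2,3) wper w(2) by (simp add: Y_h_def U_h_def algebra_simps)
    moreover have "0 < deriv (\<lambda>x. y x + t * pw_affine X w x) x" if "x \<in> interior (element X k)" for k x
    proof -
      have "((\<lambda>x. y x + t * pw_affine X w x) has_real_derivative mesh.slope (\<lambda>k. 1 * v k + t * w k) k) (at x)"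
        unfolding lin using that by (intro mesh.has_derivative_pw_affine) (auto simp: element_def)
      then have "deriv (\<lambda>x. y x + t * pw_affine X w x) x = mesh.slope v k + t * mesh.slope w k"
        unfolding mesh.slope_linear by (simp add: DERIV_imp_deriv)
      then show ?thesis using t0(2)[OF t] by simp
    qed
    ultimately show ?thesis by (simp add: Y_h_pos_def)
  qed
  obtain B where B: "0 < B" "\<And>x. \<bar>pw_affine X w x\<bar> \<le> B"
  proof -
    obtain B where B: "0 < B" "\<And>k. \<bar>w k\<bar> \<le> B" using int_period_bounded[of w K, OF w(1) T1(1)] by blast
    have "\<bar>pw_affine X w x\<bar> \<le> B" for x
    proof -
      define k s where "k = mesh.idx x" and "s = (x - X (k - 1)) / (X k - X (k - 1))"
      have x: "X (k - 1) \<le> x" "x < X k" using mesh.idx_bounds by (auto simp: k_def)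
      then have s: "0 \<le> s" "s \<le> 1" by (auto simp: s_def divide_simps)
      \<comment> \<open>On its cell the interpolant is a convex combination of two nodal values, so
        bounded nodal values bound the test function.\<close>
      have "pw_affine X w x = (1 - s) * w (k - 1) + s * w k"
        using mesh.pw_affine_idx[of w x]
        by (simp add: k_def[symmetric] s_def mesh.slope_def algebra_simps diff_divide_distrib)
      also have "\<bar>\<dots>\<bar> \<le> (1 - s) * B + s * B"
        using s B(2)[of k] B(2)[of "k - 1"]
        by (intro order_trans[OF abs_triangle_ineq] add_mono) (auto simp: abs_mult intro!: mult_left_mono)
      finally show ?thesis by (simp add: algebra_simps)
    qed
    with B(1) show thesis by (rule that)
  qed
  define c0 where "c0 = inner_h X f (\<lambda>x. y x - F * x)"
  have inner: "inner_h X f (\<lambda>x. (y x + t * pw_affine X w x) - F * x) = c0 + t * inner_h X f (pw_affine X w)" for t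
  proof -
    define g h where "g k = f (X k) * (y (X k) - F * X k)" and "h k = f (X k) * w k" for k
    have int: "set_integrable lborel Omega (pw_affine X g)" for g
      unfolding Omega_def by (intro lbm_set_integrable[of _ _ "- 1 / 2" "1 / 2"] lbm_continuous mesh.continuous_pw_affine) auto
    have "I_h X (\<lambda>x. f x * ((y x + t * pw_affine X w x) - F * x)) = pw_affine X (\<lambda>k. 1 * g k + t * h k)"
      unfolding I_h_def g_def h_def by (intro arg_cong[where f = "pw_affine X"] ext) (simp add: algebra_simps)
    then have "inner_h X f (\<lambda>x. (y x + t * pw_affine X w x) - F * x)
      = (LINT x:Omega|lborel. pw_affine X g x + t * pw_affine X h x)"
      unfolding inner_h_def mesh.pw_affine_linear by simp
    also have "\<dots> = (LINT x:Omega|lborel. pw_affine X g x) + t * (LINT x:Omega|lborel. pw_affine X h x)"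
      using set_integral_add(2)[OF int, of "\<lambda>x. t * pw_affine X h x"] int[of h]
        set_integrable_mult_right[of t lborel Omega "pw_affine X h"] by simp
    finally show ?thesis unfolding c0_def inner_h_def I_h_def g_def h_def by simp
  qed
  have "((\<lambda>t. (\<Sum>b\<in>bonds N. eps N * (a_bond N \<phi> La Ra b (\<lambda>x. pw_affine X v x + t * pw_affine X w x)
      + c_bond N \<phi> La Ra b (\<lambda>x. pw_affine X v x + t * pw_affine X w x)))
      - (c0 + t * inner_h X f (pw_affine X w)))
     has_real_derivative (\<Sum>b\<in>bonds N. bond_var (deriv \<phi>) v w b) - (0 + 1 * inner_h X f (pw_affine X w))) (at 0)"
    by (intro DERIV_diff DERIV_sum DERIV_add DERIV_const DERIV_cmult_right DERIV_ident
        bond_energy_derivative[OF \<phi> c])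
  moreover have "E_qc N F \<phi> f La Ra X (\<lambda>x. y x + t * pw_affine X w x)
    = (\<Sum>b\<in>bonds N. eps N * (a_bond N \<phi> La Ra b (\<lambda>x. pw_affine X v x + t * pw_affine X w x)
      + c_bond N \<phi> La Ra b (\<lambda>x. pw_affine X v x + t * pw_affine X w x)))
      - (c0 + t * inner_h X f (pw_affine X w))" for t
    unfolding E_qc_def stored_qc_def inner sum_distrib_left yv[symmetric] by simp
  ultimately have "((\<lambda>t. E_qc N F \<phi> f La Ra X (\<lambda>x. y x + t * pw_affine X w x)) has_real_derivative
      (\<Sum>b\<in>bonds N. bond_var (deriv \<phi>) v w b) - inner_h X f (pw_affine X w)) (at 0)"
    by simp
  from local_minimizer_stationary[OF min t0(1) Y B this]
  show ?thesis unfolding v_def[abs_def] by simp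
qed

end

section \<open>Residual of the stored energies\<close>

lemma integral_zero_interior:
  fixes g :: "real \<Rightarrow> real"
  assumes "\<And>x. a < x \<Longrightarrow> x < b \<Longrightarrow> g x = 0"
  shows "integral {a..b} g = 0"
proof -
  have "integral {a..b} g = integral {a..b} (\<lambda>x. 0)"
    by (rule integral_spike[of "{a, b}"]) (use assms in auto)
  then show ?thesis by simp
qed

context qc_grid
begin

lemma lat_slope: "lat.slope v l = bdiff N v l"
  by (simp add: lat.slope_def bdiff_def right_diff_distrib)

lemma integral_slope_square:
  "integral {L (l - 1)..L l} (\<lambda>x. (lat.slope e (lat.idx x))\<^sup>2) = eps N * (bdiff N e l)\<^sup>2"
proof -
  have "integral {L (l - 1)..L l} (\<lambda>x. (lat.slope e (lat.idx x))\<^sup>2)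
    = integral {L (l - 1)..L l} (\<lambda>x. (bdiff N e l)\<^sup>2)"
    unfolding lat_slope using lat.integral_idx_cell[of l "\<lambda>j x. (bdiff N e j)\<^sup>2"] by simp
  then show ?thesis using L_diff[of l] lat.grid_less[of l] by simp
qed

lemma sum_bonds: "(\<Sum>b\<in>bonds N. g b) = (\<Sum>l\<in>period_cells N. g (l, 1)) + (\<Sum>l\<in>period_cells N. g (l, 2))"
proof -
  have "(\<Sum>b\<in>bonds N. g b) = (\<Sum>l\<in>period_cells N. \<Sum>j\<in>{1, 2}. g (l, j))"
    unfolding bonds_def by (simp only: sum.cartesian_product case_prod_eta)
  then show ?thesis by (simp add: sum.distrib)
qed

lemma sum_period_cells:
  fixes P :: "int \<Rightarrow> real"
  assumes "\<And>l. P (l + int (2 * N)) = P l"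
  shows "(\<Sum>l\<in>period_cells N. P (l + c)) = (\<Sum>l\<in>{0 + 1..0 + int (2 * N)}. P l)"
proof -
  have "(\<Sum>l\<in>period_cells N. P (l + c)) = (\<Sum>l\<in>{(c - int N) + 1..(c - int N) + int (2 * N)}. P l)"
    by (rule sum.reindex_bij_witness[of _ "\<lambda>l. l - c" "\<lambda>l. l + c"]) (auto simp: period_cells_def)
  also have "\<dots> = (\<Sum>l\<in>{0 + 1..0 + int (2 * N)}. P l)"
    by (rule sum_int_period) (rule assms)
  finally show ?thesis .
qed

lemma integral_unit_lat:
  fixes h :: "real \<Rightarrow> real"
  assumes "\<And>l. h integrable_on {L (l - 1)..L l}"
  shows "integral {0..1} h = (\<Sum>l\<in>{0 + 1..0 + int (2 * N)}. integral {L (l - 1)..L l} h)"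
proof -
  have "L 0 = 0" "L (0 + int (2 * N)) = 1" using eps_period by auto
  then show ?thesis using lat.integral_cells[where i = 0 and n = "2 * N" and h = h] assms by metis
qed

text \<open>Modulo 1 the bonds of range j cover every cell exactly j times. Increasing j appends one
  more cell to each bond, and these additional cells make up one full period.\<close>

lemma integral_bonds_periodic:
  assumes g: "loc_bounded_meas g" and per: "\<And>x. g (x + 1) = g x"
  shows "(\<Sum>l\<in>period_cells N. integral {L l..L (l + int j)} g) = real j * integral {0..1} g"
proof (induction j)
  case (Suc j)
  define P where "P l = integral {L (l - 1)..L l} g" for l
  have P: "P (l + int (2 * N)) = P l" for l
  proof -
    have "L (l + int (2 * N)) = L l + 1" "L (l + int (2 * N) - 1) = L (l - 1) + 1"
      using lat.grid_period[of l] lat.grid_period[of "l - 1"] by (simp_all add: algebra_simps)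
    then show ?thesis unfolding P_def using integral_shift_periodic[of g 1, OF per] by metis
  qed
  have split: "integral {L l..L (l + int (Suc j))} g = integral {L l..L (l + int j)} g + P (l + int (Suc j))" for l
  proof -
    have "L l \<le> L (l + int j)" "L (l + int j) \<le> L (l + int (Suc j))"
      by (simp_all only: lat.grid_le_iff)
    from Henstock_Kurzweil_Integration.integral_combine[OF this lbm_integrable_on[OF g]]
    show ?thesis by (simp add: P_def)
  qed
  have "(\<Sum>l\<in>period_cells N. P (l + int (Suc j))) = integral {0..1} g"
    unfolding sum_period_cells[of P, OF P]
    by (subst integral_unit_lat) (auto simp: P_def intro: lbm_integrable_on g)
  then show ?case unfolding split sum.distrib Suc.IH by (simp add: algebra_simps)
qed simp

lemma unit_nodes:
  obtains k0 where "X k0 = 0" "X (k0 + int K) = 1"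
  using zero_node T1 by auto

lemma integral_unit_mesh:
  fixes h :: "real \<Rightarrow> real"
  assumes "X k0 = 0" "\<And>k. h integrable_on {X (k - 1)..X k}"
  shows "integral {0..1} h = (\<Sum>k\<in>{k0 + 1..k0 + int K}. integral {X (k - 1)..X k} h)"
proof -
  have "X (k0 + int K) = 1" using assms T1 by simp
  then show ?thesis using mesh.integral_cells[where i = k0 and n = K and h = h] assms by metis
qed

definition atom_stress :: "(real \<Rightarrow> real) \<Rightarrow> (int \<Rightarrow> real) \<Rightarrow> int \<times> nat \<Rightarrow> real" where
  "atom_stress \<psi> v b = \<psi> (bond_range b * diff_quot (bond_atom b) (pw_affine X v))"

text \<open>Quasicontinuum counterpart of the constant stress that an atomistic bond
  carries.\<close>

definition bond_stress :: "(real \<Rightarrow> real) \<Rightarrow> (int \<Rightarrow> real) \<Rightarrow> int \<times> nat \<Rightarrow> real \<Rightarrow> real" where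
  "bond_stress \<psi> v b x = indicator Oa x * atom_stress \<psi> v b
     + indicator Oc x * \<psi> (bond_range b * mesh.slope v (mesh.idx x))"

lemma lbm_bond_stress: "loc_bounded_meas (bond_stress \<psi> v b)"
  unfolding bond_stress_def[abs_def]
  by (intro lbm_intros Oa_measurable Oc_measurable
      mesh.lbm_idx[of "\<lambda>k. \<psi> (bond_range b * mesh.slope v k)"])

text \<open>The test function of the atomistic problem may replace its mesh interpolant: both agree at
  the end points of \<open>b \<inter> \<Omega>\<^sub>a\<close>, which are mesh nodes, and in the continuum region the bonds
  of a fixed range cover each element uniformly.\<close>

lemma sum_bond_var:
  assumes v: "\<And>k. mesh.slope v (k + int K) = mesh.slope v k"
    and e: "\<And>l. e (l + 2 * int N) = e l"
  defines "w \<equiv> \<lambda>k. pw_affine L e (X k)"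
  shows "(\<Sum>b\<in>bonds N. bond_var \<psi> v w b)
    = (\<Sum>b\<in>bonds N. integral {L (fst b)..L (fst b + int (snd b))}
         (\<lambda>x. bond_stress \<psi> v b x * lat.slope e (lat.idx x)))"
proof -
  define de where "de x = lat.slope e (lat.idx x)" for x
  define dw where "dw x = mesh.slope w (mesh.idx x)" for x
  have lbm: "loc_bounded_meas de" "loc_bounded_meas dw" "loc_bounded_meas (\<lambda>x. \<psi> (c * mesh.slope v (mesh.idx x)))" for c
    unfolding de_def[abs_def] dw_def[abs_def] using lat.lbm_idx mesh.lbm_idx
      mesh.lbm_idx[of "\<lambda>k. \<psi> (c * mesh.slope v k)"] by simp_all
  \<comment> \<open>The error of exchanging the slopes of w and e in the continuum part of a bond of
    range j. Its integral over a single bond need not vanish; only the sum over all bonds of that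
    range does.\<close>
  define G where "G j x = indicator Oc x * (\<psi> (real j * mesh.slope v (mesh.idx x)) * (de x - dw x))" for j x
  have G: "loc_bounded_meas (G j)" for j
    unfolding G_def[abs_def] by (intro lbm_intros Oc_measurable lbm)
  have eper: "pw_affine L e (x + 1) = pw_affine L e x" for x
    using lat.pw_affine_period[of e 0 x] e by simp
  have wper: "mesh.slope w (k + int K) = mesh.slope w k" for k
    by (rule mesh.slope_period[of _ 0]) (simp add: w_def T1 eper)
  have esl: "lat.slope e (l + int (2 * N)) = lat.slope e l" for l
    by (rule lat.slope_period[of _ 0]) (simp add: e)
  have Gper: "G j (x + 1) = G j x" for j x
  proof -
    have "mesh.idx (x + 1) = mesh.idx x + int K" "lat.idx (x + 1) = lat.idx x + int (2 * N)"
      using mesh.idx_shift[of x 1] lat.idx_shift[of x 1] by simp_all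
    moreover have "(indicator Oc (x + 1) :: real) = indicator Oc x"
      using Oa_shift[of x 1] Oc_iff by (simp add: indicator_def)
    ultimately show ?thesis
      unfolding G_def de_def dw_def by (simp only: v wper esl)
  qed
  \<comment> \<open>w takes the values of e at both nodes, so both slopes have the same mean over
    the element; the stress is constant there and cannot disturb this.\<close>
  have wint: "integral {X (k - 1)..X k} (\<lambda>x. de x - mesh.slope w k) = 0" for k
  proof -
    have "((\<lambda>x. de x) has_integral (pw_affine L e (X k) - pw_affine L e (X (k - 1)))) {X (k - 1)..X k}"
      unfolding de_def by (rule lat.has_integral_slope) simp
    moreover have "((\<lambda>x. mesh.slope w k) has_integral (w k - w (k - 1))) {X (k - 1)..X k}"
      using has_integral_const_real[of "mesh.slope w k" "X (k - 1)" "X k"] increasing[of k]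
      by (simp add: mesh.slope_def)
    ultimately have "((\<lambda>x. de x - mesh.slope w k) has_integral
        (pw_affine L e (X k) - pw_affine L e (X (k - 1)) - (w k - w (k - 1)))) {X (k - 1)..X k}"
      by (rule has_integral_diff)
    then show ?thesis unfolding w_def by (simp add: integral_unique)
  qed
  have Gint: "integral {0..1} (G j) = 0" for j
  proof -
    obtain k0 where k0: "X k0 = 0" by (rule unit_nodes)
    have "integral {X (k - 1)..X k} (G j) = 0" for k
    proof (cases rule: element_cases[of k])
      case (cont m)
      have "integral {X (k - 1)..X k} (G j) = integral {X (k - 1)..X k}
          (\<lambda>x. \<psi> (real j * mesh.slope v k) * (de x - mesh.slope w k))"
      proof (rule integral_spike[of "{X k}"])
        fix x assume x: "x \<in> {X (k - 1)..X k} - {X k}"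
        then have "mesh.idx x = k" by (intro mesh.idx_eqI) auto
        moreover have "x \<in> Oc" unfolding Oc_cases using x cont by (intro exI[of _ m]) auto
        ultimately show "\<psi> (real j * mesh.slope v k) * (de x - mesh.slope w k) = G j x"
          by (simp add: G_def dw_def)
      qed simp
      then show ?thesis using wint[of k] by simp
    next
      case (atom m)
      show ?thesis
      proof (rule integral_zero_interior)
        fix x assume "X (k - 1) < x" "x < X k"
        then have "x \<in> Oa" unfolding Oa_iff using atom by (intro exI[of _ m]) auto
        then show "G j x = 0" using Oc_iff by (simp add: G_def)
      qed
    qed
    then show ?thesis
      by (subst integral_unit_mesh[OF k0]) (auto intro: lbm_integrable_on G)
  qed
  have "bond_var \<psi> v w (l, j) = integral {L l..L (l + int j)} (\<lambda>x. bond_stress \<psi> v (l, j) x * de x)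
      - integral {L l..L (l + int j)} (G j)" if b: "(l, j) \<in> bonds N" for l j
  proof -
    let ?b = "(l, j)"
    have atom: "bond_atom ?b = {L l<..<L (l + int j)} \<inter> Oa"
      unfolding bond_atom_def bond_ivl_eq ..
    have i1: "integral {L l..L (l + int j)} (\<lambda>x. indicator Oa x * (atom_stress \<psi> v ?b * de x))
      = (if bond_atom ?b = {} then 0 else
      atom_stress \<psi> v ?b * (pw_affine X w (Sup (bond_atom ?b)) - pw_affine X w (Inf (bond_atom ?b))))"
    proof (cases "bond_atom ?b = {}")
      case True
      have "integral {L l..L (l + int j)} (\<lambda>x. indicator Oa x * (atom_stress \<psi> v ?b * de x)) = 0"
      proof (rule integral_zero_interior)
        fix x assume "L l < x" "x < L (l + int j)"
        then have "x \<notin> Oa" using True unfolding atom by (metis IntI emptyE greaterThanLessThan_iff)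
        then show "indicator Oa x * (atom_stress \<psi> v ?b * de x) = 0" by simp
      qed
      then show ?thesis using True by simp
    next
      case False
      obtain p q where pq: "bond_atom ?b = {p<..<q}" "p < q" "p \<in> range X" "q \<in> range X"
        by (rule bond_atom_cases[OF b False])
      obtain i i' where i: "p = X i" "q = X i'" using pq by blast
      have "integral {L l..L (l + int j)} (\<lambda>x. indicator Oa x * (atom_stress \<psi> v ?b * de x))
        = (LINT x:bond_atom ?b|lborel. atom_stress \<psi> v ?b * de x)"
        unfolding atom by (rule LINT_open_ivl[symmetric]) (intro lbm_intros lbm Oa_measurable)+
      also have "\<dots> = (LINT x:{p<..<q} \<inter> UNIV|lborel. atom_stress \<psi> v ?b * de x)" using pq by simp
      also have "\<dots> = integral {p..q} (\<lambda>x. indicator UNIV x * (atom_stress \<psi> v ?b * de x))"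
        by (rule LINT_open_ivl) (intro lbm_intros lbm, simp)
      also have "\<dots> = atom_stress \<psi> v ?b * integral {p..q} de" by simp
      also have "integral {p..q} de = pw_affine L e q - pw_affine L e p"
        unfolding de_def[abs_def] using pq by (intro integral_unique lat.has_integral_slope) simp
      also have "\<dots> = pw_affine X w q - pw_affine X w p" by (simp add: i w_def)
      finally show ?thesis using pq False by simp
    qed
    have "integral {L l..L (l + int j)} (\<lambda>x. bond_stress \<psi> v ?b x * de x)
      = integral {L l..L (l + int j)} (\<lambda>x. indicator Oa x * (atom_stress \<psi> v ?b * de x)
          + (indicator Oc x * (\<psi> (real j * mesh.slope v (mesh.idx x)) * dw x) + G j x))"
      by (rule arg_cong[where f = "integral _"])
        (auto simp: bond_stress_def G_def bond_range_def algebra_simps)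
    also have "\<dots> = integral {L l..L (l + int j)} (\<lambda>x. indicator Oa x * (atom_stress \<psi> v ?b * de x))
        + (integral {L l..L (l + int j)} (\<lambda>x. indicator Oc x * (\<psi> (real j * mesh.slope v (mesh.idx x)) * dw x))
          + integral {L l..L (l + int j)} (G j))"
      by (intro integral_unique has_integral_add integrable_integral lbm_integrable_on lbm_intros lbm G
          Oa_measurable Oc_measurable)
    also have "integral {L l..L (l + int j)} (\<lambda>x. indicator Oa x * (atom_stress \<psi> v ?b * de x))
        + (integral {L l..L (l + int j)} (\<lambda>x. indicator Oc x * (\<psi> (real j * mesh.slope v (mesh.idx x)) * dw x))
          + integral {L l..L (l + int j)} (G j)) = bond_var \<psi> v w ?b + integral {L l..L (l + int j)} (G j)"
      unfolding i1 unfolding bond_var_def atom_stress_def dw_def bond_range_def fst_conv snd_conv by (simp only: add.assoc)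
    finally show ?thesis by simp
  qed
  then have "(\<Sum>b\<in>bonds N. bond_var \<psi> v w b)
    = (\<Sum>b\<in>bonds N. integral {L (fst b)..L (fst b + int (snd b))} (\<lambda>x. bond_stress \<psi> v b x * de x)
      - integral {L (fst b)..L (fst b + int (snd b))} (G (snd b)))"
    by (intro sum.cong) auto
  also have "\<dots> = (\<Sum>b\<in>bonds N. integral {L (fst b)..L (fst b + int (snd b))} (\<lambda>x. bond_stress \<psi> v b x * de x))
      - (\<Sum>b\<in>bonds N. integral {L (fst b)..L (fst b + int (snd b))} (G (snd b)))"
    by (rule sum_subtractf)
  also have "(\<Sum>b\<in>bonds N. integral {L (fst b)..L (fst b + int (snd b))} (G (snd b))) = 0"
    unfolding sum_bonds fst_conv snd_conv integral_bonds_periodic[OF G Gper] Gint by simp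
  finally show ?thesis unfolding de_def by simp
qed

lemma stress_sum_bonds:
  assumes y: "\<And>x. y (x + 1) = y x + F" and e: "\<And>l. e (l + 2 * int N) = e l"
  shows "stress_sum \<psi> (nodal N y) e
    = (\<Sum>b\<in>bonds N. integral {L (fst b)..L (fst b + int (snd b))}
        (\<lambda>x. \<psi> (bond_range b * diff_quot (bond_ivl N b) y) * lat.slope e (lat.idx x)))"
proof -
  define z where "z = nodal N y"
  have zper: "z (l + 2 * int N) = F + z l" for l
    using y[of "L l"] lat.grid_period[of l] by (simp add: z_def nodal_def)
  define P1 where "P1 l = \<psi> (bdiff N z l) * bdiff N e l" for l
  define P2 where "P2 l = \<psi> (bdiff N z (l - 1) + bdiff N z l) * (bdiff N e (l - 1) + bdiff N e l)" for l
  have bp: "bdiff N z (l + int (2 * N)) = bdiff N z l" "bdiff N e (l + int (2 * N)) = bdiff N e l"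
    "bdiff N z (l + int (2 * N) - 1) = bdiff N z (l - 1)" "bdiff N e (l + int (2 * N) - 1) = bdiff N e (l - 1)" for l
    using bdiff_period[of z F l, OF zper] bdiff_period[of e 0 l] e
      bdiff_period[of z F "l - 1", OF zper] bdiff_period[of e 0 "l - 1"] by (simp_all add: algebra_simps)
  have P: "P1 (l + int (2 * N)) = P1 l" "P2 (l + int (2 * N)) = P2 l" for l
    unfolding P1_def P2_def by (simp_all only: bp)
  have I: "integral {L l..L (l + int j)} (\<lambda>x. c * lat.slope e (lat.idx x)) = c * (e (l + int j) - e l)" for c l j
  proof -
    have "integral {L l..L (l + int j)} (\<lambda>x. lat.slope e (lat.idx x))
       = pw_affine L e (L (l + int j)) - pw_affine L e (L l)"
      by (intro integral_unique lat.has_integral_slope) (simp only: lat.grid_le_iff)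
    also have "\<dots> = e (l + int j) - e l" by (simp only: lat.pw_affine_node)
    finally show ?thesis by simp
  qed
  have Q: "diff_quot (bond_ivl N (l, j)) y = (z (l + int j) - z l) / (eps N * real j)" if "0 < j" for l j
  proof -
    have "L l < L (l + int j)" using that by (simp only: lat.grid_less_iff)
    then show ?thesis
      unfolding bond_ivl_eq using bond_width[of l j] by (simp add: diff_quot_ivl z_def nodal_def)
  qed
  \<comment> \<open>A bond is labelled by its left end, a backward difference by its right end. This
    explains the shifts by 1 and by 2, which periodicity removes from the sums.\<close>
  have b1: "integral {L l..L (l + int 1)} (\<lambda>x. \<psi> (bond_range (l, 1) * diff_quot (bond_ivl N (l, 1)) y) * lat.slope e (lat.idx x))
      = eps N * P1 (l + 1)" for l
    unfolding I using Q[of 1 l] eps_pos by (simp add: P1_def bond_range_def bdiff_def)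
  have b2: "integral {L l..L (l + int 2)} (\<lambda>x. \<psi> (bond_range (l, 2) * diff_quot (bond_ivl N (l, 2)) y) * lat.slope e (lat.idx x))
      = eps N * P2 (l + 2)" for l
  proof -
    have s: "bdiff N u (l + 2 - 1) + bdiff N u (l + 2) = (u (l + 2) - u l) / eps N" for u
      by (simp add: bdiff_def diff_divide_distrib)
    have "bond_range (l, 2) * diff_quot (bond_ivl N (l, 2)) y = (z (l + 2) - z l) / eps N"
      using Q[of 2 l] eps_pos by (simp add: bond_range_def field_simps)
    then show ?thesis unfolding I P2_def s using eps_pos by simp
  qed
  have "stress_sum \<psi> z e = eps N * ((\<Sum>l\<in>period_cells N. P1 (l + 0)) + (\<Sum>l\<in>period_cells N. P2 (l + 0)))"
    by (simp add: stress_sum_def P1_def P2_def sum.distrib)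
  also have "\<dots> = eps N * ((\<Sum>l\<in>period_cells N. P1 (l + 1)) + (\<Sum>l\<in>period_cells N. P2 (l + 2)))"
    by (simp only: sum_period_cells[of P1, OF P(1)] sum_period_cells[of P2, OF P(2)])
  finally show ?thesis
    unfolding sum_bonds fst_conv snd_conv b1 b2 z_def
    by (simp add: sum_distrib_left distrib_left)
qed

definition bond_error :: "(real \<Rightarrow> real) \<Rightarrow> (real \<Rightarrow> real) \<Rightarrow> int \<times> nat \<Rightarrow> real \<Rightarrow> real" where
  "bond_error \<psi> y b x = \<psi> (bond_range b * diff_quot (bond_ivl N b) y) - bond_stress \<psi> (\<lambda>k. y (X k)) b x"

lemma lbm_bond_error: "loc_bounded_meas (bond_error \<psi> y b)"
  unfolding bond_error_def[abs_def] by (intro lbm_intros lbm_bond_stress)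

text \<open>\<open>Oa\<close> and \<open>Oc\<close> are complementary, so the square of the error
  splits without mixed terms. For \<psi> = \<open>deriv \<phi>\<close> the left side is one summand
  of \<open>eta_elem_sq\<close>.\<close>

lemma bond_error_square:
  assumes y: "y = pw_affine X (\<lambda>k. y (X k))"
  shows "(L2_norm (bond_ivl N b \<inter> Oa) (\<lambda>x. \<psi> (bond_range b * diff_quot (bond_ivl N b) y)
        - \<psi> (bond_range b * diff_quot (bond_ivl N b \<inter> Oa) y)))\<^sup>2
      + (L2_norm (bond_ivl N b \<inter> Oc) (\<lambda>x. \<psi> (bond_range b * diff_quot (bond_ivl N b) y)
        - \<psi> (bond_range b * deriv y x)))\<^sup>2
    = integral {L (fst b)..L (fst b + int (snd b))} (\<lambda>x. (bond_error \<psi> y b x)\<^sup>2)"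
proof -
  define v where "v k = y (X k)" for k
  have yv: "y = pw_affine X v" unfolding v_def[abs_def] by (rule y)
  obtain l j where b: "b = (l, j)" by (cases b)
  have ivl: "bond_ivl N b = {L l<..<L (l + int j)}" unfolding b by (rule bond_ivl_eq)
  define c where "c = \<psi> (bond_range b * diff_quot (bond_ivl N b) y)"
  define c1 where "c1 = c - atom_stress \<psi> v b"
  define c2 where "c2 x = c - \<psi> (bond_range b * mesh.slope v (mesh.idx x))" for x
  have lbm: "loc_bounded_meas c2" unfolding c2_def[abs_def]
    by (intro lbm_intros mesh.lbm_idx[of "\<lambda>k. \<psi> (bond_range b * mesh.slope v k)"])
  have "(L2_norm (bond_ivl N b \<inter> Oa) (\<lambda>x. c - \<psi> (bond_range b * diff_quot (bond_ivl N b \<inter> Oa) y)))\<^sup>2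
    = (LINT x:{L l<..<L (l + int j)} \<inter> Oa|lborel. c1\<^sup>2)"
    by (simp add: L2_norm_square c1_def atom_stress_def bond_atom_def ivl yv)
  also have "\<dots> = integral {L l..L (l + int j)} (\<lambda>x. indicator Oa x * c1\<^sup>2)"
    by (intro LINT_open_ivl lbm_intros Oa_measurable)
  finally have 1: "(L2_norm (bond_ivl N b \<inter> Oa) (\<lambda>x. c - \<psi> (bond_range b * diff_quot (bond_ivl N b \<inter> Oa) y)))\<^sup>2 = \<dots>" .
  have "(L2_norm (bond_ivl N b \<inter> Oc) (\<lambda>x. c - \<psi> (bond_range b * deriv y x)))\<^sup>2
    = (LINT x:{L l<..<L (l + int j)} \<inter> Oc|lborel. (c - \<psi> (bond_range b * deriv (pw_affine X v) x))\<^sup>2)"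
    unfolding L2_norm_square ivl yv[symmetric] ..
  also have "\<dots> = (LINT x:{L l<..<L (l + int j)} \<inter> Oc|lborel. (c2 x)\<^sup>2)"
    unfolding c2_def by (rule mesh.LINT_deriv_pw_affine)
  also have "\<dots> = integral {L l..L (l + int j)} (\<lambda>x. indicator Oc x * (c2 x)\<^sup>2)"
    by (intro LINT_open_ivl lbm_intros lbm Oc_measurable)
  finally have 2: "(L2_norm (bond_ivl N b \<inter> Oc) (\<lambda>x. c - \<psi> (bond_range b * deriv y x)))\<^sup>2 = \<dots>" .
  have "integral {L l..L (l + int j)} (\<lambda>x. (bond_error \<psi> y b x)\<^sup>2)
    = integral {L l..L (l + int j)} (\<lambda>x. indicator Oa x * c1\<^sup>2 + indicator Oc x * (c2 x)\<^sup>2)"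
  proof (rule arg_cong[where f = "integral _"], rule ext)
    fix x
    show "(bond_error \<psi> y b x)\<^sup>2 = indicator Oa x * c1\<^sup>2 + indicator Oc x * (c2 x)\<^sup>2"
      unfolding bond_error_def bond_stress_def c_def[symmetric] v_def[symmetric] c1_def c2_def
      using Oc_iff[of x] by (cases "x \<in> Oa") auto
  qed
  also have "\<dots> = integral {L l..L (l + int j)} (\<lambda>x. indicator Oa x * c1\<^sup>2)
      + integral {L l..L (l + int j)} (\<lambda>x. indicator Oc x * (c2 x)\<^sup>2)"
    by (intro integral_unique has_integral_add integrable_integral lbm_integrable_on lbm_intros lbm
        Oa_measurable Oc_measurable)
  finally show ?thesis unfolding c_def[symmetric] 1 2 unfolding b by simp
qed

text \<open>If the bond lies in \<open>Oa\<close>, both models use the same difference quotient; if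
  it lies within one continuum element, y is affine on it and the difference quotient equals the
  derivative.\<close>

lemma bond_error_zero:
  assumes y: "y = pw_affine X (\<lambda>k. y (X k))" and b: "(l, j) \<in> bonds N"
    and no: "\<And>k. X k \<in> Oc \<Longrightarrow> X k \<notin> bond_ivl N (l, j)" and x: "L l < x" "x < L (l + int j)"
  shows "bond_error \<psi> y (l, j) x = 0"
proof -
  have j: "j = 1 \<or> j = 2" using b by (auto simp: bonds_def)
  have w: "L (l + int j) \<le> L l + 2 * eps N" "L l < L (l + int j)"
    using j eps_pos by (auto simp: algebra_simps)
  have x': "x \<in> {L l<..<L (l + int j)}" using x by simp
  consider (atom) "{L l<..<L (l + int j)} \<subseteq> Oa"
    | (cont) k where "{L l<..<L (l + int j)} \<inter> Oa = {}" "X (k - 1) \<le> L l" "L (l + int j) \<le> X k"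
    using ivl_without_cont_node[OF rangeI rangeI w(2,1) no[unfolded bond_ivl_eq]] by blast
  then show ?thesis
  proof cases
    case atom
    then have "bond_atom (l, j) = bond_ivl N (l, j)" by (auto simp: bond_atom_def bond_ivl_eq)
    moreover have "x \<in> Oa" using atom x' by blast
    ultimately show ?thesis
      unfolding bond_error_def bond_stress_def atom_stress_def using Oc_iff[of x] y by simp
  next
    case (cont k)
    then have "x \<notin> Oa" using x' by blast
    moreover have "mesh.idx x = k" using cont x by (intro mesh.idx_eqI) auto
    moreover have "diff_quot (bond_ivl N (l, j)) y = mesh.slope (\<lambda>k. y (X k)) k"
    proof -
      have "y (L (l + int j)) - y (L l) = mesh.slope (\<lambda>k. y (X k)) k * (L (l + int j) - L l)"
        using cont w(2) mesh.pw_affine_cell[of k "L l" "\<lambda>k. y (X k)"]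
          mesh.pw_affine_cell[of k "L (l + int j)" "\<lambda>k. y (X k)"] y by (simp add: algebra_simps)
      moreover have "L (l + int j) - L l \<noteq> 0" using w(2) by linarith
      ultimately show ?thesis
        unfolding bond_ivl_eq diff_quot_ivl[OF w(2)] by (simp only: nonzero_mult_div_cancel_right not_False_eq_True)
    qed
    ultimately show ?thesis
      unfolding bond_error_def bond_stress_def using Oc_iff[of x] by simp
  qed
qed

text \<open>Written bondwise, both variations pair a stress with the slope of the same e, so only
  the stress errors remain. Cauchy-Schwarz is applied on each bond and then over the bonds that
  contain a continuum node.\<close>

lemma stored_residual:
  assumes y: "y = pw_affine X (\<lambda>k. y (X k))" "\<And>x. y (x + 1) = y x + F"
    and e: "\<And>l. e (l + 2 * int N) = e l"
  shows "\<bar>stress_sum (deriv \<phi>) (nodal N y) e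
      - (\<Sum>b\<in>bonds N. integral {L (fst b)..L (fst b + int (snd b))}
          (\<lambda>x. bond_stress (deriv \<phi>) (\<lambda>k. y (X k)) b x * lat.slope e (lat.idx x)))\<bar>
    \<le> eta N \<phi> La Ra K X y * sqrt (integral {0..1} (\<lambda>x. (lat.slope e (lat.idx x))\<^sup>2))"
proof -
  define de where "de x = lat.slope e (lat.idx x)" for x
  define I where "I b = {L (fst b)..L (fst b + int (snd b))}" for b :: "int \<times> nat"
  define R where "R = bond_error (deriv \<phi>) y"
  define \<rho> where "\<rho> b = integral (I b) (\<lambda>x. (R b x)\<^sup>2)" for b
  define M2 where "M2 = integral {0..1} (\<lambda>x. (de x)\<^sup>2)"
  define \<K> where "\<K> = {k \<in> {1..int K}. X k \<in> Omega_c La Ra}"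
  define \<B> where "\<B> k = {b \<in> bonds N. \<exists>m :: int. X k + of_int m \<in> bond_ivl N b}" for k
  define B0 where "B0 = (\<Union>k\<in>\<K>. \<B> k)"
  have finB: "finite (bonds N)" by (simp add: bonds_def period_cells_def)
  have fin: "finite \<K>" "finite (\<B> k)" "finite B0" "B0 \<subseteq> bonds N" for k
  proof -
    show "finite \<K>" unfolding \<K>_def by (rule finite_subset[of _ "{1..int K}"]) auto
    then show "finite (\<B> k)" "finite B0" "B0 \<subseteq> bonds N"
      using finB by (auto simp: \<B>_def B0_def)
  qed
  have lbm: "loc_bounded_meas de" "loc_bounded_meas (R b)" for b
    unfolding de_def[abs_def] R_def using lat.lbm_idx lbm_bond_error by auto
  have int: "g integrable_on I b" if "loc_bounded_meas g" for g b
    unfolding I_def by (rule lbm_integrable_on[OF that])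
  have \<rho>0: "0 \<le> \<rho> b" for b
    unfolding \<rho>_def by (intro integral_nonneg int lbm_intros lbm) auto
  have diff: "stress_sum (deriv \<phi>) (nodal N y) e
      - (\<Sum>b\<in>bonds N. integral (I b) (\<lambda>x. bond_stress (deriv \<phi>) (\<lambda>k. y (X k)) b x * de x))
    = (\<Sum>b\<in>bonds N. integral (I b) (\<lambda>x. R b x * de x))"
    unfolding stress_sum_bonds[of y F e, OF y(2) e] sum_subtractf[symmetric] I_def[symmetric] de_def[symmetric]
  proof (intro sum.cong refl)
    fix b
    have "integral (I b) (\<lambda>x. deriv \<phi> (bond_range b * diff_quot (bond_ivl N b) y) * de x)
      - integral (I b) (\<lambda>x. bond_stress (deriv \<phi>) (\<lambda>k. y (X k)) b x * de x)
      = integral (I b) (\<lambda>x. deriv \<phi> (bond_range b * diff_quot (bond_ivl N b) y) * de x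
          - bond_stress (deriv \<phi>) (\<lambda>k. y (X k)) b x * de x)"
      by (intro Henstock_Kurzweil_Integration.integral_diff[symmetric] int lbm_intros lbm lbm_bond_stress)
    then show "integral (I b) (\<lambda>x. deriv \<phi> (bond_range b * diff_quot (bond_ivl N b) y) * de x)
      - integral (I b) (\<lambda>x. bond_stress (deriv \<phi>) (\<lambda>k. y (X k)) b x * de x)
      = integral (I b) (\<lambda>x. R b x * de x)"
      by (simp add: R_def bond_error_def left_diff_distrib)
  qed
  have zero: "integral (I b) (\<lambda>x. R b x * de x) = 0" if b: "b \<in> bonds N - B0" for b
  proof -
    obtain l j where lj: "b = (l, j)" by (cases b)
    have no: "X k \<notin> bond_ivl N (l, j)" if k: "X k \<in> Oc" for k
    proof
      assume "X k \<in> bond_ivl N (l, j)"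
      moreover obtain k' m where "k' \<in> {1..int K}" "X k' \<in> Omega_c La Ra" "X k = X k' + of_int m"
        by (rule node_representative[OF k])
      ultimately have "k' \<in> \<K>" "b \<in> \<B> k'" using b lj by (auto simp: \<K>_def \<B>_def)
      with b show False by (auto simp: B0_def)
    qed
    have b': "(l, j) \<in> bonds N" using b lj by simp
    show ?thesis
      unfolding I_def lj fst_conv snd_conv R_def
      by (intro integral_zero_interior) (simp add: bond_error_zero[OF y(1) b' no])
  qed
  \<comment> \<open>3 = 1 + 2, the contributions of the bonds of range 1 and of range 2.\<close>
  have de2: "(\<Sum>b\<in>bonds N. integral (I b) (\<lambda>x. (de x)\<^sup>2)) = 3 * M2"
  proof -
    have per: "(de (x + 1))\<^sup>2 = (de x)\<^sup>2" for x
    proof -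
      have "lat.slope e (l + int (2 * N)) = lat.slope e l" for l
        by (rule lat.slope_period[of _ 0]) (simp add: e)
      then show ?thesis using lat.idx_shift[of x 1] by (simp add: de_def)
    qed
    show ?thesis
      unfolding sum_bonds I_def fst_conv snd_conv
        integral_bonds_periodic[OF lbm_power2[OF lbm(1)] per] M2_def by simp
  qed
  have "\<bar>\<Sum>b\<in>bonds N. integral (I b) (\<lambda>x. R b x * de x)\<bar> = \<bar>\<Sum>b\<in>B0. integral (I b) (\<lambda>x. R b x * de x)\<bar>"
    using sum.mono_neutral_right[OF finB fin(4), of "\<lambda>b. integral (I b) (\<lambda>x. R b x * de x)"] zero by simp
  also have "\<dots> \<le> (\<Sum>b\<in>B0. \<bar>sqrt (\<rho> b)\<bar> * \<bar>sqrt (integral (I b) (\<lambda>x. (de x)\<^sup>2))\<bar>)"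
  proof (rule order_trans[OF sum_abs], rule sum_mono)
    fix b
    have "\<bar>integral (I b) (\<lambda>x. R b x * de x)\<bar> \<le> sqrt (\<rho> b) * sqrt (integral (I b) (\<lambda>x. (de x)\<^sup>2))"
      unfolding \<rho>_def by (intro integral_Cauchy_Schwarz int lbm_intros lbm)
    also have "\<dots> \<le> \<bar>sqrt (\<rho> b)\<bar> * \<bar>sqrt (integral (I b) (\<lambda>x. (de x)\<^sup>2))\<bar>"
      using abs_ge_self[of "sqrt (\<rho> b) * sqrt (integral (I b) (\<lambda>x. (de x)\<^sup>2))"] by (simp only: abs_mult)
    finally show "\<bar>integral (I b) (\<lambda>x. R b x * de x)\<bar> \<le> \<dots>" .
  qed
  also have "\<dots> \<le> L2_set (\<lambda>b. sqrt (\<rho> b)) B0 * L2_set (\<lambda>b. sqrt (integral (I b) (\<lambda>x. (de x)\<^sup>2))) B0"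
    by (rule L2_set_mult_ineq)
  also have "\<dots> = sqrt (\<Sum>b\<in>B0. \<rho> b) * sqrt (\<Sum>b\<in>B0. integral (I b) (\<lambda>x. (de x)\<^sup>2))"
  proof -
    have "0 \<le> integral (I b) (\<lambda>x. (de x)\<^sup>2)" for b
      by (intro integral_nonneg int lbm_intros lbm) auto
    then show ?thesis using \<rho>0 by (simp add: L2_set_def)
  qed
  also have "\<dots> \<le> sqrt (\<Sum>k\<in>\<K>. \<Sum>b\<in>\<B> k. \<rho> b) * sqrt (3 * M2)"
  proof (intro mult_mono real_sqrt_le_mono)
    \<comment> \<open>A bond with several continuum nodes occurs in the estimator once for each of
      the corresponding node classes, which only enlarges the sum.\<close>
    show "(\<Sum>b\<in>B0. \<rho> b) \<le> (\<Sum>k\<in>\<K>. \<Sum>b\<in>\<B> k. \<rho> b)"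
      unfolding B0_def using fin(1)
    proof (induction rule: finite_induct)
      case (insert k F)
      have "sum \<rho> (\<B> k \<union> (\<Union>k\<in>F. \<B> k)) \<le> sum \<rho> (\<B> k) + sum \<rho> (\<Union>k\<in>F. \<B> k)"
        using sum.union_inter[OF fin(2)[of k], of "\<Union>k\<in>F. \<B> k" \<rho>] insert(1) fin(2)
          sum_nonneg[of "\<B> k \<inter> (\<Union>k\<in>F. \<B> k)" \<rho>] \<rho>0 by auto
      then show ?case using insert by simp
    qed simp
    show "(\<Sum>b\<in>B0. integral (I b) (\<lambda>x. (de x)\<^sup>2)) \<le> 3 * M2"
      unfolding de2[symmetric]
      by (intro sum_mono2 finB fin integral_nonneg int lbm_intros lbm) auto
    show "0 \<le> sqrt (\<Sum>b\<in>B0. integral (I b) (\<lambda>x. (de x)\<^sup>2))"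
      by (intro real_sqrt_ge_zero sum_nonneg integral_nonneg int lbm_intros lbm) auto
    show "0 \<le> sqrt (\<Sum>k\<in>\<K>. \<Sum>b\<in>\<B> k. \<rho> b)"
      by (intro real_sqrt_ge_zero sum_nonneg \<rho>0)
  qed
  also have "\<dots> = sqrt (3 * (\<Sum>k\<in>\<K>. \<Sum>b\<in>\<B> k. \<rho> b)) * sqrt M2"
    by (simp add: real_sqrt_mult)
  also have "(\<Sum>k\<in>\<K>. \<Sum>b\<in>\<B> k. \<rho> b) = (\<Sum>k\<in>\<K>. eta_elem_sq N \<phi> La Ra X y k)"
    unfolding eta_elem_sq_def \<B>_def \<rho>_def R_def I_def bond_error_square[OF y(1)] ..
  also have "sqrt (3 * (\<Sum>k\<in>\<K>. eta_elem_sq N \<phi> La Ra X y k)) = eta N \<phi> La Ra K X y"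
    by (simp add: eta_def \<K>_def)
  finally show ?thesis
    using diff unfolding M2_def I_def de_def by simp
qed

end

section \<open>Functions of class C2 on closed intervals\<close>

text \<open>Two-sided derivatives inside, with continuous extensions up to the end points. At an end
  point f may have a kink and \<open>deriv f\<close> may be unspecified, which happens where the
  smooth part of f ends.\<close>

definition C2_ivl :: "(real \<Rightarrow> real) \<Rightarrow> real \<Rightarrow> real \<Rightarrow> bool" where
  "C2_ivl f a b \<longleftrightarrow> (\<exists>f1 f2. continuous_on {a..b} f \<and> continuous_on {a..b} f1 \<and> continuous_on {a..b} f2 \<and>
     (\<forall>x\<in>{a<..<b}. (f has_real_derivative f1 x) (at x) \<and> (f1 has_real_derivative f2 x) (at x)))"

lemma deriv_deriv_eq:
  fixes f f1 f2 :: "real \<Rightarrow> real"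
  assumes "\<And>x. x \<in> {a<..<b} \<Longrightarrow> (f has_real_derivative f1 x) (at x)"
    "\<And>x. x \<in> {a<..<b} \<Longrightarrow> (f1 has_real_derivative f2 x) (at x)" and x: "x \<in> {a<..<b}"
  shows "deriv f x = f1 x" "(deriv f has_real_derivative f2 x) (at x)" "deriv (deriv f) x = f2 x"
proof -
  have d: "deriv f z = f1 z" if "z \<in> {a<..<b}" for z
    using assms(1)[OF that] by (rule DERIV_imp_deriv)
  then show "deriv f x = f1 x" using x by simp
  show "(deriv f has_real_derivative f2 x) (at x)"
    by (rule has_field_derivative_transform_within_open[OF assms(2)[OF x], of "{a<..<b}"])
      (use x d in auto)
  then show "deriv (deriv f) x = f2 x" by (rule DERIV_imp_deriv)
qed

lemma C2_ivl_interior: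
  assumes "C2_ivl f a b" "x \<in> {a<..<b}"
  shows "(f has_real_derivative deriv f x) (at x)" "(deriv f has_real_derivative deriv (deriv f) x) (at x)"
    "isCont (deriv (deriv f)) x"
proof -
  obtain f1 f2 where f: "continuous_on {a..b} f2"
    "\<And>x. x \<in> {a<..<b} \<Longrightarrow> (f has_real_derivative f1 x) (at x)"
    "\<And>x. x \<in> {a<..<b} \<Longrightarrow> (f1 has_real_derivative f2 x) (at x)"
    using assms(1) unfolding C2_ivl_def by blast
  note d = deriv_deriv_eq[of a b f f1 f2, OF f(2,3)]
  show "(f has_real_derivative deriv f x) (at x)" "(deriv f has_real_derivative deriv (deriv f) x) (at x)"
    using d assms(2) f(2) by auto
  have "continuous_on {a<..<b} (deriv (deriv f))"
    by (rule continuous_on_eq[of _ f2]) (use d(3) continuous_on_subset[OF f(1)] in \<open>auto simp: subset_eq\<close>)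
  then show "isCont (deriv (deriv f)) x"
    using assms(2) by (simp add: continuous_on_eq_continuous_at)
qed

text \<open>Inside, the derivatives are \<open>deriv f\<close> and \<open>deriv (deriv f)\<close>;
  their missing end point values are supplied by f1, f2 near a and by g1, g2 near b. The overlaps up
  to c and from d on make the combined functions continuous.\<close>

lemma C2_ivlI:
  assumes "continuous_on {a..b} f"
    and int: "\<And>x. x \<in> {a<..<b} \<Longrightarrow> (f has_real_derivative deriv f x) (at x) \<and>
      (deriv f has_real_derivative deriv (deriv f) x) (at x) \<and> isCont (deriv (deriv f)) x"
    and left: "a < c" "continuous_on {a..c} f1" "continuous_on {a..c} f2"
      "\<And>x. x \<in> {a<..c} \<Longrightarrow> deriv f x = f1 x \<and> deriv (deriv f) x = f2 x"
    and right: "d < b" "continuous_on {d..b} g1" "continuous_on {d..b} g2"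
      "\<And>x. x \<in> {d..<b} \<Longrightarrow> deriv f x = g1 x \<and> deriv (deriv f) x = g2 x"
    and cd: "c < d"
  shows "C2_ivl f a b"
proof -
  have glue: "continuous_on {a..b} (\<lambda>x. if x \<le> a then u x else if b \<le> x then v x else h x)"
    if u: "continuous_on {a..c} u" "\<And>x. x \<in> {a<..c} \<Longrightarrow> h x = u x"
      and v: "continuous_on {d..b} v" "\<And>x. x \<in> {d..<b} \<Longrightarrow> h x = v x"
      and h: "\<And>x. x \<in> {a<..<b} \<Longrightarrow> isCont h x" for u v h :: "real \<Rightarrow> real"
  proof -
    let ?F = "\<lambda>x. if x \<le> a then u x else if b \<le> x then v x else h x"
    have "continuous_on {a..c} ?F"
      by (rule continuous_on_eq[OF u(1)]) (use u(2) cd right(1) in auto)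
    moreover have "continuous_on {c..d} h"
      using h left(1) right(1) by (intro continuous_at_imp_continuous_on) auto
    then have "continuous_on {c..d} ?F"
      by (rule continuous_on_eq) (use left(1) right(1) in auto)
    moreover have "continuous_on {d..b} ?F"
      by (rule continuous_on_eq[OF v(1)]) (use v(2) cd left(1) in auto)
    ultimately have "continuous_on ({a..c} \<union> {c..d} \<union> {d..b}) ?F"
      by (intro continuous_on_closed_Un closed_Un) auto
    moreover have "{a..c} \<union> {c..d} \<union> {d..b} = {a..b}" using left(1) right(1) cd by auto
    ultimately show ?thesis by simp
  qed
  let ?F1 = "\<lambda>x. if x \<le> a then f1 x else if b \<le> x then g1 x else deriv f x"
  let ?F2 = "\<lambda>x. if x \<le> a then f2 x else if b \<le> x then g2 x else deriv (deriv f) x"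
  have "continuous_on {a..b} ?F1"
    using left right int by (intro glue) (auto intro: DERIV_isCont)
  moreover have "continuous_on {a..b} ?F2"
    using left right int by (intro glue) auto
  moreover have "(f has_real_derivative ?F1 x) (at x) \<and> (?F1 has_real_derivative ?F2 x) (at x)"
    if x: "x \<in> {a<..<b}" for x
  proof -
    have "(?F1 has_real_derivative deriv (deriv f) x) (at x)"
      by (rule has_field_derivative_transform_within_open[of "deriv f" _ _ "{a<..<b}"])
        (use int[OF x] x in auto)
    then show ?thesis using int[OF x] x by simp
  qed
  ultimately show ?thesis unfolding C2_ivl_def using assms(1) by blast
qed

text \<open>Smoothness on both sides alone would permit a kink at c; the neighbourhood of c excludes
  it.\<close>

lemma C2_ivl_glue:
  assumes ab: "a < c" "c < b" and L: "C2_ivl f a c" and R: "C2_ivl f c b"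
    and M: "0 < \<delta>" "C2_ivl f (c - \<delta>) (c + \<delta>)"
  shows "C2_ivl f a b"
proof -
  obtain f1 f2 where f: "continuous_on {a..c} f" "continuous_on {a..c} f1" "continuous_on {a..c} f2"
    "\<And>x. x \<in> {a<..<c} \<Longrightarrow> (f has_real_derivative f1 x) (at x)"
    "\<And>x. x \<in> {a<..<c} \<Longrightarrow> (f1 has_real_derivative f2 x) (at x)"
    using L unfolding C2_ivl_def by blast
  obtain g1 g2 where g: "continuous_on {c..b} f" "continuous_on {c..b} g1" "continuous_on {c..b} g2"
    "\<And>x. x \<in> {c<..<b} \<Longrightarrow> (f has_real_derivative g1 x) (at x)"
    "\<And>x. x \<in> {c<..<b} \<Longrightarrow> (g1 has_real_derivative g2 x) (at x)"
    using R unfolding C2_ivl_def by blast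
  define c1 c2 where "c1 = (a + c) / 2" and "c2 = (c + b) / 2"
  have c: "a < c1" "c1 < c" "c < c2" "c2 < b" using ab by (auto simp: c1_def c2_def)
  show ?thesis
  proof (rule C2_ivlI[of a b f c1 f1 f2 c2 g1 g2])
    have "continuous_on ({a..c} \<union> {c..b}) f" by (intro continuous_on_closed_Un f g) auto
    moreover have "{a..c} \<union> {c..b} = {a..b}" using ab by auto
    ultimately show "continuous_on {a..b} f" by simp
    fix x assume x: "x \<in> {a<..<b}"
    consider "x \<in> {a<..<c}" | "x \<in> {c - \<delta><..<c + \<delta>}" | "x \<in> {c<..<b}" using x M(1) by force
    then show "(f has_real_derivative deriv f x) (at x) \<and>
      (deriv f has_real_derivative deriv (deriv f) x) (at x) \<and> isCont (deriv (deriv f)) x"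
      by cases (use C2_ivl_interior[OF L] C2_ivl_interior[OF R] C2_ivl_interior[OF M(2)] in auto)
  next
    show "deriv f x = f1 x \<and> deriv (deriv f) x = f2 x" if "x \<in> {a<..c1}" for x
      using deriv_deriv_eq[of a c f f1 f2 x, OF f(4,5)] that c by auto
    show "deriv f x = g1 x \<and> deriv (deriv f) x = g2 x" if "x \<in> {c2..<b}" for x
      using deriv_deriv_eq[of c b f g1 g2 x, OF g(4,5)] that c by auto
  qed (use c in \<open>auto intro: continuous_on_subset f g\<close>)
qed

lemma Ck_on_2_imp_C2_ivl:
  assumes "Ck_on 2 f S" "{a..b} \<subseteq> S"
  shows "C2_ivl f a b"
proof -
  obtain D :: "nat \<Rightarrow> real \<Rightarrow> real" where D: "D 0 = f"
    "\<And>j x. j < 2 \<Longrightarrow> x \<in> S \<Longrightarrow> (D j has_real_derivative D (Suc j) x) (at x within S)"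
    "continuous_on S (D 2)"
    using assms(1) unfolding Ck_on_def by blast
  have cS: "continuous_on S (D j)" if "j < 2" for j
    by (rule DERIV_continuous_on) (rule D(2)[OF that])
  have c: "continuous_on {a..b} (D 0)" "continuous_on {a..b} (D 1)" "continuous_on {a..b} (D 2)"
    by (rule continuous_on_subset[OF _ assms(2)], rule D(3) cS, simp?)+
  have "(D j has_real_derivative D (Suc j) x) (at x)" if j: "j < 2" and x: "x \<in> {a<..<b}" for j x
  proof -
    have "(D j has_real_derivative D (Suc j) x) (at x within {a..b})"
      by (rule DERIV_subset[OF D(2)[OF j] assms(2)]) (use x assms(2) in force)
    then show ?thesis using x by (simp add: at_within_Icc_at)
  qed
  from this[of 0] this[of 1] show ?thesis
    unfolding C2_ivl_def using c D(1) by (intro exI[of _ "D 1"] exI[of _ "D 2"]) (auto simp: numeral_2_eq_2)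
qed

lemma C2_ivl_shift:
  assumes C: "C2_ivl f a b" and per: "\<And>x. f (x + c) = f x"
  shows "C2_ivl f (a + c) (b + c)"
proof -
  obtain f1 f2 where f: "continuous_on {a..b} f" "continuous_on {a..b} f1" "continuous_on {a..b} f2"
    "\<And>x. x \<in> {a<..<b} \<Longrightarrow> (f has_real_derivative f1 x) (at x)"
    "\<And>x. x \<in> {a<..<b} \<Longrightarrow> (f1 has_real_derivative f2 x) (at x)"
    using C unfolding C2_ivl_def by blast
  have fc: "f = (\<lambda>x. f (x - c))" using per[of "_ - c"] by auto
  have cont: "continuous_on {a + c..b + c} (\<lambda>x. g (x - c))" if "continuous_on {a..b} g" for g :: "real \<Rightarrow> real"
    by (rule continuous_on_compose2[OF that]) (auto intro!: continuous_intros)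
  have der: "((\<lambda>x. g (x - c)) has_real_derivative g' (x - c)) (at x)"
    if "(g has_real_derivative g' (x - c)) (at (x - c))" for g g' :: "real \<Rightarrow> real" and x
    using DERIV_shift[of g "g' (x - c)" x "- c"] that by simp
  have "continuous_on {a + c..b + c} f" by (subst fc) (rule cont[OF f(1)])
  moreover have "(f has_real_derivative f1 (x - c)) (at x)" if "x \<in> {a + c<..<b + c}" for x
    by (subst fc) (rule der, rule f(4), use that in auto)
  moreover have "((\<lambda>x. f1 (x - c)) has_real_derivative f2 (x - c)) (at x)" if "x \<in> {a + c<..<b + c}" for x
    by (rule der, rule f(5), use that in auto)
  ultimately show ?thesis
    unfolding C2_ivl_def using cont[OF f(2)] cont[OF f(3)] by blast
qed

lemma C2_ivl_integrals:
  assumes "C2_ivl f a b"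
  shows "(\<lambda>x. (deriv f x)\<^sup>2) integrable_on {a..b}" "(\<lambda>x. (deriv (deriv f) x)\<^sup>2) integrable_on {a..b}"
    "(L2_norm {a..b} f)\<^sup>2 = integral {a..b} (\<lambda>x. (f x)\<^sup>2)"
    "(L2_norm {a..b} (deriv f))\<^sup>2 = integral {a..b} (\<lambda>x. (deriv f x)\<^sup>2)"
    "(L2_norm {a..b} (deriv (deriv f)))\<^sup>2 = integral {a..b} (\<lambda>x. (deriv (deriv f) x)\<^sup>2)"
proof -
  obtain f1 f2 where f: "continuous_on {a..b} f" "continuous_on {a..b} f1" "continuous_on {a..b} f2"
    "\<And>x. x \<in> {a<..<b} \<Longrightarrow> (f has_real_derivative f1 x) (at x)"
    "\<And>x. x \<in> {a<..<b} \<Longrightarrow> (f1 has_real_derivative f2 x) (at x)"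
    using assms unfolding C2_ivl_def by blast
  \<comment> \<open>Used for f and its two derivatives, each of which agrees inside the interval
    with a function continuous up to the ends.\<close>
  have *: "(\<lambda>x. (h x)\<^sup>2) integrable_on {a..b} \<and> (L2_norm {a..b} h)\<^sup>2 = integral {a..b} (\<lambda>x. (h x)\<^sup>2)"
    if g: "continuous_on {a..b} g" and h: "\<And>x. x \<in> {a<..<b} \<Longrightarrow> h x = g x" for g h :: "real \<Rightarrow> real"
  proof -
    have c: "continuous_on {a..b} (\<lambda>x. (g x)\<^sup>2)" by (intro continuous_intros g)
    have "(L2_norm {a..b} h)\<^sup>2 = (LINT x:{a..b}|lborel. (g x)\<^sup>2)"
      unfolding L2_norm_square set_lebesgue_integral_def
    proof (rule integral_discrete_difference[where X = "{a, b}"])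
      fix x assume "x \<notin> {a, b}"
      then show "indicator {a..b} x *\<^sub>R (h x)\<^sup>2 = indicator {a..b} x *\<^sub>R (g x)\<^sup>2"
        using h[of x] by (auto simp: indicator_def)
    qed auto
    also have "\<dots> = integral {a..b} (\<lambda>x. (g x)\<^sup>2)"
      using borel_integrable_atLeastAtMost'[OF c] by (rule set_borel_integral_eq_integral)
    also have "\<dots> = integral {a..b} (\<lambda>x. (h x)\<^sup>2)"
      by (rule integral_spike[of "{a, b}"]) (use h in auto)
    finally show ?thesis
      using integrable_spike_finite[of "{a, b}" "{a..b}" "\<lambda>x. (h x)\<^sup>2" "\<lambda>x. (g x)\<^sup>2"]
        integrable_continuous_real[OF c] h by fastforce
  qed
  note d = deriv_deriv_eq[of a b f f1 f2, OF f(4,5)]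
  show "(\<lambda>x. (deriv f x)\<^sup>2) integrable_on {a..b}" "(\<lambda>x. (deriv (deriv f) x)\<^sup>2) integrable_on {a..b}"
    "(L2_norm {a..b} f)\<^sup>2 = integral {a..b} (\<lambda>x. (f x)\<^sup>2)"
    "(L2_norm {a..b} (deriv f))\<^sup>2 = integral {a..b} (\<lambda>x. (deriv f x)\<^sup>2)"
    "(L2_norm {a..b} (deriv (deriv f)))\<^sup>2 = integral {a..b} (\<lambda>x. (deriv (deriv f) x)\<^sup>2)"
    using *[OF f(1)] *[OF f(2) d(1)] *[OF f(3) d(3)] by blast+
qed

lemma C2_ivl_trapezoid_error:
  assumes C: "C2_ivl f a b" and ab: "a < b" and p: "\<And>x. x \<in> {a..b} \<Longrightarrow> p x = q + s * x"
  shows "\<bar>(b - a) * (f a * p a + f b * p b) / 2 - integral {a..b} (\<lambda>x. f x * p x)\<bar>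
    \<le> (b - a)\<^sup>2 / 8 *
      (2 * (sqrt (integral {a..b} (\<lambda>x. (deriv f x)\<^sup>2)) * sqrt ((b - a) * s\<^sup>2))
       + sqrt (integral {a..b} (\<lambda>x. (deriv (deriv f) x)\<^sup>2)) * sqrt (integral {a..b} (\<lambda>x. (p x)\<^sup>2)))"
proof -
  obtain f1 f2 where f: "continuous_on {a..b} f" "continuous_on {a..b} f1" "continuous_on {a..b} f2"
    "\<And>x. x \<in> {a<..<b} \<Longrightarrow> (f has_real_derivative f1 x) (at x)"
    "\<And>x. x \<in> {a<..<b} \<Longrightarrow> (f1 has_real_derivative f2 x) (at x)"
    using C unfolding C2_ivl_def by blast
  note d = deriv_deriv_eq[of a b f f1 f2, OF f(4,5)]
  have "integral {a..b} (\<lambda>x. (deriv f x)\<^sup>2) = integral {a..b} (\<lambda>x. (f1 x)\<^sup>2)"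
    "integral {a..b} (\<lambda>x. (deriv (deriv f) x)\<^sup>2) = integral {a..b} (\<lambda>x. (f2 x)\<^sup>2)"
    by (rule integral_spike[of "{a, b}"], use d in auto)+
  then show ?thesis using trapezoid_error[OF ab f p] by simp
qed

lemma sum_sqrt_mult_le:
  assumes "\<And>i. i \<in> I \<Longrightarrow> 0 \<le> p i" "\<And>i. i \<in> I \<Longrightarrow> 0 \<le> q i" "(\<Sum>i\<in>I. q i) \<le> Q"
  shows "(\<Sum>i\<in>I. sqrt (p i) * sqrt (q i)) \<le> sqrt (\<Sum>i\<in>I. p i) * sqrt Q"
proof -
  have "(\<Sum>i\<in>I. sqrt (p i) * sqrt (q i)) = (\<Sum>i\<in>I. \<bar>sqrt (p i)\<bar> * \<bar>sqrt (q i)\<bar>)"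
    using assms by (intro sum.cong) auto
  also have "\<dots> \<le> L2_set (\<lambda>i. sqrt (p i)) I * L2_set (\<lambda>i. sqrt (q i)) I"
    by (rule L2_set_mult_ineq)
  also have "\<dots> = sqrt (\<Sum>i\<in>I. p i) * sqrt (\<Sum>i\<in>I. q i)"
    using assms by (simp add: L2_set_def)
  also have "\<dots> \<le> sqrt (\<Sum>i\<in>I. p i) * sqrt Q"
    using assms by (intro mult_left_mono real_sqrt_le_mono real_sqrt_ge_zero sum_nonneg) auto
  finally show ?thesis .
qed

lemma deriv_periodic:
  fixes g :: "real \<Rightarrow> real"
  assumes "\<And>x. g (x + c) = g x" shows "deriv g (x + c) = deriv g x"
proof -
  have "(g has_real_derivative D) (at (x + c)) \<longleftrightarrow> (g has_real_derivative D) (at x)" for D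
    using DERIV_shift[of g D x c] assms by simp
  then show ?thesis by (simp add: deriv_def)
qed

lemma L2_norm_shift:
  assumes "\<And>x. g (x + 1) = g x"
  shows "L2_norm {a + 1..b + 1} g = L2_norm {a..b} g"
proof -
  have "(LINT x:{a + 1..b + 1}|lborel. (g x)\<^sup>2) = (LINT x:{a..b}|lborel. (g x)\<^sup>2)"
    unfolding set_lebesgue_integral_def
    by (subst lborel_integral_real_affine[where c = 1 and t = 1])
      (auto simp: indicator_def assms add.commute[of 1] intro!: Bochner_Integration.integral_cong)
  then show ?thesis by (simp add: L2_norm_def)
qed

section \<open>Residual of the external forces\<close>

locale qc_force = qc_grid N La Ra K X for N La Ra K X +
  fixes f :: "real \<Rightarrow> real"
  assumes f_cont: "continuous_on UNIV f" and f_per: "\<And>x. f (x + 1) = f x"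
    and f_C2: "Ck_on 2 f (Omega_c_tilde N La Ra \<inter> {- 1 / 2..1 / 2})"
    and f_half: "1 / 2 \<notin> range X \<Longrightarrow> \<exists>\<delta>>0. Ck_on 2 f {1 / 2 - \<delta><..<1 / 2 + \<delta>}"
begin

lemma C2_ivl_f_shift: "C2_ivl f (a + of_int m) (b + of_int m) \<longleftrightarrow> C2_ivl f a b"
proof -
  have *: "C2_ivl f (a + of_int m) (b + of_int m)" if "C2_ivl f a b" for a b m
    by (rule C2_ivl_shift[OF that]) (rule periodic_of_int[of f, OF f_per])
  from *[of a b m] *[of "a + of_int m" "b + of_int m" "- m"] show ?thesis by auto
qed

lemma C2_ivl_f:
  assumes "{a..b} \<subseteq> Ot" "- 1 / 2 \<le> a" "b \<le> 1 / 2"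
  shows "C2_ivl f a b"
  by (rule Ck_on_2_imp_C2_ivl[OF f_C2]) (use assms in auto)

text \<open>Smoothness of f is assumed in one period only. The numbers -1/2 and 1/2 are lattice
  points, so every cell has a translate that lies within this period.\<close>

lemma C2_cell: "cell_in l \<Longrightarrow> C2_ivl f (L (l - 1)) (L l)"
proof -
  assume l: "cell_in l"
  \<comment> \<open>This reduces l modulo 2N to an index from -N + 1 to N.\<close>
  define m where "m = - ((l + int N - 1) div (2 * int N))"
  define l' where "l' = l + 2 * int N * m"
  have "l' = (l + int N - 1) mod (2 * int N) - int N + 1"
    unfolding l'_def m_def by (simp add: minus_mult_div_eq_mod[symmetric])
  then have l': "- int N + 1 \<le> l'" "l' \<le> int N"
    using N_pos pos_mod_sign[of "2 * int N" "l + int N - 1"] pos_mod_bound[of "2 * int N" "l + int N - 1"]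
    by linarith+
  have half: "L (- int N) = - 1 / 2" "L (int N) = 1 / 2" using eps_period by auto
  have "L (- int N) \<le> L (l' - 1)" "L l' \<le> L (int N)"
    using l' by (simp_all only: lat.grid_le_iff)
  moreover have "cell_in l'" unfolding l'_def cell_in_shift by (rule l)
  ultimately have "C2_ivl f (L (l' - 1)) (L l')"
    unfolding half by (intro C2_ivl_f cell_in_Ot)
  moreover have "L (l' - 1) = L (l - 1) + of_int m" "L l' = L l + of_int m"
    using L_shift[of l m] L_shift[of "l - 1" m] by (simp_all add: l'_def algebra_simps)
  ultimately show ?thesis by (simp only: C2_ivl_f_shift)
qed

text \<open>Unlike a lattice cell, an element may straddle 1/2. Then 1/2 is not a node, and three
  pieces are glued: the part up to 1/2, the translate of the part starting at -1/2, and the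
  neighbourhood of 1/2 on which f is assumed to be smooth.\<close>

lemma C2_element: "element X k \<subseteq> Ot \<Longrightarrow> C2_ivl f (X (k - 1)) (X k)"
proof -
  assume sub: "element X k \<subseteq> Ot"
  define m where "m = - \<lfloor>X (k - 1) + 1 / 2\<rfloor>"
  define a b where "a = X (k - 1) + of_int m" and "b = X k + of_int m"
  have a: "- 1 / 2 \<le> a" "a < 1 / 2" unfolding a_def m_def by linarith+
  have ab: "{a..b} \<subseteq> Ot"
  proof
    fix x assume "x \<in> {a..b}"
    then have "x - of_int m \<in> element X k" by (auto simp: a_def b_def element_def)
    then show "x \<in> Ot" using sub Ot_shift[of "x - of_int m" m] by auto
  qed
  have "C2_ivl f a b"
  proof (cases "b \<le> 1 / 2")
    case True
    then show ?thesis using ab a by (intro C2_ivl_f)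
  next
    case False
    have "1 / 2 \<notin> range X"
    proof
      assume "1 / 2 \<in> range X"
      then have "1 / 2 - of_int m \<in> range X" using mesh.node_shift[of "1 / 2" "- m"] by simp
      then show False using mesh.node_outside_cell[of "1 / 2 - of_int m" k] a False by (auto simp: a_def b_def)
    qed
    then obtain \<delta> where \<delta>: "0 < \<delta>" "Ck_on 2 f {1 / 2 - \<delta><..<1 / 2 + \<delta>}" using f_half by blast
    have "X k \<le> X (k - 1 + int K)" using T1(1) by simp
    then have b1: "b \<le> a + 1" using T1(2)[of "k - 1"] by (simp add: a_def b_def)
    have "C2_ivl f (- 1 / 2) (b - 1)"
    proof (rule C2_ivl_f)
      show "{- 1 / 2..b - 1} \<subseteq> Ot"
      proof
        fix x assume "x \<in> {- 1 / 2..b - 1}"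
        then have "x + 1 \<in> {a..b}" using a by auto
        then show "x \<in> Ot" using ab Ot_shift[of x 1] by auto
      qed
    qed (use b1 a in auto)
    then have "C2_ivl f (1 / 2) b" using C2_ivl_f_shift[of "- 1 / 2" 1 "b - 1"] by simp
    moreover have "C2_ivl f a (1 / 2)"
      by (rule C2_ivl_f) (use a ab False in auto)
    moreover have "C2_ivl f (1 / 2 - \<delta> / 2) (1 / 2 + \<delta> / 2)"
      by (rule Ck_on_2_imp_C2_ivl[OF \<delta>(2)]) (use \<delta>(1) in auto)
    ultimately show ?thesis
      using a False \<delta>(1) by (intro C2_ivl_glue[of a "1 / 2" b f "\<delta> / 2"]) auto
  qed
  then show ?thesis unfolding a_def b_def C2_ivl_f_shift .
qed

text \<open>A lattice cell or element that is not contained in \<open>Ot\<close> belongs to both partitions, so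
  integrating the cut-off function over a period in two ways compares the two sums.\<close>

lemma sum_cells_eq_sum_elements:
  fixes h h' :: "real \<Rightarrow> real"
  assumes k0: "X k0 = 0"
    and h: "\<And>l. cell_in l \<Longrightarrow> h integrable_on {L (l - 1)..L l}"
      "\<And>k. element X k \<subseteq> Ot \<Longrightarrow> h integrable_on {X (k - 1)..X k}"
    and h': "loc_bounded_meas h'"
  shows "(\<Sum>l\<in>{0 + 1..0 + int (2 * N)}. if cell_in l then integral {L (l - 1)..L l} h else integral {L (l - 1)..L l} h')
    = (\<Sum>k\<in>{k0 + 1..k0 + int K}. if element X k \<subseteq> Ot then integral {X (k - 1)..X k} h
         else integral {X (k - 1)..X k} h')"
proof -
  define H where "H x = (if x \<in> Ot then h x else h' x)" for x
  have cell: "(H has_integral (if cell_in l then integral {L (l - 1)..L l} h else integral {L (l - 1)..L l} h'))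
      {L (l - 1)..L l}" for l
  proof (cases "cell_in l")
    case True
    have "(h has_integral integral {L (l - 1)..L l} h) {L (l - 1)..L l}"
      using h(1)[OF True] by (rule integrable_integral)
    then have "(H has_integral integral {L (l - 1)..L l} h) {L (l - 1)..L l}"
      by (rule has_integral_eq[rotated]) (use cell_in_Ot[OF True] in \<open>auto simp: H_def\<close>)
    then show ?thesis using True by simp
  next
    case False
    have "(h' has_integral integral {L (l - 1)..L l} h') {L (l - 1)..L l}"
      using lbm_integrable_on[OF h'] by (rule integrable_integral)
    then have "(H has_integral integral {L (l - 1)..L l} h') {L (l - 1)..L l}"
    proof (rule has_integral_spike_finite[rotated -1])
      fix x assume "x \<in> {L (l - 1)..L l} - {L (l - 1), L l}"
      then have "x \<in> {L (l - 1)<..<L l}" by auto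
      then have "x \<notin> Ot" using cell_out_Ot[OF False] by blast
      then show "H x = h' x" by (simp add: H_def)
    qed simp
    then show ?thesis using False by simp
  qed
  have elem: "(H has_integral (if element X k \<subseteq> Ot then integral {X (k - 1)..X k} h else integral {X (k - 1)..X k} h'))
      {X (k - 1)..X k}" for k
  proof (cases "element X k \<subseteq> Ot")
    case True
    have "(h has_integral integral {X (k - 1)..X k} h) {X (k - 1)..X k}"
      using h(2)[OF True] by (rule integrable_integral)
    then have "(H has_integral integral {X (k - 1)..X k} h) {X (k - 1)..X k}"
      by (rule has_integral_eq[rotated]) (use True in \<open>auto simp: H_def element_def\<close>)
    then show ?thesis using True by simp
  next
    case False
    then obtain l where l: "\<not> cell_in l" "X (k - 1) = L (l - 1)" "X k = L l"
      using element_tilde_cases[of k] by blast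
    then show ?thesis using cell[of l] False by simp
  qed
  have "L 0 = 0" "L (0 + int (2 * N)) = 1" using eps_period by auto
  then have "(H has_integral (\<Sum>l\<in>{0 + 1..0 + int (2 * N)}. if cell_in l then integral {L (l - 1)..L l} h
      else integral {L (l - 1)..L l} h')) {0..1}"
    using lat.has_integral_cells[OF cell, where i = 0 and n = "2 * N"] by (simp only:)
  moreover have "X (k0 + int K) = 1" using k0 T1 by simp
  then have "(H has_integral (\<Sum>k\<in>{k0 + 1..k0 + int K}. if element X k \<subseteq> Ot then integral {X (k - 1)..X k} h
      else integral {X (k - 1)..X k} h')) {0..1}"
    using mesh.has_integral_cells[OF elem, where i = k0 and n = K] by (simp only: k0)
  ultimately show ?thesis by (rule has_integral_unique)
qed

text \<open>In a periodic trapezoidal sum every point receives half a weight from each of its two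
  cells, which gives the full weight eps of the discrete inner product.\<close>

lemma inner_eps_trapezoid:
  assumes e: "\<And>l. e (l + 2 * int N) = e l"
  shows "inner_eps N (nodal N f) e
    = (\<Sum>l\<in>{0 + 1..0 + int (2 * N)}. integral {L (l - 1)..L l} (pw_affine L (\<lambda>l. f (L l) * e l)))"
proof -
  define Q where "Q l = f (L l) * e l" for l
  have Q: "Q (l + int (2 * N)) = Q l" for l
    using lat.grid_period[of l] e[of l] f_per[of "L l"] by (simp add: Q_def)
  have "integral {L (l - 1)..L l} (pw_affine L Q) = eps N / 2 * (Q (l + (- 1)) + Q (l + 0))" for l
    unfolding lat.integral_pw_affine_cell L_diff by simp
  then have "(\<Sum>l\<in>{0 + 1..0 + int (2 * N)}. integral {L (l - 1)..L l} (pw_affine L Q))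
    = eps N / 2 * ((\<Sum>l\<in>{0 + 1..0 + int (2 * N)}. Q (l + (- 1))) + (\<Sum>l\<in>{0 + 1..0 + int (2 * N)}. Q (l + 0)))"
    by (simp only: distrib_left sum.distrib sum_distrib_left)
  also have "(\<Sum>l\<in>{0 + 1..0 + int (2 * N)}. Q (l + (- 1))) = (\<Sum>l\<in>{0 + 1..0 + int (2 * N)}. Q l)"
  proof -
    have "(\<Sum>l\<in>{0 + 1..0 + int (2 * N)}. Q (l + (- 1))) = (\<Sum>l\<in>{- 1 + 1..- 1 + int (2 * N)}. Q l)"
      by (rule sum.reindex_bij_witness[of _ "\<lambda>l. l + 1" "\<lambda>l. l - 1"]) auto
    also have "\<dots> = (\<Sum>l\<in>{0 + 1..0 + int (2 * N)}. Q l)" by (rule sum_int_period) (rule Q)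
    finally show ?thesis .
  qed
  also have "(\<Sum>l\<in>{0 + 1..0 + int (2 * N)}. Q l) = (\<Sum>l\<in>period_cells N. Q (l + 0))"
    by (rule sum_period_cells[symmetric]) (rule Q)
  finally have "(\<Sum>l\<in>{0 + 1..0 + int (2 * N)}. integral {L (l - 1)..L l} (pw_affine L Q))
      = eps N * (\<Sum>l\<in>period_cells N. Q l)"
    by (simp add: sum_period_cells[of Q 0, OF Q, simplified])
  then show ?thesis unfolding inner_eps_def Q_def[abs_def] nodal_def by simp
qed

text \<open>1/2 need not be a node. By periodicity the integral over \<open>Omega\<close> is moved
  to [0, 1], which is a union of elements and, at the same time, of lattice cells.\<close>

lemma inner_h_trapezoid:
  assumes w: "\<And>k. w (k + int K) = w k" and k0: "X k0 = 0"
  shows "inner_h X f (pw_affine X w)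
    = (\<Sum>k\<in>{k0 + 1..k0 + int K}. integral {X (k - 1)..X k} (pw_affine X (\<lambda>k. f (X k) * w k)))"
proof -
  define g where "g = pw_affine X (\<lambda>k. f (X k) * w k)"
  have g: "loc_bounded_meas g"
    unfolding g_def by (intro lbm_continuous mesh.continuous_pw_affine)
  have per: "g (x + 1) = g x" for x
    unfolding g_def using mesh.pw_affine_period[of "\<lambda>k. f (X k) * w k" 0 x] w T1(2) f_per by simp
  have "inner_h X f (pw_affine X w) = (LINT x:Omega|lborel. g x)"
    by (simp add: inner_h_def I_h_def g_def)
  also have "\<dots> = integral {- 1 / 2..1 / 2} (\<lambda>x. indicator Omega x * g x)"
    by (rule lbm_LINT[OF g]) (auto simp: Omega_def)
  also have "\<dots> = integral {- 1 / 2..- 1 / 2 + 1} g"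
    by (rule integral_cong[THEN trans]) (auto simp: Omega_def)
  also have "\<dots> = integral {0..1} g"
    by (rule integral_unit_periodic[OF g per])
  also have "\<dots> = (\<Sum>k\<in>{k0 + 1..k0 + int K}. integral {X (k - 1)..X k} g)"
    by (rule integral_unit_mesh[OF k0]) (rule lbm_integrable_on[OF g])
  finally show ?thesis unfolding g_def .
qed

text \<open>The estimators run over the elements numbered 1 to K, the quadrature sums over the
  elements of [0, 1]; both windows contain one full period.\<close>

lemma sum_estimator_period:
  assumes k0: "X k0 = 0" and S: "\<And>k. S (k + int K) = (S k :: real)"
  shows "(\<Sum>k\<in>elements_c_tilde N La Ra K X. S k)
    = (\<Sum>k\<in>{k \<in> {k0 + 1..k0 + int K}. element X k \<subseteq> Ot}. S k)"
proof -
  define P where "P k = (if element X k \<subseteq> Ot then S k else 0)" for k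
  have "element X (k + int K) \<subseteq> Ot \<longleftrightarrow> element X k \<subseteq> Ot" for k
  proof -
    have eq: "x \<in> element X (k + int K) \<longleftrightarrow> x - of_int 1 \<in> element X k" for x
      using T1(2)[of k] T1(2)[of "k - 1"] by (auto simp: element_def algebra_simps)
    have sh: "x - of_int 1 \<in> Ot \<longleftrightarrow> x \<in> Ot" "x + of_int 1 \<in> Ot \<longleftrightarrow> x \<in> Ot" for x
      using Ot_shift[of x 1] Ot_shift[of x "-1"] by simp_all
    show ?thesis unfolding subset_iff eq using sh by (metis add_diff_cancel)
  qed
  then have P: "P (k + int K) = P k" for k by (simp add: P_def S)
  have "(\<Sum>k\<in>elements_c_tilde N La Ra K X. S k) = (\<Sum>k\<in>{0 + 1..0 + int K}. P k)"
    unfolding elements_c_tilde_def P_def sum.inter_filter[OF finite_atLeastAtMost_int] by simp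
  also have "\<dots> = (\<Sum>k\<in>{k0 + 1..k0 + int K}. P k)" by (rule sum_int_period) (rule P)
  also have "\<dots> = (\<Sum>k\<in>{k \<in> {k0 + 1..k0 + int K}. element X k \<subseteq> Ot}. S k)"
    unfolding P_def sum.inter_filter[OF finite_atLeastAtMost_int] ..
  finally show ?thesis .
qed

text \<open>Both loads are compared with the integral of f E over the cells and elements in
  \<open>Ot\<close>. On lattice cells the integrand of the trapezoidal rule involves E itself, on
  elements only its mesh interpolant W. Because \<open>E\<close> and \<open>W\<close> vanish at 0
  and 1, their L2 norms over [0, 1] are at most M / pi, where M is the norm of the slope of e; this
  brings pi into \<open>eta_q\<close>.\<close>

lemma force_residual:
  assumes e: "\<And>l. e (l + 2 * int N) = e l" "e 0 = 0"
  shows "\<bar>inner_eps N (nodal N f) e - inner_h X f (pw_affine X (\<lambda>k. pw_affine L e (X k)))\<bar>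
    \<le> (eta_f N f La Ra K X + eta_q N f La Ra K X)
      * sqrt (integral {0..1} (\<lambda>x. (lat.slope e (lat.idx x))\<^sup>2))"
proof -
  obtain k0 where k0: "X k0 = 0" "X (k0 + int K) = 1" by (rule unit_nodes)
  define E where "E = pw_affine L e"
  define w where "w k = E (X k)" for k
  define W where "W = pw_affine X w"
  define de where "de x = lat.slope e (lat.idx x)" for x
  define M where "M = sqrt (integral {0..1} (\<lambda>x. (de x)\<^sup>2))"
  define P1 where "P1 = {0 + 1..0 + int (2 * N)}"
  define P2 where "P2 = {k0 + 1..k0 + int K}"
  define Ci where "Ci = {l \<in> P1. cell_in l}"
  define Ei where "Ei = {k \<in> P2. element X k \<subseteq> Ot}"
  define h where "h k = X k - X (k - 1)" for k
  define s where "s k = mesh.slope w k" for k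
  define T where "T g k = integral {X (k - 1)..X k} (\<lambda>x. (g x)\<^sup>2)" for g :: "real \<Rightarrow> real" and k
  define C where "C g l = integral {L (l - 1)..L l} (\<lambda>x. (g x)\<^sup>2)" for g :: "real \<Rightarrow> real" and l
  have fin: "finite P1" "finite P2" "finite Ci" "finite Ei" "Ci \<subseteq> P1" "Ei \<subseteq> P2"
  proof -
    show "finite P1" "finite P2" by (simp_all add: P1_def P2_def)
    then show "finite Ci" "finite Ei" by (simp_all add: Ci_def Ei_def)
    show "Ci \<subseteq> P1" "Ei \<subseteq> P2" by (auto simp: Ci_def Ei_def)
  qed
  have h0: "0 < h k" for k using increasing[of k] by (simp add: h_def)
  have cE: "continuous_on S E" and cW: "continuous_on S W" for S
    unfolding E_def W_def by (rule lat.continuous_pw_affine mesh.continuous_pw_affine)+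
  have lbm: "loc_bounded_meas de" "loc_bounded_meas E" "loc_bounded_meas W" "loc_bounded_meas f"
    unfolding de_def[abs_def] by (rule lat.lbm_idx lbm_continuous cE cW f_cont)+
  note int = lbm_integrable_on
  have eper: "E (x + 1) = E x" for x
    unfolding E_def using lat.pw_affine_period[of e 0 x] e by simp
  have wper: "w (k + int K) = w k" for k unfolding w_def by (simp add: T1 eper)
  have nonneg: "0 \<le> T g k" "0 \<le> C g l" if "loc_bounded_meas g" for g k l
    unfolding T_def C_def by (auto intro!: integral_nonneg int lbm_intros that)
  \<comment> \<open>The integral of a non-integrable function is 0 by convention, so no regularity
    of g is required here.\<close>
  have nonneg_d: "0 \<le> integral S (\<lambda>x. (g x)\<^sup>2)" for S :: "real set" and g :: "real \<Rightarrow> real"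
    by (cases "(\<lambda>x. (g x)\<^sup>2) integrable_on S") (auto intro: integral_nonneg simp: not_integrable_integral)
  have M2: "(\<Sum>k\<in>P2. T de k) = M\<^sup>2" "(\<Sum>l\<in>P1. C de l) = M\<^sup>2"
  proof -
    have "M\<^sup>2 = integral {0..1} (\<lambda>x. (de x)\<^sup>2)" unfolding M_def using nonneg_d by simp
    then show "(\<Sum>k\<in>P2. T de k) = M\<^sup>2" "(\<Sum>l\<in>P1. C de l) = M\<^sup>2"
      unfolding T_def C_def P1_def P2_def
      by (simp_all only: integral_unit_mesh[OF k0(1), symmetric] integral_unit_lat[symmetric] int[OF lbm_power2[OF lbm(1)]])
  qed
  have M0: "0 \<le> M" unfolding M_def using nonneg_d by simp
  have cell_de: "C de l = eps N * (bdiff N e l)\<^sup>2" for l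
    unfolding C_def de_def by (rule integral_slope_square)
  \<comment> \<open>Variance identity: \<open>s k\<close> is the mean of \<open>de\<close> over the
    element.\<close>
  have elem_de: "((\<lambda>x. (de x - s k)\<^sup>2) has_integral (T de k - h k * (s k)\<^sup>2)) {X (k - 1)..X k}" for k
  proof -
    have "(de has_integral (E (X k) - E (X (k - 1)))) {X (k - 1)..X k}"
      unfolding de_def E_def by (rule lat.has_integral_slope) simp
    moreover have "E (X k) - E (X (k - 1)) = h k * s k"
      using h0[of k] by (simp add: s_def mesh.slope_def w_def h_def)
    ultimately have 1: "(de has_integral h k * s k) {X (k - 1)..X k}" by simp
    have "((\<lambda>x. (s k)\<^sup>2) has_integral h k * (s k)\<^sup>2) {X (k - 1)..X k}"
      using has_integral_const_real[of "(s k)\<^sup>2" "X (k - 1)" "X k"] increasing[of k] by (simp add: h_def)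
    moreover have "((\<lambda>x. (de x)\<^sup>2) has_integral T de k) {X (k - 1)..X k}"
      unfolding T_def by (intro integrable_integral int lbm_intros lbm)
    ultimately have "((\<lambda>x. (de x)\<^sup>2 - 2 * s k * de x + (s k)\<^sup>2) has_integral
        (T de k - 2 * s k * (h k * s k) + h k * (s k)\<^sup>2)) {X (k - 1)..X k}"
      using 1 by (intro has_integral_add has_integral_diff has_integral_mult_right)
    moreover have "(\<lambda>x. (de x)\<^sup>2 - 2 * s k * de x + (s k)\<^sup>2) = (\<lambda>x. (de x - s k)\<^sup>2)"
      by (simp add: power2_eq_square algebra_simps)
    ultimately show ?thesis by (simp add: power2_eq_square algebra_simps)
  qed
  have hs: "h k * (s k)\<^sup>2 \<le> T de k" for k
    using has_integral_nonneg[OF elem_de[of k]] by simp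
  \<comment> \<open>E - W vanishes at both nodes; its kinks inside the element are lattice
    points.\<close>
  have wirt_elem: "integral {X (k - 1)..X k} (\<lambda>x. (E x - W x)\<^sup>2) \<le> (h k / pi)\<^sup>2 * T de k" for k
  proof -
    have "integral {X (k - 1)..X k} (\<lambda>x. (E x - W x)\<^sup>2)
      \<le> ((X k - X (k - 1)) / pi)\<^sup>2 * integral {X (k - 1)..X k} (\<lambda>x. (de x - s k)\<^sup>2)"
    proof (rule Wirtinger_Dirichlet[OF increasing lat.finite_nodes[of "X (k - 1)" "X k"]])
      fix x assume x: "x \<in> {X (k - 1)<..<X k} - range L \<inter> {X (k - 1)..X k}"
      then have "x \<notin> range L" by auto
      then show "((\<lambda>x. E x - W x) has_real_derivative de x - s k) (at x)"
        unfolding E_def W_def de_def s_def using x lat.idx_bounds lat.idx_strict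
        by (intro DERIV_diff lat.has_derivative_pw_affine mesh.has_derivative_pw_affine) auto
    next
      show "(\<lambda>x. (de x - s k)\<^sup>2) integrable_on {X (k - 1)..X k}"
        using elem_de by (rule has_integral_integrable)
    qed (auto intro!: continuous_intros cE cW mesh.continuous_pw_affine simp: W_def w_def)
    also have "integral {X (k - 1)..X k} (\<lambda>x. (de x - s k)\<^sup>2) = T de k - h k * (s k)\<^sup>2"
      using elem_de by (rule integral_unique)
    also have "((X k - X (k - 1)) / pi)\<^sup>2 * (T de k - h k * (s k)\<^sup>2) \<le> (h k / pi)\<^sup>2 * T de k"
      unfolding h_def[symmetric] using h0[of k] by (intro mult_left_mono) auto
    finally show ?thesis .
  qed
  \<comment> \<open>The normalization at 0 and periodicity provide Dirichlet data on the unit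
    interval.\<close>
  have E01: "E 0 = 0" "E 1 = 0" using lat.pw_affine_node[of e 0] e(2) eper[of 0] by (auto simp: E_def)
  have sumE: "(\<Sum>l\<in>P1. C E l) \<le> (M / pi)\<^sup>2"
  proof -
    have "(\<Sum>l\<in>P1. C E l) = integral {0..1} (\<lambda>x. (E x)\<^sup>2)"
      unfolding C_def P1_def by (rule integral_unit_lat[symmetric]) (intro int lbm_intros lbm)
    also have "\<dots> \<le> ((1 - 0) / pi)\<^sup>2 * integral {0..1} (\<lambda>x. (de x)\<^sup>2)"
    proof (rule Wirtinger_Dirichlet[OF _ lat.finite_nodes[of 0 1] cE])
      fix x :: real assume x: "x \<in> {0<..<1} - range L \<inter> {0..1}"
      then have "x \<notin> range L" by auto
      then show "(E has_real_derivative de x) (at x)"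
        unfolding E_def de_def using lat.idx_bounds lat.idx_strict by (intro lat.has_derivative_pw_affine) auto
    qed (auto intro!: int lbm_intros lbm E01)
    also have "\<dots> = (M / pi)\<^sup>2" unfolding M_def using nonneg_d by (simp add: power_divide)
    finally show ?thesis .
  qed
  have sumhs: "(\<Sum>k\<in>P2. h k * (s k)\<^sup>2) \<le> M\<^sup>2"
    unfolding M2(1)[symmetric] by (intro sum_mono hs)
  have sumW: "(\<Sum>k\<in>P2. T W k) \<le> (M / pi)\<^sup>2"
  proof -
    have lbms: "loc_bounded_meas (\<lambda>x. s (mesh.idx x))" by (rule mesh.lbm_idx)
    have "(\<Sum>k\<in>P2. T W k) = integral {0..1} (\<lambda>x. (W x)\<^sup>2)"
      unfolding T_def P2_def by (rule integral_unit_mesh[OF k0(1), symmetric]) (intro int lbm_intros lbm)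
    also have "\<dots> \<le> ((1 - 0) / pi)\<^sup>2 * integral {0..1} (\<lambda>x. (s (mesh.idx x))\<^sup>2)"
    proof (rule Wirtinger_Dirichlet[OF _ mesh.finite_nodes[of 0 1] cW])
      fix x :: real assume x: "x \<in> {0<..<1} - range X \<inter> {0..1}"
      then have "x \<notin> range X" by auto
      then show "(W has_real_derivative s (mesh.idx x)) (at x)"
        unfolding W_def s_def using mesh.idx_bounds mesh.idx_strict by (intro mesh.has_derivative_pw_affine) auto
    next
      show "W 0 = 0" "W 1 = 0"
        using mesh.pw_affine_node[of w k0] mesh.pw_affine_node[of w "k0 + int K"] k0 E01
        by (simp_all add: W_def w_def)
    qed (auto intro!: int lbm_intros lbms)
    also have "integral {0..1} (\<lambda>x. (s (mesh.idx x))\<^sup>2) = (\<Sum>k\<in>P2. integral {X (k - 1)..X k} (\<lambda>x. (s (mesh.idx x))\<^sup>2))"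
      unfolding P2_def by (rule integral_unit_mesh[OF k0(1)]) (intro int lbm_intros lbms)
    also have "\<dots> = (\<Sum>k\<in>P2. h k * (s k)\<^sup>2)"
      using mesh.integral_idx_cell[of _ "\<lambda>j x. (s j)\<^sup>2"] h0
      by (intro sum.cong) (simp_all add: h_def increasing less_imp_le)
    also have "((1 - 0) / pi)\<^sup>2 * (\<Sum>k\<in>P2. h k * (s k)\<^sup>2) \<le> ((1 - 0) / pi)\<^sup>2 * M\<^sup>2"
      by (intro mult_left_mono sumhs) auto
    finally show ?thesis by (simp add: power_divide)
  qed

  define G where "G = pw_affine L (\<lambda>l. f (L l) * e l)"
  define GX where "GX = pw_affine X (\<lambda>k. f (X k) * w k)"
  have lbmG: "loc_bounded_meas G" "loc_bounded_meas (\<lambda>x. f x * E x)"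
    unfolding G_def by (intro lbm_continuous lat.continuous_pw_affine lbm_mult lbm)+
  \<comment> \<open>Such an element is a lattice cell, on which w and e have the same nodal
    values.\<close>
  have GX: "integral {X (k - 1)..X k} G = integral {X (k - 1)..X k} GX" if out: "\<not> element X k \<subseteq> Ot" for k
  proof -
    obtain l where l: "X (k - 1) = L (l - 1)" "X k = L l"
      using element_tilde_cases[of k] out by blast
    have "w k = e l" "w (k - 1) = e (l - 1)"
      unfolding w_def E_def l by (simp_all only: lat.pw_affine_node)
    then show ?thesis
      unfolding GX_def mesh.integral_pw_affine_cell unfolding l G_def lat.integral_pw_affine_cell by simp
  qed
  have trap_cell: "\<bar>integral {L (l - 1)..L l} G - integral {L (l - 1)..L l} (\<lambda>x. f x * E x)\<bar>
     \<le> (eps N)\<^sup>2 / 8 * (2 * (sqrt (C (deriv f) l) * sqrt (C de l)) + sqrt (C (deriv (deriv f)) l) * sqrt (C E l))"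
    if "cell_in l" for l
  proof -
    have "E x = (e (l - 1) - bdiff N e l * L (l - 1)) + bdiff N e l * x" if "x \<in> {L (l - 1)..L l}" for x
      using that lat.pw_affine_cell[of l x e] by (simp add: E_def lat_slope algebra_simps)
    note bound = C2_ivl_trapezoid_error[OF C2_cell[OF that] lat.grid_less this]
    have G_cell: "integral {L (l - 1)..L l} G
       = (L l - L (l - 1)) * (f (L (l - 1)) * E (L (l - 1)) + f (L l) * E (L l)) / 2"
      unfolding G_def E_def lat.integral_pw_affine_cell lat.pw_affine_node ..
    show ?thesis using bound[folded G_cell] unfolding L_diff C_def[symmetric] cell_de .
  qed
  have trap_elem: "\<bar>integral {X (k - 1)..X k} GX - integral {X (k - 1)..X k} (\<lambda>x. f x * E x)\<bar>
     \<le> (h k)\<^sup>2 / 8 * (2 * (sqrt (T (deriv f) k) * sqrt (h k * (s k)\<^sup>2)) + sqrt (T (deriv (deriv f)) k) * sqrt (T W k))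
       + sqrt ((h k / pi)\<^sup>2 * T f k) * sqrt (T de k)"
    if "element X k \<subseteq> Ot" for k
  proof -
    have "W x = (w (k - 1) - s k * X (k - 1)) + s k * x" if "x \<in> {X (k - 1)..X k}" for x
      using that mesh.pw_affine_cell[of k x w] by (simp add: W_def s_def algebra_simps)
    note bound = C2_ivl_trapezoid_error[OF C2_element[OF that] increasing this]
    have GX_elem: "integral {X (k - 1)..X k} GX
       = (X k - X (k - 1)) * (f (X (k - 1)) * W (X (k - 1)) + f (X k) * W (X k)) / 2"
      unfolding GX_def W_def mesh.integral_pw_affine_cell mesh.pw_affine_node ..
    have 1: "\<bar>integral {X (k - 1)..X k} GX - integral {X (k - 1)..X k} (\<lambda>x. f x * W x)\<bar>
      \<le> (h k)\<^sup>2 / 8 * (2 * (sqrt (T (deriv f) k) * sqrt (h k * (s k)\<^sup>2)) + sqrt (T (deriv (deriv f)) k) * sqrt (T W k))"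
      using bound[folded GX_elem] unfolding T_def h_def .
    \<comment> \<open>Passing from W to E costs the integral of f (E - W). Wirtinger on the element
      bounds it, which is the source of \<open>eta_f\<close>.\<close>
    have "integral {X (k - 1)..X k} (\<lambda>x. f x * E x) - integral {X (k - 1)..X k} (\<lambda>x. f x * W x)
      = integral {X (k - 1)..X k} (\<lambda>x. f x * (E x - W x))"
      by (subst Henstock_Kurzweil_Integration.integral_diff[symmetric])
        (auto intro!: int lbm_intros lbm simp: right_diff_distrib)
    also have "\<bar>\<dots>\<bar> \<le> sqrt (T f k) * sqrt (integral {X (k - 1)..X k} (\<lambda>x. (E x - W x)\<^sup>2))"
      unfolding T_def by (intro integral_Cauchy_Schwarz int lbm_intros lbm)
    also have "\<dots> \<le> sqrt (T f k) * sqrt ((h k / pi)\<^sup>2 * T de k)"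
      by (intro mult_left_mono real_sqrt_le_mono wirt_elem real_sqrt_ge_zero nonneg lbm)
    also have "\<dots> = sqrt ((h k / pi)\<^sup>2 * T f k) * sqrt (T de k)"
      by (simp add: real_sqrt_mult)
    finally show ?thesis using 1 by linarith
  qed

  have E_eq: "inner_eps N (nodal N f) e = (\<Sum>l\<in>P1. integral {L (l - 1)..L l} G)"
    unfolding P1_def G_def by (rule inner_eps_trapezoid[of e, OF e(1)])
  have H_eq: "inner_h X f W = (\<Sum>k\<in>P2. integral {X (k - 1)..X k} GX)"
    unfolding P2_def GX_def W_def by (rule inner_h_trapezoid[of w, OF wper k0(1)])
  define A where "A = (\<Sum>l\<in>Ci. integral {L (l - 1)..L l} G - integral {L (l - 1)..L l} (\<lambda>x. f x * E x))"
  define B where "B = (\<Sum>k\<in>Ei. integral {X (k - 1)..X k} GX - integral {X (k - 1)..X k} (\<lambda>x. f x * E x))"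
  \<comment> \<open>Outside \<open>Ot\<close> the two quadrature sums coincide, and inside it both
    are compared with the same integral, which drops out.\<close>
  have diff: "inner_eps N (nodal N f) e - inner_h X f W = A - B"
  proof -
    have "(\<Sum>l\<in>P1. integral {L (l - 1)..L l} G) - A
      = (\<Sum>l\<in>P1. if cell_in l then integral {L (l - 1)..L l} (\<lambda>x. f x * E x) else integral {L (l - 1)..L l} G)"
      unfolding A_def Ci_def sum.inter_filter[OF fin(1)] sum_subtractf[symmetric]
      by (intro sum.cong) auto
    moreover have "(\<Sum>k\<in>P2. integral {X (k - 1)..X k} GX) - B
      = (\<Sum>k\<in>P2. if element X k \<subseteq> Ot then integral {X (k - 1)..X k} (\<lambda>x. f x * E x) else integral {X (k - 1)..X k} G)"
      unfolding B_def Ei_def sum.inter_filter[OF fin(2)] sum_subtractf[symmetric]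
      by (intro sum.cong) (auto simp: GX)
    ultimately show ?thesis
      unfolding E_eq H_eq
      using sum_cells_eq_sum_elements[OF k0(1), of "\<lambda>x. f x * E x" G] lbmG int
      by (simp add: P1_def P2_def)
  qed
  \<comment> \<open>The lattice errors involve norms over cells, the estimators norms over elements.
    Cells and elements in \<open>Ot\<close> fill the same set within a period; the comparison is
    used with cut-off value 0.\<close>
  have transfer: "(\<Sum>l\<in>Ci. C g l) = (\<Sum>k\<in>Ei. T g k)"
    if "\<And>a b. C2_ivl f a b \<Longrightarrow> (\<lambda>x. (g x)\<^sup>2) integrable_on {a..b}" for g
  proof -
    have "(\<Sum>l\<in>P1. if cell_in l then C g l else integral {L (l - 1)..L l} (\<lambda>x. 0))
      = (\<Sum>k\<in>P2. if element X k \<subseteq> Ot then T g k else integral {X (k - 1)..X k} (\<lambda>x. 0))"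
      unfolding C_def T_def P1_def P2_def
      by (rule sum_cells_eq_sum_elements[OF k0(1)]) (intro that C2_cell C2_element lbm_const; assumption)+
    then show ?thesis
      unfolding Ci_def Ei_def sum.inter_filter[OF fin(1)] sum.inter_filter[OF fin(2)]
        Henstock_Kurzweil_Integration.integral_0 .
  qed
  define n0 n1 n2 where "n0 = T f" and "n1 = T (deriv f)" and "n2 = T (deriv (deriv f))"
  have n: "0 \<le> n0 k" "0 \<le> n1 k" "0 \<le> n2 k" for k
    unfolding n0_def n1_def n2_def T_def by (rule nonneg_d)+
  \<comment> \<open>a and b belong to the lattice, c and d to the mesh. The quadrature bound has 2/8
    = 1/4 before the first derivative and 1/8 before the second; with the factor 1/pi of Wirtinger
    the latter is 1/4 times 1/(2 pi), whence 4 pi^2 under the root.\<close>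
  define a b c d where "a = sqrt (eps N ^ 4 * (\<Sum>k\<in>Ei. n1 k))" and "b = sqrt (eps N ^ 4 / (4 * pi\<^sup>2) * (\<Sum>k\<in>Ei. n2 k))"
    and "c = sqrt (\<Sum>k\<in>Ei. h k ^ 4 * n1 k)" and "d = sqrt (1 / (4 * pi\<^sup>2) * (\<Sum>k\<in>Ei. h k ^ 4 * n2 k))"
  have rM: "sqrt (M\<^sup>2) = M" "sqrt ((M / pi)\<^sup>2) = M / pi" using M0 by simp_all
  have absA: "\<bar>A\<bar> \<le> (a + b) / 4 * M"
  proof -
    have "\<bar>A\<bar> \<le> (\<Sum>l\<in>Ci. (eps N)\<^sup>2 / 8 * (2 * (sqrt (C (deriv f) l) * sqrt (C de l))
        + sqrt (C (deriv (deriv f)) l) * sqrt (C E l)))"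
      unfolding A_def by (rule order_trans[OF sum_abs], rule sum_mono, rule trap_cell) (simp add: Ci_def)
    also have "\<dots> = (eps N)\<^sup>2 / 8 * (2 * (\<Sum>l\<in>Ci. sqrt (C (deriv f) l) * sqrt (C de l))
        + (\<Sum>l\<in>Ci. sqrt (C (deriv (deriv f)) l) * sqrt (C E l)))"
      by (simp only: sum_distrib_left[symmetric] sum.distrib)
    also have "\<dots> \<le> (eps N)\<^sup>2 / 8 * (2 * (sqrt (\<Sum>l\<in>Ci. C (deriv f) l) * sqrt (M\<^sup>2))
        + sqrt (\<Sum>l\<in>Ci. C (deriv (deriv f)) l) * sqrt ((M / pi)\<^sup>2))"
    proof (intro mult_left_mono add_mono sum_sqrt_mult_le)
      show "(\<Sum>l\<in>Ci. C de l) \<le> M\<^sup>2" unfolding M2(2)[symmetric]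
        by (intro sum_mono2 fin nonneg lbm)
      show "(\<Sum>l\<in>Ci. C E l) \<le> (M / pi)\<^sup>2"
        by (rule order_trans[OF _ sumE]) (intro sum_mono2 fin nonneg lbm)
    qed (auto simp: C_def intro: nonneg_d)
    also have "(\<Sum>l\<in>Ci. C (deriv f) l) = (\<Sum>k\<in>Ei. n1 k)"
      unfolding n1_def by (rule transfer) (rule C2_ivl_integrals)
    also have "(\<Sum>l\<in>Ci. C (deriv (deriv f)) l) = (\<Sum>k\<in>Ei. n2 k)"
      unfolding n2_def by (rule transfer) (rule C2_ivl_integrals)
    also have "(eps N)\<^sup>2 / 8 * (2 * (sqrt (\<Sum>k\<in>Ei. n1 k) * sqrt (M\<^sup>2)) + sqrt (\<Sum>k\<in>Ei. n2 k) * sqrt ((M / pi)\<^sup>2))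
      = (a + b) / 4 * M"
    proof -
      have e4: "sqrt (eps N ^ 4) = (eps N)\<^sup>2"
        using real_sqrt_abs[of "(eps N)\<^sup>2"] by (simp add: power_mult[symmetric])
      have "sqrt (4 * pi\<^sup>2) = 2 * pi" using real_sqrt_mult[of 4 "pi\<^sup>2"] by simp
      then show ?thesis unfolding rM a_def b_def real_sqrt_mult real_sqrt_divide e4
        by (simp add: field_simps)
    qed
    finally show ?thesis .
  qed
  have absB: "\<bar>B\<bar> \<le> (c + d) / 4 * M + sqrt (\<Sum>k\<in>Ei. (h k / pi)\<^sup>2 * n0 k) * M"
  proof -
    have h4: "(h k)\<^sup>2 * sqrt z = sqrt (h k ^ 4 * z)" for k z
      using real_sqrt_abs[of "(h k)\<^sup>2"] by (simp add: power_mult[symmetric] real_sqrt_mult)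
    have "\<bar>B\<bar> \<le> (\<Sum>k\<in>Ei. (h k)\<^sup>2 / 8 * (2 * (sqrt (n1 k) * sqrt (h k * (s k)\<^sup>2)) + sqrt (n2 k) * sqrt (T W k))
       + sqrt ((h k / pi)\<^sup>2 * n0 k) * sqrt (T de k))"
      unfolding B_def n0_def n1_def n2_def
      by (rule order_trans[OF sum_abs], rule sum_mono, rule trap_elem) (simp add: Ei_def)
    also have "\<dots> = (\<Sum>k\<in>Ei. 1 / 4 * (sqrt (h k ^ 4 * n1 k) * sqrt (h k * (s k)\<^sup>2))
        + 1 / 8 * (sqrt (h k ^ 4 * n2 k) * sqrt (T W k)) + sqrt ((h k / pi)\<^sup>2 * n0 k) * sqrt (T de k))"
      unfolding h4[symmetric] by (intro sum.cong refl) (simp add: algebra_simps)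
    also have "\<dots> = 1 / 4 * (\<Sum>k\<in>Ei. sqrt (h k ^ 4 * n1 k) * sqrt (h k * (s k)\<^sup>2))
        + 1 / 8 * (\<Sum>k\<in>Ei. sqrt (h k ^ 4 * n2 k) * sqrt (T W k))
        + (\<Sum>k\<in>Ei. sqrt ((h k / pi)\<^sup>2 * n0 k) * sqrt (T de k))"
      by (simp only: sum_distrib_left[symmetric] sum.distrib)
    also have "\<dots> \<le> 1 / 4 * (sqrt (\<Sum>k\<in>Ei. h k ^ 4 * n1 k) * sqrt (M\<^sup>2))
        + 1 / 8 * (sqrt (\<Sum>k\<in>Ei. h k ^ 4 * n2 k) * sqrt ((M / pi)\<^sup>2))
        + sqrt (\<Sum>k\<in>Ei. (h k / pi)\<^sup>2 * n0 k) * sqrt (M\<^sup>2)"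
    proof (intro add_mono mult_left_mono sum_sqrt_mult_le)
      show "(\<Sum>k\<in>Ei. h k * (s k)\<^sup>2) \<le> M\<^sup>2"
        by (rule order_trans[OF _ sumhs]) (use h0 in \<open>intro sum_mono2 fin mult_nonneg_nonneg; simp add: less_imp_le\<close>)
      show "(\<Sum>k\<in>Ei. T W k) \<le> (M / pi)\<^sup>2"
        by (rule order_trans[OF _ sumW]) (intro sum_mono2 fin nonneg lbm)
      show "(\<Sum>k\<in>Ei. T de k) \<le> M\<^sup>2" unfolding M2(1)[symmetric]
        by (intro sum_mono2 fin nonneg lbm)
    qed (use h0 n in \<open>auto simp: T_def intro!: nonneg_d mult_nonneg_nonneg intro: less_imp_le\<close>)
    also have "\<dots> = (c + d) / 4 * M + sqrt (\<Sum>k\<in>Ei. (h k / pi)\<^sup>2 * n0 k) * M"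
    proof -
      have "sqrt (4 * pi\<^sup>2) = 2 * pi" using real_sqrt_mult[of 4 "pi\<^sup>2"] by simp
      then show ?thesis unfolding rM c_def d_def real_sqrt_mult real_sqrt_divide
        by (simp add: field_simps)
    qed
    finally show ?thesis .
  qed
  have df: "deriv f (x + 1) = deriv f x" "deriv (deriv f) (x + 1) = deriv (deriv f) x" for x
    using deriv_periodic[of f 1] deriv_periodic[of "deriv f" 1] f_per by auto
  have per: "elem_len X (k + int K) = elem_len X k" "L2_norm (element X (k + int K)) f = L2_norm (element X k) f"
    "L2_norm (element X (k + int K)) (deriv f) = L2_norm (element X k) (deriv f)"
    "L2_norm (element X (k + int K)) (deriv (deriv f)) = L2_norm (element X k) (deriv (deriv f))" for k
  proof -
    have X: "X (k + int K) = X k + 1" "X (k + int K - 1) = X (k - 1) + 1"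
      using T1(2)[of k] T1(2)[of "k - 1"] by (simp_all add: algebra_simps)
    show "elem_len X (k + int K) = elem_len X k" "L2_norm (element X (k + int K)) f = L2_norm (element X k) f"
      "L2_norm (element X (k + int K)) (deriv f) = L2_norm (element X k) (deriv f)"
      "L2_norm (element X (k + int K)) (deriv (deriv f)) = L2_norm (element X k) (deriv (deriv f))"
      unfolding element_def elem_len_def X using f_per df by (simp_all add: L2_norm_shift)
  qed
  have norms: "(L2_norm (element X k) f)\<^sup>2 = n0 k" "(L2_norm (element X k) (deriv f))\<^sup>2 = n1 k"
    "(L2_norm (element X k) (deriv (deriv f)))\<^sup>2 = n2 k" if "k \<in> Ei" for k
    using C2_ivl_integrals[OF C2_element[of k]] that
    by (auto simp: Ei_def element_def n0_def n1_def n2_def T_def)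
  have eta_f: "eta_f N f La Ra K X = sqrt (\<Sum>k\<in>Ei. (h k / pi)\<^sup>2 * n0 k)"
  proof -
    have "eta_f N f La Ra K X = sqrt (\<Sum>k\<in>Ei. (elem_len X k)\<^sup>2 / pi\<^sup>2 * (L2_norm (element X k) f)\<^sup>2)"
      unfolding eta_f_def Ei_def P2_def by (subst sum_estimator_period[OF k0(1)]) (simp_all add: per)
    also have "(\<Sum>k\<in>Ei. (elem_len X k)\<^sup>2 / pi\<^sup>2 * (L2_norm (element X k) f)\<^sup>2) = (\<Sum>k\<in>Ei. (h k / pi)\<^sup>2 * n0 k)"
      by (intro sum.cong) (auto simp: norms elem_len_def h_def power_divide)
    finally show ?thesis .
  qed
  have eta_q: "eta_q N f La Ra K X = sqrt (a\<^sup>2 + b\<^sup>2 + c\<^sup>2 + d\<^sup>2)"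
  proof -
    have "eta_q N f La Ra K X = sqrt (\<Sum>k\<in>Ei.
     (eps N ^ 4 + elem_len X k ^ 4) * (L2_norm (element X k) (deriv f))\<^sup>2
     + (eps N ^ 4 + elem_len X k ^ 4) / (4 * pi\<^sup>2) * (L2_norm (element X k) (deriv (deriv f)))\<^sup>2)"
      unfolding eta_q_def Ei_def P2_def by (subst sum_estimator_period[OF k0(1)]) (simp_all add: per)
    also have "(\<Sum>k\<in>Ei. (eps N ^ 4 + elem_len X k ^ 4) * (L2_norm (element X k) (deriv f))\<^sup>2
     + (eps N ^ 4 + elem_len X k ^ 4) / (4 * pi\<^sup>2) * (L2_norm (element X k) (deriv (deriv f)))\<^sup>2)
     = (\<Sum>k\<in>Ei. eps N ^ 4 * n1 k + eps N ^ 4 / (4 * pi\<^sup>2) * n2 k + h k ^ 4 * n1 k + 1 / (4 * pi\<^sup>2) * (h k ^ 4 * n2 k))"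
      by (intro sum.cong) (auto simp: norms elem_len_def h_def algebra_simps add_divide_distrib)
    also have "\<dots> = eps N ^ 4 * (\<Sum>k\<in>Ei. n1 k) + eps N ^ 4 / (4 * pi\<^sup>2) * (\<Sum>k\<in>Ei. n2 k)
        + (\<Sum>k\<in>Ei. h k ^ 4 * n1 k) + 1 / (4 * pi\<^sup>2) * (\<Sum>k\<in>Ei. h k ^ 4 * n2 k)"
      by (simp only: sum.distrib sum_distrib_left)
    also have "\<dots> = a\<^sup>2 + b\<^sup>2 + c\<^sup>2 + d\<^sup>2"
      unfolding a_def b_def c_def d_def using n h0
      by (simp add: sum_nonneg less_imp_le)
    finally show ?thesis .
  qed
  \<comment> \<open>Each of the four terms is at most the root of the sum of their squares; the
    factor 4 is absorbed by the 1/4 in front of the quadrature errors.\<close>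
  have le: "a + b + c + d \<le> 4 * eta_q N f La Ra K X"
  proof -
    have "z \<le> eta_q N f La Ra K X" if "z\<^sup>2 \<le> a\<^sup>2 + b\<^sup>2 + c\<^sup>2 + d\<^sup>2" for z
      unfolding eta_q using that by (rule real_le_rsqrt)
    from this[of a] this[of b] this[of c] this[of d] show ?thesis by simp
  qed
  have "\<bar>inner_eps N (nodal N f) e - inner_h X f W\<bar> \<le> \<bar>A\<bar> + \<bar>B\<bar>"
    unfolding diff by (rule abs_triangle_ineq4)
  also have "\<dots> \<le> (a + b + c + d) / 4 * M + eta_f N f La Ra K X * M"
    using absA absB unfolding eta_f by (simp add: field_simps)
  also have "\<dots> \<le> eta_q N f La Ra K X * M + eta_f N f La Ra K X * M"
    using le M0 by (intro add_right_mono mult_right_mono) auto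
  finally show ?thesis
    unfolding M_def W_def w_def[abs_def] E_def de_def by (simp add: algebra_simps)
qed

end

section \<open>Coercivity and the error estimate\<close>

lemma Ck_on_Suc:
  assumes "Ck_on (Suc n) g S"
  shows "Ck_on n g S"
proof -
  obtain D :: "nat \<Rightarrow> real \<Rightarrow> real" where D: "D 0 = g"
    "\<And>j x. j < Suc n \<Longrightarrow> x \<in> S \<Longrightarrow> (D j has_real_derivative D (Suc j) x) (at x within S)"
    using assms unfolding Ck_on_def by blast
  have "continuous_on S (D n)" by (rule DERIV_continuous_on) (rule D(2), simp_all)
  then show ?thesis unfolding Ck_on_def using D by (intro exI[of _ D]) auto
qed

lemma Ck_on_3_pos_derivatives:
  assumes "Ck_on 3 \<phi> {0<..}" "0 < t"
  shows "(\<phi> has_real_derivative deriv \<phi> t) (at t)"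
    "(deriv \<phi> has_real_derivative deriv (deriv \<phi>) t) (at t)" "isCont (deriv (deriv \<phi>)) t"
proof -
  have "Ck_on 2 \<phi> {0<..}" using Ck_on_Suc[of 2] assms(1) by (simp add: eval_nat_numeral)
  then have "C2_ivl \<phi> (t / 2) (2 * t)" by (rule Ck_on_2_imp_C2_ivl) (use assms(2) in auto)
  then show "(\<phi> has_real_derivative deriv \<phi> t) (at t)"
    "(deriv \<phi> has_real_derivative deriv (deriv \<phi>) t) (at t)" "isCont (deriv (deriv \<phi>)) t"
    using C2_ivl_interior[of \<phi> "t / 2" "2 * t" t] assms(2) by auto
qed

text \<open>The tangent inequalities at x and at y are added.\<close>

lemma concave_on_deriv_antimono:
  assumes conc: "concave_on {r<..} \<phi>" and d: "\<And>t. r < t \<Longrightarrow> (\<phi> has_real_derivative \<phi>' t) (at t)"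
    and xy: "r < x" "x < y"
  shows "\<phi>' y \<le> \<phi>' x"
proof -
  have conv: "convex_on {r<..} (\<lambda>t. - \<phi> t)" using conc by (simp add: concave_on_def)
  have tangent: "- \<phi> z - (- \<phi> t) \<ge> - \<phi>' t * (z - t)" if "r < t" "r < z" for t z
  proof (rule convex_on_imp_above_tangent[OF conv])
    show "((\<lambda>t. - \<phi> t) has_real_derivative - \<phi>' t) (at t within {r<..})"
      by (rule DERIV_subset[of _ _ _ UNIV]) (auto intro: DERIV_minus d that)
  qed (use that in \<open>auto simp: interior_open\<close>)
  have "(\<phi>' y - \<phi>' x) * (y - x) \<le> 0"
    using tangent[of x y] tangent[of y x] xy by (simp add: algebra_simps)
  then show ?thesis using xy by (simp add: mult_le_0_iff)
qed

text \<open>The end point r is included by continuity of the second derivative: gradients of at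
  least r/2 give second-neighbour arguments that may equal r.\<close>

lemma concave_on_second_derivative_nonpos:
  assumes conc: "concave_on {r<..} \<phi>"
    and d: "\<And>t. r \<le> t \<Longrightarrow> (\<phi> has_real_derivative deriv \<phi> t) (at t)"
      "\<And>t. r \<le> t \<Longrightarrow> (deriv \<phi> has_real_derivative deriv (deriv \<phi>) t) (at t)"
    and cont: "isCont (deriv (deriv \<phi>)) r" and t: "r \<le> t"
  shows "deriv (deriv \<phi>) t \<le> 0"
proof -
  have pos: "deriv (deriv \<phi>) s \<le> 0" if s: "r < s" for s
  proof (rule ccontr)
    assume "\<not> deriv (deriv \<phi>) s \<le> 0"
    then obtain \<delta> where \<delta>: "0 < \<delta>" "\<And>h. 0 < h \<Longrightarrow> h < \<delta> \<Longrightarrow> deriv \<phi> s < deriv \<phi> (s + h)"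
      using DERIV_pos_inc_right[OF d(2)[of s]] s by auto
    have "deriv \<phi> (s + \<delta> / 2) \<le> deriv \<phi> s"
      using s \<delta>(1) by (intro concave_on_deriv_antimono[OF conc d(1)]) auto
    with \<delta>(2)[of "\<delta> / 2"] \<delta>(1) show False by simp
  qed
  show ?thesis
  proof (cases "t = r")
    case True
    have "(deriv (deriv \<phi>) \<longlongrightarrow> deriv (deriv \<phi>) r) (at_right r)"
      using cont by (simp add: isCont_def filterlim_at_split)
    then have "deriv (deriv \<phi>) r \<le> 0"
      by (rule tendsto_upperbound) (auto simp: eventually_at_filter pos)
    with True show ?thesis by simp
  next
    case False
    with t pos show ?thesis by simp
  qed
qed

text \<open>The difference quotient at s exceeds D - \<kappa> near s. The form with an eventually
  valid d allows finitely many points s to share one radius.\<close>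

lemma derivative_monotone_bound:
  assumes "(g has_real_derivative D) (at s)" "0 < \<kappa>"
  shows "\<forall>\<^sub>F d in at_right 0. \<forall>t. \<bar>t - s\<bar> < d \<longrightarrow> (D - \<kappa>) * (t - s)\<^sup>2 \<le> (g t - g s) * (t - s)"
proof -
  have "((\<lambda>t. (g t - g s) / (t - s)) \<longlongrightarrow> D) (at s)"
    using assms(1) by (simp add: has_field_derivative_iff)
  then have "\<forall>\<^sub>F t in at s. D - \<kappa> < (g t - g s) / (t - s)"
    using assms(2) by (intro order_tendstoD) auto
  then obtain \<delta> where \<delta>: "0 < \<delta>" "\<And>t. t \<noteq> s \<Longrightarrow> \<bar>t - s\<bar> < \<delta> \<Longrightarrow> D - \<kappa> < (g t - g s) / (t - s)"
    by (auto simp: eventually_at dist_real_def)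
  have "(D - \<kappa>) * (t - s)\<^sup>2 \<le> (g t - g s) * (t - s)" if t: "\<bar>t - s\<bar> < \<delta>" for t
  proof (cases "t = s")
    case False
    have "(D - \<kappa>) * (t - s)\<^sup>2 \<le> (g t - g s) / (t - s) * (t - s)\<^sup>2"
      using \<delta>(2)[OF False t] by (intro mult_right_mono) auto
    also have "\<dots> = (g t - g s) * (t - s)" using False by (simp add: power2_eq_square)
    finally show ?thesis .
  qed simp
  then show ?thesis
    unfolding eventually_at_right_field using \<delta>(1) by (intro exI[of _ \<delta>]) auto
qed

lemma lbm_integral_AE_nonneg:
  assumes g: "loc_bounded_meas g" and AE: "AE x in lborel. x \<in> {a..b} \<longrightarrow> 0 \<le> g x"
  shows "0 \<le> integral {a..b} g"
proof -
  have "integral {a..b} g = (LINT x:{a..b}|lborel. g x)"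
    by (rule set_borel_integral_eq_integral(2)[symmetric]) (rule lbm_set_integrable[OF g, of _ a b], auto)
  also have "0 \<le> \<dots>"
    unfolding set_lebesgue_integral_def using AE
    by (intro integral_nonneg_AE) (auto simp: indicator_def elim!: eventually_mono)
  finally show ?thesis .
qed

section \<open>Lower bound for the linearized lattice operator, and norms of the lattice
  error\<close>

context qc_grid
begin

lemma period_cells_range:
  assumes "\<And>l. P (l + int (2 * N)) = P l"
  shows "P l \<in> P ` period_cells N"
proof -
  have "period_cells N = {- int N + 1..- int N + int (2 * N)}" by (auto simp: period_cells_def)
  then show ?thesis using int_period_range[of P "2 * N" l "- int N", OF assms] N_pos by simp
qed

lemma integral_slope_square_unit:
  assumes e: "\<And>l. e (l + 2 * int N) = e l"
  shows "integral {0..1} (\<lambda>x. (lat.slope e (lat.idx x))\<^sup>2) = eps N * (\<Sum>l\<in>period_cells N. (bdiff N e l)\<^sup>2)"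
proof -
  have "bdiff N e (l + int (2 * N)) = bdiff N e l" for l
    using bdiff_period[of e 0] e by simp
  then have "(\<Sum>l\<in>period_cells N. (bdiff N e (l + 0))\<^sup>2) = (\<Sum>l\<in>{0 + 1..0 + int (2 * N)}. (bdiff N e l)\<^sup>2)"
    by (intro sum_period_cells) simp
  moreover have "integral {0..1} (\<lambda>x. (lat.slope e (lat.idx x))\<^sup>2)
      = (\<Sum>l\<in>{0 + 1..0 + int (2 * N)}. eps N * (bdiff N e l)\<^sup>2)"
    unfolding integral_slope_square[symmetric]
    by (rule integral_unit_lat) (intro lbm_integrable_on lbm_power2 lat.lbm_idx)
  ultimately show ?thesis by (simp add: sum_distrib_left)
qed

text \<open>The second-neighbour coefficient is nonpositive, so replacing (x + y)^2 by its upper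
  bound 2 x^2 + 2 y^2 only lowers the sum. After an index shift each squared difference carries the
  three terms of its \<open>A_coeff\<close>. The linearization error \<kappa> enters once from the
  nearest neighbours and twice from each of the two second-neighbour bonds over a cell, together 5
  times.\<close>

lemma coercivity:
  assumes z: "\<And>l. z (l + 2 * int N) = F + z l" and e: "\<And>l. e (l + 2 * int N) = e l"
    and neg: "\<And>l. \<psi>' (bdiff N z (l - 1) + bdiff N z l) \<le> 0" and \<kappa>: "0 < \<kappa>"
    and A: "\<And>l. A \<le> \<psi>' (bdiff N z l) + 2 * \<psi>' (bdiff N z (l - 1) + bdiff N z l)
      + 2 * \<psi>' (bdiff N z l + bdiff N z (l + 1))"
    and mono: "\<And>l. (\<psi>' (bdiff N z l) - \<kappa>) * (bdiff N e l)\<^sup>2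
        \<le> (\<psi> (bdiff N z l + bdiff N e l) - \<psi> (bdiff N z l)) * bdiff N e l"
      "\<And>l. (\<psi>' (bdiff N z (l - 1) + bdiff N z l) - \<kappa>) * (bdiff N e (l - 1) + bdiff N e l)\<^sup>2
        \<le> (\<psi> ((bdiff N z (l - 1) + bdiff N z l) + (bdiff N e (l - 1) + bdiff N e l))
           - \<psi> (bdiff N z (l - 1) + bdiff N z l)) * (bdiff N e (l - 1) + bdiff N e l)"
  shows "(A - 5 * \<kappa>) * (eps N * (\<Sum>l\<in>period_cells N. (bdiff N e l)\<^sup>2))
    \<le> stress_sum \<psi> (\<lambda>l. z l + e l) e - stress_sum \<psi> z e"
proof -
  define s a where "s l = bdiff N z (l - 1) + bdiff N z l" and "a l = bdiff N e l" for l
  define q where "q l = 2 * (\<psi>' (s l) - \<kappa>)" for l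
  have per: "bdiff N z (l + int (2 * N)) = bdiff N z l" "a (l + int (2 * N)) = a l" for l
    unfolding a_def using bdiff_period[of z F l, OF z] bdiff_period[of e 0 l] e by simp_all
  have per1: "s (l + int (2 * N)) = s l" "a (l - 1 + int (2 * N)) = a (l - 1)" for l
    using per(1)[of l] per(1)[of "l - 1"] per(2)[of "l - 1"] by (simp_all add: s_def algebra_simps)
  \<comment> \<open>Moves the second-neighbour coefficient from its left cell to index l, so that
    both bonds over cell l act on the same square.\<close>
  have shift: "(\<Sum>l\<in>period_cells N. q l * (a (l - 1))\<^sup>2) = (\<Sum>l\<in>period_cells N. q (l + 1) * (a l)\<^sup>2)"
  proof -
    define P where "P l = q l * (a (l - 1))\<^sup>2" for l
    have "P (l + int (2 * N)) = P l" for l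
      using per1[of l] by (simp add: P_def q_def algebra_simps)
    then have "(\<Sum>l\<in>period_cells N. P (l + 0)) = (\<Sum>l\<in>period_cells N. P (l + 1))"
      by (simp only: sum_period_cells)
    then show ?thesis by (simp add: P_def)
  qed
  have "(A - 5 * \<kappa>) * (\<Sum>l\<in>period_cells N. (a l)\<^sup>2)
    \<le> (\<Sum>l\<in>period_cells N. ((\<psi>' (bdiff N z l) - \<kappa>) + q l + q (l + 1)) * (a l)\<^sup>2)"
    unfolding sum_distrib_left
  proof (rule sum_mono, rule mult_right_mono)
    fix l
    have "s (l + 1) = bdiff N z l + bdiff N z (l + 1)" by (simp add: s_def)
    then show "A - 5 * \<kappa> \<le> \<psi>' (bdiff N z l) - \<kappa> + q l + q (l + 1)"
      using A[of l] by (simp add: q_def s_def)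
  qed simp
  also have "\<dots> = (\<Sum>l\<in>period_cells N. (\<psi>' (bdiff N z l) - \<kappa>) * (a l)\<^sup>2 + q l * (a l)\<^sup>2)
      + (\<Sum>l\<in>period_cells N. q l * (a (l - 1))\<^sup>2)"
    unfolding shift by (simp add: sum.distrib distrib_right)
  also have "\<dots> = (\<Sum>l\<in>period_cells N. (\<psi>' (bdiff N z l) - \<kappa>) * (a l)\<^sup>2 + q l * ((a l)\<^sup>2 + (a (l - 1))\<^sup>2))"
    by (simp add: sum.distrib distrib_left)
  also have "\<dots> \<le> (\<Sum>l\<in>period_cells N. (\<psi>' (bdiff N z l) - \<kappa>) * (a l)\<^sup>2 + (\<psi>' (s l) - \<kappa>) * (a (l - 1) + a l)\<^sup>2)"
  proof (rule sum_mono, rule add_left_mono)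
    fix l
    have "(a (l - 1) + a l)\<^sup>2 \<le> 2 * ((a l)\<^sup>2 + (a (l - 1))\<^sup>2)"
      using zero_le_power2[of "a (l - 1) - a l"] by (simp add: power2_eq_square algebra_simps)
    moreover have "\<psi>' (s l) - \<kappa> \<le> 0" using neg[of l] \<kappa> by (simp add: s_def)
    ultimately show "q l * ((a l)\<^sup>2 + (a (l - 1))\<^sup>2) \<le> (\<psi>' (s l) - \<kappa>) * (a (l - 1) + a l)\<^sup>2"
      using mult_left_mono_neg[of "(a (l - 1) + a l)\<^sup>2" "2 * ((a l)\<^sup>2 + (a (l - 1))\<^sup>2)" "\<psi>' (s l) - \<kappa>"]
      by (simp add: q_def algebra_simps)
  qed
  also have "\<dots> \<le> (\<Sum>l\<in>period_cells N. (\<psi> (bdiff N z l + a l) - \<psi> (bdiff N z l)) * a l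
      + (\<psi> (s l + (a (l - 1) + a l)) - \<psi> (s l)) * (a (l - 1) + a l))"
    unfolding s_def a_def by (intro sum_mono add_mono mono)
  finally have main: "(A - 5 * \<kappa>) * (\<Sum>l\<in>period_cells N. (a l)\<^sup>2) \<le> \<dots>" .
  have "stress_sum \<psi> (\<lambda>l. z l + e l) e - stress_sum \<psi> z e
    = eps N * (\<Sum>l\<in>period_cells N. (\<psi> (bdiff N z l + a l) - \<psi> (bdiff N z l)) * a l
      + (\<psi> (s l + (a (l - 1) + a l)) - \<psi> (s l)) * (a (l - 1) + a l))"
    unfolding stress_sum_def right_diff_distrib[symmetric] sum_subtractf[symmetric]
    using bdiff_linear[of N z 1 e] by (simp add: s_def a_def algebra_simps)
  then show ?thesis
    using mult_left_mono[OF main, of "eps N"] eps_pos by (simp add: a_def mult.left_commute)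
qed

text \<open>A lattice difference of the error is the mean over a cell of the difference of the two
  derivatives, hence bounded by its essential supremum. This passes from y itself, which may have
  kinks inside the cell, to its lattice values.\<close>

lemma Linf_bound_bdiff:
  assumes y: "y = pw_affine X (\<lambda>k. y (X k))" and l: "l \<in> period_cells N"
    and le: "Linf_norm Omega (\<lambda>x. deriv (lattice_interp N z) x - deriv y x) \<le> ereal \<tau>"
  shows "\<bar>bdiff N (\<lambda>l. z l - nodal N y l) l\<bar> \<le> \<tau>"
proof -
  define v where "v k = y (X k)" for k
  have yv: "y = pw_affine X v" unfolding v_def[abs_def] by (rule y)
  define u where "u x = lat.slope z (lat.idx x) - mesh.slope v (mesh.idx x)" for x
  have u: "loc_bounded_meas u" unfolding u_def[abs_def] by (intro lbm_diff lat.lbm_idx mesh.lbm_idx)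
  have "AE x in restrict_space lborel Omega.
      ereal \<bar>deriv (lattice_interp N z) x - deriv y x\<bar>
        \<le> esssup (restrict_space lborel Omega) (\<lambda>x. ereal \<bar>deriv (lattice_interp N z) x - deriv y x\<bar>)"
    by (rule esssup_AE)
  then have "AE x in restrict_space lborel Omega. \<bar>deriv (lattice_interp N z) x - deriv y x\<bar> \<le> \<tau>"
    by (rule eventually_mono) (use le in \<open>auto simp: Linf_norm_def dest: order_trans\<close>)
  then have 1: "AE x in lborel. x \<in> Omega \<longrightarrow> \<bar>deriv (lattice_interp N z) x - deriv y x\<bar> \<le> \<tau>"
    by (subst (asm) AE_restrict_space_iff) (auto simp: Omega_def)
  have "range L \<union> range X \<in> null_sets lborel"
    by (intro countable_imp_null_set_lborel countable_Un) auto
  then have 2: "AE x in lborel. x \<notin> range L \<union> range X" by (rule AE_not_in)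
  have half: "L (- int N) = - 1 / 2" "L (int N) = 1 / 2" using eps_period by auto
  have "L (- int N) \<le> L (l - 1)" "L l \<le> L (int N)"
  proof -
    have "- int N \<le> l - 1" "l \<le> int N" using l by (auto simp: period_cells_def)
    then show "L (- int N) \<le> L (l - 1)" "L l \<le> L (int N)" by (simp_all only: lat.grid_le_iff)
  qed
  then have sub: "{L (l - 1)..L l} \<subseteq> Omega" unfolding half Omega_def by auto
  have AE: "AE x in lborel. x \<in> {L (l - 1)..L l} \<longrightarrow> \<bar>u x\<bar> \<le> \<tau>"
    using 1 2
  proof eventually_elim
    case (elim x)
    then have "deriv (lattice_interp N z) x = lat.slope z (lat.idx x)" "deriv y x = mesh.slope v (mesh.idx x)"
      unfolding lattice_interp_def yv by (auto intro!: lat.deriv_pw_affine mesh.deriv_pw_affine)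
    then show ?case using elim(1) sub by (auto simp: u_def)
  qed
  have "0 \<le> integral {L (l - 1)..L l} (\<lambda>x. \<tau> + u x)" "0 \<le> integral {L (l - 1)..L l} (\<lambda>x. \<tau> - u x)"
    by (rule lbm_integral_AE_nonneg; use AE in \<open>auto intro!: lbm_intros u elim!: eventually_mono\<close>)+
  moreover have "((\<lambda>x. u x) has_integral ((z l - z (l - 1)) - (y (L l) - y (L (l - 1))))) {L (l - 1)..L l}"
  proof -
    have le: "L (l - 1) \<le> L l" using lat.grid_less[of l] by linarith
    have "((\<lambda>x. lat.slope z (lat.idx x)) has_integral (z l - z (l - 1))) {L (l - 1)..L l}"
      using lat.has_integral_slope[OF le, of z] by (simp only: lat.pw_affine_node)
    moreover have "((\<lambda>x. mesh.slope v (mesh.idx x)) has_integral (y (L l) - y (L (l - 1)))) {L (l - 1)..L l}"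
      unfolding yv by (rule mesh.has_integral_slope[OF le])
    ultimately show ?thesis unfolding u_def by (rule has_integral_diff)
  qed
  moreover have "(z l - z (l - 1)) - (y (L l) - y (L (l - 1))) = eps N * bdiff N (\<lambda>l. z l - nodal N y l) l"
    using eps_pos by (simp add: bdiff_def nodal_def)
  ultimately have I: "(u has_integral (eps N * bdiff N (\<lambda>l. z l - nodal N y l) l)) {L (l - 1)..L l}"
    and nonneg: "0 \<le> integral {L (l - 1)..L l} (\<lambda>x. \<tau> + u x)" "0 \<le> integral {L (l - 1)..L l} (\<lambda>x. \<tau> - u x)"
    by simp_all
  have c: "((\<lambda>x. \<tau>) has_integral eps N * \<tau>) {L (l - 1)..L l}"
    using has_integral_const_real[of \<tau> "L (l - 1)" "L l"] lat.grid_less[of l] L_diff[of l] by simp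
  have "0 \<le> eps N * \<tau> + eps N * bdiff N (\<lambda>l. z l - nodal N y l) l"
    "0 \<le> eps N * \<tau> - eps N * bdiff N (\<lambda>l. z l - nodal N y l) l"
    using nonneg integral_unique[OF has_integral_add[OF c I]] integral_unique[OF has_integral_diff[OF c I]] by simp_all
  then have "0 \<le> eps N * (\<tau> + bdiff N (\<lambda>l. z l - nodal N y l) l)"
    "0 \<le> eps N * (\<tau> - bdiff N (\<lambda>l. z l - nodal N y l) l)" by (simp_all add: algebra_simps)
  then show ?thesis using eps_pos by (auto simp: zero_le_mult_iff abs_le_iff)
qed

lemma L2_norm_lattice_diff:
  assumes e: "\<And>l. z l - nodal N y l = e l" "\<And>l. e (l + 2 * int N) = e l"
  shows "L2_norm Omega (\<lambda>x. deriv (lattice_interp N z) x - deriv (I_eps N y) x)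
    = sqrt (integral {0..1} (\<lambda>x. (lat.slope e (lat.idx x))\<^sup>2))"
proof -
  define g where "g x = (lat.slope e (lat.idx x))\<^sup>2" for x
  have g: "loc_bounded_meas g" unfolding g_def[abs_def] by (intro lbm_power2 lat.lbm_idx)
  have slope: "lat.slope e l = lat.slope z l - lat.slope (nodal N y) l" for l
    by (simp add: lat_slope bdiff_def e(1)[symmetric] diff_divide_distrib)
  have "(LINT x:Omega|lborel. (deriv (lattice_interp N z) x - deriv (I_eps N y) x)\<^sup>2) = (LINT x:Omega|lborel. g x)"
    unfolding set_lebesgue_integral_def
  proof (rule integral_discrete_difference[where X = "range L"])
    fix x assume "x \<notin> range L"
    then show "indicator Omega x *\<^sub>R (deriv (lattice_interp N z) x - deriv (I_eps N y) x)\<^sup>2 = indicator Omega x *\<^sub>R g x"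
      unfolding lattice_interp_def I_eps_def g_def by (simp add: lat.deriv_pw_affine slope)
  qed auto
  also have "\<dots> = integral {- 1 / 2..1 / 2} (\<lambda>x. indicator Omega x * g x)"
    by (rule lbm_LINT[OF g]) (auto simp: Omega_def)
  also have "\<dots> = integral {- 1 / 2..- 1 / 2 + 1} g"
    by (rule integral_cong[THEN trans]) (auto simp: Omega_def)
  also have "\<dots> = integral {0..1} g"
  proof (rule integral_unit_periodic[OF g])
    fix x
    have "lat.slope e (l + int (2 * N)) = lat.slope e l" for l
      by (rule lat.slope_period[of _ 0]) (simp add: e)
    then show "g (x + 1) = g x" using lat.idx_shift[of x 1] by (simp add: g_def)
  qed
  finally show ?thesis unfolding L2_norm_def g_def[abs_def] by simp
qed

end

lemma eta_nonneg: "0 \<le> eta N \<phi> La Ra K X y"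
  unfolding eta_def eta_elem_sq_def
  by (intro real_sqrt_ge_zero mult_nonneg_nonneg sum_nonneg add_nonneg_nonneg) auto

lemma eta_f_nonneg: "0 \<le> eta_f N f La Ra K X"
  unfolding eta_f_def by (intro real_sqrt_ge_zero sum_nonneg mult_nonneg_nonneg divide_nonneg_nonneg) auto

lemma eta_q_nonneg: "0 \<le> eta_q N f La Ra K X"
  unfolding eta_q_def
  by (intro real_sqrt_ge_zero sum_nonneg add_nonneg_nonneg mult_nonneg_nonneg divide_nonneg_nonneg zero_le_even_power) auto

theorem theorem7:
  fixes N K :: nat and F r La Ra :: real and \<phi> f :: "real \<Rightarrow> real"
    and X :: "int \<Rightarrow> real" and y_qc :: "real \<Rightarrow> real"
  assumes "0 < N" and "0 < F"
    and "Ck_on 3 \<phi> {0<..}"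
    and "0 < r" and "convex_on {0<..<r} \<phi>" and "concave_on {r<..} \<phi>"
    and "qc_mesh N La Ra K X"
    and "continuous_on UNIV f" and "\<And>x. f (x + 1) = f x"
    and "Ck_on 2 f (Omega_c_tilde N La Ra \<inter> {- 1 / 2..1 / 2})"
    and "1 / 2 \<notin> range X \<Longrightarrow> \<exists>\<delta>>0. Ck_on 2 f {1 / 2 - \<delta><..<1 / 2 + \<delta>}"
    and "local_minimizer (E_qc N F \<phi> f La Ra X) (Y_h_pos F X) y_qc"
    and "r / 2 \<le> Min (bdiff N (nodal N y_qc) ` period_cells N)"
    and "0 < A_star N \<phi> (nodal N y_qc)"
  shows "\<exists>\<tau>\<^sub>0>0. \<forall>\<tau>. 0 < \<tau> \<and> \<tau> \<le> \<tau>\<^sub>0 \<longrightarrow>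
    (\<forall>y_a. local_minimizer (E_a N F \<phi> f) (Y_eps_pos N F) y_a \<and>
       Linf_norm Omega (\<lambda>x. deriv (lattice_interp N y_a) x - deriv y_qc x) \<le> ereal \<tau> \<longrightarrow>
       L2_norm Omega (\<lambda>x. deriv (lattice_interp N y_a) x - deriv (I_eps N y_qc) x)
         \<le> 2 / A_star N \<phi> (nodal N y_qc)
             * (eta N \<phi> La Ra K X y_qc + eta_f N f La Ra K X + eta_q N f La Ra K X))"
proof -
  have "qc_force N La Ra K X f"
    unfolding qc_force_def qc_grid_def qc_grid_axioms_def qc_force_axioms_def
    by (intro conjI allI impI assms)
  then interpret qc_force N La Ra K X f .
  define z where "z = nodal N y_qc"
  define A where "A = A_star N \<phi> z"
  \<comment> \<open>Chosen so that A - 5 \<kappa> = A / 2, the origin of the factor 2 in the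
    estimate.\<close>
  define \<kappa> where "\<kappa> = A / 10"
  have A0: "0 < A" using assms(14) by (simp add: A_def z_def)
  then have \<kappa>0: "0 < \<kappa>" by (simp add: \<kappa>_def)
  note \<phi> = Ck_on_3_pos_derivatives[OF assms(3)]
  have "y_qc \<in> Y_h_pos F X" using assms(12) by (simp add: local_minimizer_def)
  note y = Y_h_pos_nodal[OF this]
  have zper: "z (l + 2 * int N) = F + z l" for l
    using y(2)[of "L l"] lat.grid_period[of l] by (simp add: z_def nodal_def)
  note bz = bdiff_period[of z F, OF zper]
  have finP: "finite (period_cells N)" "period_cells N \<noteq> {}"
    using assms(1) by (auto simp: period_cells_def)
  have zr: "r / 2 \<le> bdiff N z l" for l
    using period_cells_range[of "bdiff N z" l, OF bz] assms(13) finP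
    unfolding z_def by (meson Min_le finite_imageI order_trans)
  have pos: "0 < bdiff N z l" "r \<le> bdiff N z (l - 1) + bdiff N z l" for l
    using zr[of l] zr[of "l - 1"] assms(4) by linarith+
  have neg: "deriv (deriv \<phi>) (bdiff N z (l - 1) + bdiff N z l) \<le> 0" for l
    using assms(4) pos(2)[of l]
    by (intro concave_on_second_derivative_nonpos[OF assms(6)] \<phi>) auto
  have bz': "bdiff N z (l + int (2 * N) - 1) = bdiff N z (l - 1)" "bdiff N z (l + int (2 * N) + 1) = bdiff N z (l + 1)" for l
    using bz[of "l - 1"] bz[of "l + 1"] by (simp_all add: algebra_simps)
  have Acoeff: "A \<le> A_coeff N \<phi> z l" for l
  proof -
    have "A_coeff N \<phi> z l \<in> A_coeff N \<phi> z ` period_cells N"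
      by (rule period_cells_range) (simp only: A_coeff_def bz bz')
    then show ?thesis unfolding A_def A_star_def using finP by (intro Min_le) auto
  qed
  \<comment> \<open>All arguments at which the stress is linearized. The set is finite by
    periodicity, so one radius d0, determined by \<phi> and the quasicontinuum solution, serves them
    all.\<close>
  define S where "S = (bdiff N z ` period_cells N) \<union> ((\<lambda>l. bdiff N z (l - 1) + bdiff N z l) ` period_cells N)"
  have S: "bdiff N z l \<in> S" "bdiff N z (l - 1) + bdiff N z l \<in> S" for l
    using period_cells_range[of "bdiff N z" l, OF bz]
      period_cells_range[of "\<lambda>l. bdiff N z (l - 1) + bdiff N z l" l] bz bz' by (auto simp: S_def)
  have Spos: "0 < s" if "s \<in> S" for s
    using that pos assms(4) by (fastforce simp: S_def intro: less_le_trans)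
  have "\<forall>\<^sub>F d in at_right 0. \<forall>s\<in>S. \<forall>t. \<bar>t - s\<bar> < d \<longrightarrow>
      (deriv (deriv \<phi>) s - \<kappa>) * (t - s)\<^sup>2 \<le> (deriv \<phi> t - deriv \<phi> s) * (t - s)"
    using finP(1) Spos by (intro eventually_ball_finite ballI derivative_monotone_bound \<phi> \<kappa>0) (auto simp: S_def)
  then obtain d0 where d0: "0 < d0" "\<And>d s t. 0 < d \<Longrightarrow> d < d0 \<Longrightarrow> s \<in> S \<Longrightarrow> \<bar>t - s\<bar> < d \<Longrightarrow>
      (deriv (deriv \<phi>) s - \<kappa>) * (t - s)\<^sup>2 \<le> (deriv \<phi> t - deriv \<phi> s) * (t - s)"
    unfolding eventually_at_right_field by blast
  \<comment> \<open>Second-neighbour arguments change by up to twice the distance of the gradients,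
    and 2 d0/5 < 3 d0/5 < d0 leaves room for both strict inequalities required of the
    radius.\<close>
  define \<tau>0 where "\<tau>0 = d0 / 5"
  have mono: "(deriv (deriv \<phi>) s - \<kappa>) * h\<^sup>2 \<le> (deriv \<phi> (s + h) - deriv \<phi> s) * h"
    if "s \<in> S" "\<bar>h\<bar> \<le> 2 * \<tau>0" for s h
    using d0(2)[of "3 * \<tau>0" s "s + h"] d0(1) that by (simp add: \<tau>0_def)
  show ?thesis
  proof (intro exI[of _ \<tau>0] conjI allI impI)
    show "0 < \<tau>0" using d0 by (simp add: \<tau>0_def)
    fix \<tau> y_a
    assume \<tau>: "0 < \<tau> \<and> \<tau> \<le> \<tau>0" and a: "local_minimizer (E_a N F \<phi> f) (Y_eps_pos N F) y_a \<and>
       Linf_norm Omega (\<lambda>x. deriv (lattice_interp N y_a) x - deriv y_qc x) \<le> ereal \<tau>"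
    define e where "e l = y_a l - z l" for l
    have ya: "\<And>l. y_a (l + 2 * int N) = F + y_a l" "y_a 0 = 0"
      using a by (auto simp: local_minimizer_def Y_eps_pos_def Y_eps_def)
    have eper: "e (l + 2 * int N) = e l" for l by (simp add: e_def ya zper)
    have e0: "e 0 = 0" using ya y(3) by (simp add: e_def z_def nodal_def)
    have be: "bdiff N e (l + int (2 * N)) = bdiff N e l" for l
      using bdiff_period[of e 0] eper by simp
    have small: "\<bar>bdiff N e l\<bar> \<le> \<tau>0" for l
    proof -
      obtain l' where "l' \<in> period_cells N" "bdiff N e l = bdiff N e l'"
        using period_cells_range[of "bdiff N e" l, OF be] by blast
      then show ?thesis
        using Linf_bound_bdiff[OF y(1), of l' y_a \<tau>] a \<tau> unfolding e_def[abs_def] z_def by auto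
    qed
    define M where "M = sqrt (integral {0..1} (\<lambda>x. (lat.slope e (lat.idx x))\<^sup>2))"
    define R where "R = eta N \<phi> La Ra K X y_qc + eta_f N f La Ra K X + eta_q N f La Ra K X"
    have M2: "M\<^sup>2 = eps N * (\<Sum>l\<in>period_cells N. (bdiff N e l)\<^sup>2)"
      unfolding M_def integral_slope_square_unit[of e, OF eper] using eps_pos
      by (simp add: sum_nonneg)
    define w where "w k = pw_affine L e (X k)" for k
    define Q where "Q = (\<Sum>b\<in>bonds N. integral {L (fst b)..L (fst b + int (snd b))}
         (\<lambda>x. bond_stress (deriv \<phi>) (\<lambda>k. y_qc (X k)) b x * lat.slope e (lat.idx x)))"
    have stat_a: "stress_sum (deriv \<phi>) y_a e = inner_eps N (nodal N f) e"
      using a by (intro E_a_stationary[of \<phi> F f] \<phi> eper e0) auto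
    have stat_qc: "Q = inner_h X f (pw_affine X w)"
    proof -
      obtain k0 where k0: "X k0 = 0" by (rule unit_nodes)
      have "pw_affine L e (x + 1) = pw_affine L e x" for x
        using lat.pw_affine_period[of e 0 x] eper by simp
      then have wper: "w (k + int K) = w k" for k by (simp add: w_def T1)
      have "pw_affine X w 0 = w k0" using mesh.pw_affine_node[of w k0] k0 by simp
      also have "\<dots> = 0" using lat.pw_affine_node[of e 0] k0 e0 by (simp add: w_def)
      finally have "(\<Sum>b\<in>bonds N. bond_var (deriv \<phi>) (\<lambda>k. y_qc (X k)) w b) = inner_h X f (pw_affine X w)"
        using assms(12) by (intro E_qc_stationary[of \<phi> F f] \<phi> wper)
      moreover have "(\<Sum>b\<in>bonds N. bond_var (deriv \<phi>) (\<lambda>k. y_qc (X k)) w b) = Q"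
        unfolding Q_def w_def[abs_def]
        by (rule sum_bond_var) (rule slope_mesh_period[of y_qc F, OF y(2)] eper)+
      ultimately show ?thesis by simp
    qed
    have "(A - 5 * \<kappa>) * M\<^sup>2 \<le> stress_sum (deriv \<phi>) (\<lambda>l. z l + e l) e - stress_sum (deriv \<phi>) z e"
      unfolding M2
    proof (rule coercivity[of z F e "deriv (deriv \<phi>)", OF zper eper neg \<kappa>0 _ mono mono])
      show "A \<le> deriv (deriv \<phi>) (bdiff N z l) + 2 * deriv (deriv \<phi>) (bdiff N z (l - 1) + bdiff N z l)
        + 2 * deriv (deriv \<phi>) (bdiff N z l + bdiff N z (l + 1))" for l
        using Acoeff[of l] by (simp add: A_coeff_def)
      show "\<bar>bdiff N e l\<bar> \<le> 2 * \<tau>0" for l using small[of l] \<tau> by linarith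
      show "\<bar>bdiff N e (l - 1) + bdiff N e l\<bar> \<le> 2 * \<tau>0" for l
        using small[of l] small[of "l - 1"] by linarith
    qed (rule S)+
    then have "A / 2 * M\<^sup>2 \<le> inner_eps N (nodal N f) e - stress_sum (deriv \<phi>) z e"
      using stat_a by (simp add: e_def \<kappa>_def)
    \<comment> \<open>Stationarity of the quasicontinuum solution, tested with the mesh interpolant
      of e, is inserted to split the residual into a force part and a stored part.\<close>
    also have "\<dots> = (inner_eps N (nodal N f) e - inner_h X f (pw_affine X w)) - (stress_sum (deriv \<phi>) z e - Q)"
      using stat_qc by simp
    also have "\<dots> \<le> (eta_f N f La Ra K X + eta_q N f La Ra K X) * M + eta N \<phi> La Ra K X y_qc * M"
      using force_residual[of e, OF eper e0] stored_residual[of y_qc F e \<phi>, OF y(1,2) eper]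
      unfolding M_def w_def[abs_def] Q_def z_def by linarith
    finally have "A / 2 * M * M \<le> R * M"
      by (simp add: R_def power2_eq_square algebra_simps)
    moreover have "0 \<le> M" unfolding M_def by (auto intro!: integral_nonneg lbm_integrable_on lbm_power2 lat.lbm_idx)
    moreover have "0 \<le> R" unfolding R_def by (intro add_nonneg_nonneg eta_nonneg eta_f_nonneg eta_q_nonneg)
    \<comment> \<open>One factor M is cancelled; for M = 0 the inequality is the nonnegativity of
      R.\<close>
    ultimately have "A / 2 * M \<le> R"
      by (cases "M = 0") (auto simp: mult_le_cancel_right)
    then have "M \<le> 2 / A * R" using A0 by (simp add: field_simps)
    moreover have "L2_norm Omega (\<lambda>x. deriv (lattice_interp N y_a) x - deriv (I_eps N y_qc) x) = M"
      unfolding M_def by (rule L2_norm_lattice_diff) (simp_all add: e_def[symmetric] z_def[symmetric] eper)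
    ultimately show "L2_norm Omega (\<lambda>x. deriv (lattice_interp N y_a) x - deriv (I_eps N y_qc) x)
         \<le> 2 / A_star N \<phi> (nodal N y_qc)
             * (eta N \<phi> La Ra K X y_qc + eta_f N f La Ra K X + eta_q N f La Ra K X)"
      by (simp add: R_def A_def z_def)
  qed
qed

end
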